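(* Let $X$ be a non-empty compact Hausdorff space, let $\sigma:X\to X$ be a homeomorphism, and write $\Sigma=(X,\sigma)$. Let $I$ be a primitive ideal of $\ell^1(\Sigma)$. (1)(a) If $I$ is the kernel of a finite dimensional algebraically irreducible representation of $\ell^1(\Sigma)$, then $I=\operatorname{Ker}(\pi_{x,\lambda})$ for some $x\in\mathrm{Per}(\sigma)$ and $\lambda\in\mathbb{T}$. Furthermore, $\pi_{x,\lambda}$ is a topologically irreducible involutive representation of $\ell^1(\Sigma)$ on a finite dimensional Hilbert space. (1)(b) If $I$ is the kernel of an infinite dimensional algebraically irreducible representation of $\ell^1(\Sigma)$, then there exists an infinite invariant subset $S$ of $X$ such that $$I=\bigcap_{x\in\mathrm{Per}(\sigma)\cap S,\ \lambda\in\mathbb{T}}\operatorname{Ker}(\pi_{x,\lambda})\ \cap\bigcap_{x\in\mathrm{Aper}(\sigma)\cap S}\operatorname{Ker}(\pi_x^2).$$ If $X$ is metrizable, then there exists $x\in\mathrm{Aper}(\sigma)$ such that $I=\operatorname{Ker}(\pi_x^2)$. Furthermore, all $\pi_{x,\lambda}$ that occur are topologically irreducible involutive representations of $\ell^1(\Sigma)$ on finite dimensional Hilbert spaces, and all $\pi_x^2$ that occur are topologically irreducible involutive representations of $\ell^1(\Sigma)$ on the Hilbert space $\ell^2(\mathbb{Z})$. (2) There exists a unital involutive representation $\pi$ of $\ell^1(\Sigma)$ on a Hilbert space such that $I=\operatorname{Ker}(\pi)$. (3) If $X$ is metrizable, then there exists a topologically irreducible involutive representation $\pi$ of $\ell^1(\Sigma)$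 on a Hilbert space such that $I=\operatorname{Ker}(\pi)$.
   Context: Let $\mathrm{C}(X)$ be the algebra of continuous complex-valued functions on $X$ with the supremum norm, and let $\alpha(f)=f\circ\sigma^{-1}$ for $f\in \mathrm{C}(X)$. The unital Banach $^\ast$-algebra $\ell^1(\Sigma)$ is the space of all $a:\mathbb{Z}\to \mathrm{C}(X)$ with $\|a\|:=\sum_{n\in\mathbb{Z}}\|a(n)\|<\infty$, with multiplication $(aa')(n)=\sum_{k\in\mathbb{Z}}a(k)\cdot\alpha^k(a'(n-k))$ and isometric involution $a^*(n)=\overline{\alpha^n(a(-n))}$. Let $\delta\in\ell^1(\Sigma)$ be the element with $\delta(1)$ the constant function $1$ and $\delta(m)=0$ for $m\neq 1$; then $\delta$ is invertible with $\delta^{-1}=\delta^*$. Regard $\mathrm{C}(X)$ as the subalgebra of elements supported at $0\in\mathbb{Z}$. Each $a\in\ell^1(\Sigma)$ is uniquely $a=\sum_{n\in\mathbb{Z}}f_n\delta^n$ with $f_n=a(n)\in \mathrm{C}(X)$, and $\delta f\delta^{-1}=f\circ\sigma^{-1}$ for $f\in \mathrm{C}(X)$. $\mathrm{Per}(\sigma)$ and $\mathrm{Aper}(\sigma)$ are the sets of periodic and aperiodic points of $\sigma$ in $X$ (a point $x$ is periodic if $\sigma^n x=x$ for some integer $n\ge 1$, its period being the least such $n$; otherwise it is aperiodic). A subset $S\subset X$ is invariant if $\sigma(S)=S$. $\mathbb{T}$ is the unit circle in $\mathbb{C}$. An algebraically irreducible representation of a complex algebra $A$ is a non-zero homomorphism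 from $A$ into the linear operators on a complex vector space $E$ such that the only invariant subspaces of $E$ are $\{0\}$ and $E$; it is finite (infinite) dimensional if $E$ is. A primitive ideal of $A$ is the kernel of an algebraically irreducible representation of $A$ (a purely algebraic notion). An involutive representation on a Hilbert space is a $^\ast$-homomorphism into the bounded operators; it is topologically irreducible if it is non-zero and the only closed invariant subspaces are trivial. The intersection of an empty family of ideals is $\ell^1(\Sigma)$. For $x\in\mathrm{Per}(\sigma)$ of period $p$ and $\lambda\in\mathbb{T}$, let $H_{x,\lambda}$ be a Hilbert space with orthonormal basis $e_0,\dots,e_{p-1}$. Then $\pi_{x,\lambda}$ is the unique involutive representation of $\ell^1(\Sigma)$ on $H_{x,\lambda}$ such that $\pi_{x,\lambda}(f)e_k=f(\sigma^k x)e_k$ for $f\in \mathrm{C}(X)$ and $0\le k\le p-1$, and $\pi_{x,\lambda}(\delta)=T_\lambda$, where $T_\lambda e_k=e_{k+1}$ for $0\le k\le p-2$ and $T_\lambda e_{p-1}=\lambda e_0$. For $x\in\mathrm{Aper}(\sigma)$, $\pi_x^2$ is the unital involutive representation of $\ell^1(\Sigma)$ on $\ell^2(\mathbb{Z})$ (with canonical orthonormal basis $(e_k)_{k\in\mathbb{Z}}$) given by $\pi_x^2\left(\sum_{n}f_n\delta^n\right)=\sum_{n}\pi_x^2(f_n)S^n$, where $S$ here denotes the right shift $Se_k=e_{k+1}$ and $\pi_x^2(f)e_k=f(\sigma^k x)e_k$ for $f\in \mathrm{C}(X)$, $k\in\mathbb{Z}$. *)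

theory Defs
  imports "HOL-Analysis.Analysis" "HOL-Library.Function_Algebras"
begin

section \<open>The algebra of continuous functions\<close>

text \<open>
  The space \<open>X\<close> is a type of class \<open>t2_space\<close> with compact universe. Then every continuous function
  is bounded and \<open>C(X)\<close> is the library type \<open>'x \<Rightarrow>\<^sub>C complex\<close> with its supremum norm. The library has
  no multiplication on that type, so the pointwise one is added here.
\<close>

instantiation bcontfun :: (topological_space, real_normed_algebra) real_normed_algebra
begin

definition times_bcontfun :: "('a \<Rightarrow>\<^sub>C 'b) \<Rightarrow> ('a \<Rightarrow>\<^sub>C 'b) \<Rightarrow> ('a \<Rightarrow>\<^sub>C 'b)"
  where "f * g = Bcontfun (\<lambda>x. apply_bcontfun f x * apply_bcontfun g x)"

lemma apply_bcontfun_times [simp]: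
  fixes f g :: "'a \<Rightarrow>\<^sub>C 'b"
  shows "apply_bcontfun (f * g) x = apply_bcontfun f x * apply_bcontfun g x"
proof -
  have "norm (apply_bcontfun f x * apply_bcontfun g x) \<le> norm f * norm g" for x
    by (rule order_trans[OF norm_mult_ineq]) (intro mult_mono norm_bounded norm_ge_zero)
  then have "(\<lambda>x. apply_bcontfun f x * apply_bcontfun g x) \<in> bcontfun"
    by (intro bcontfun_normI continuous_intros) auto
  then show ?thesis
    by (simp add: times_bcontfun_def Bcontfun_inverse)
qed

instance
proof
  fix f g :: "'a \<Rightarrow>\<^sub>C 'b"
  show "norm (f * g) \<le> norm f * norm g"
  proof (rule norm_bound)
    fix x
    show "norm (apply_bcontfun (f * g) x) \<le> norm f * norm g"
      unfolding apply_bcontfun_times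
      by (rule order_trans[OF norm_mult_ineq]) (intro mult_mono norm_bounded norm_ge_zero)
  qed
qed (auto intro!: bcontfun_eqI simp: algebra_simps)

end

definition cnj_bcontfun :: "('x::topological_space \<Rightarrow>\<^sub>C complex) \<Rightarrow> ('x \<Rightarrow>\<^sub>C complex)"
  where "cnj_bcontfun f = Bcontfun (\<lambda>x. cnj (apply_bcontfun f x))"

section \<open>Integer powers and periodic points\<close>

definition int_iterate :: "'s set \<Rightarrow> ('s \<Rightarrow> 's) \<Rightarrow> int \<Rightarrow> 's \<Rightarrow> 's"
  where "int_iterate S f n =
    (if 0 \<le> n then f ^^ nat n else inv_into S f ^^ nat (- n))"
  \<comment> \<open>the \<open>n\<close>-th power of a bijection \<open>f\<close> of \<open>S\<close> onto itself\<close>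

definition Per :: "('x \<Rightarrow> 'x) \<Rightarrow> 'x set"
  where "Per \<sigma> = {x. \<exists>n\<ge>1. (\<sigma> ^^ n) x = x}"

definition Aper :: "('x \<Rightarrow> 'x) \<Rightarrow> 'x set"
  where "Aper \<sigma> = - Per \<sigma>"

definition period :: "('x \<Rightarrow> 'x) \<Rightarrow> 'x \<Rightarrow> nat"
  where "period \<sigma> x = (LEAST n. 1 \<le> n \<and> (\<sigma> ^^ n) x = x)"

section \<open>The Banach star-algebra of the dynamical system\<close>

text \<open>
  Elements are functions \<open>a :: int \<Rightarrow> ('x \<Rightarrow>\<^sub>C complex)\<close> lying in the carrier \<open>l1\<close>; their sum is the
  pointwise sum of functions.
\<close>

definition l1 :: "(int \<Rightarrow> ('x::topological_space \<Rightarrow>\<^sub>C complex)) set"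
  where "l1 = {a. (\<lambda>n. norm (a n)) summable_on UNIV}"

definition alpha_pow ::
  "('x::topological_space \<Rightarrow> 'x) \<Rightarrow> int \<Rightarrow> ('x \<Rightarrow>\<^sub>C complex) \<Rightarrow> ('x \<Rightarrow>\<^sub>C complex)"
  where "alpha_pow \<sigma> k f = Bcontfun (\<lambda>x. apply_bcontfun f (int_iterate UNIV \<sigma> (- k) x))"
  \<comment> \<open>\<open>\<alpha>\<^sup>k(f) = f \<circ> \<sigma>\<^sup>-\<^sup>k\<close>; the argument of \<open>Bcontfun\<close> is bounded and continuous
     when \<open>\<sigma>\<close> is a homeomorphism\<close>

definition l1_scale ::
  "complex \<Rightarrow> (int \<Rightarrow> ('x::topological_space \<Rightarrow>\<^sub>C complex)) \<Rightarrow> (int \<Rightarrow> ('x \<Rightarrow>\<^sub>C complex))"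
  where "l1_scale c a = (\<lambda>n. const_bcontfun c * a n)"

definition l1_mult ::
  "('x::topological_space \<Rightarrow> 'x) \<Rightarrow> (int \<Rightarrow> ('x \<Rightarrow>\<^sub>C complex)) \<Rightarrow> (int \<Rightarrow> ('x \<Rightarrow>\<^sub>C complex))
     \<Rightarrow> (int \<Rightarrow> ('x \<Rightarrow>\<^sub>C complex))"
  where "l1_mult \<sigma> a b = (\<lambda>n. \<Sum>\<^sub>\<infinity>k. a k * alpha_pow \<sigma> k (b (n - k)))"

definition l1_star ::
  "('x::topological_space \<Rightarrow> 'x) \<Rightarrow> (int \<Rightarrow> ('x \<Rightarrow>\<^sub>C complex)) \<Rightarrow> (int \<Rightarrow> ('x \<Rightarrow>\<^sub>C complex))"
  where "l1_star \<sigma> a = (\<lambda>n. cnj_bcontfun (alpha_pow \<sigma> n (a (- n))))"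

definition l1_embed :: "('x::topological_space \<Rightarrow>\<^sub>C complex) \<Rightarrow> (int \<Rightarrow> ('x \<Rightarrow>\<^sub>C complex))"
  where "l1_embed f = (\<lambda>n. if n = 0 then f else 0)"

definition l1_one :: "int \<Rightarrow> ('x::topological_space \<Rightarrow>\<^sub>C complex)"
  where "l1_one = l1_embed (const_bcontfun 1)"

definition l1_delta :: "int \<Rightarrow> ('x::topological_space \<Rightarrow>\<^sub>C complex)"
  where "l1_delta = (\<lambda>n. if n = 1 then const_bcontfun 1 else 0)"

section \<open>Representations\<close>

text \<open>
  A representation space is a subspace \<open>E\<close> of an ambient complex vector space, given by a type of
  class \<open>ab_group_add\<close> with a scalar multiplication \<open>sc\<close>. Only the values of operators on \<open>E\<close> and of
  representations on \<open>l1\<close> matter.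
\<close>

definition linear_op_on :: "(complex \<Rightarrow> 'v::ab_group_add \<Rightarrow> 'v) \<Rightarrow> 'v set \<Rightarrow> ('v \<Rightarrow> 'v) \<Rightarrow> bool"
  where "linear_op_on sc E T \<longleftrightarrow>
    (\<forall>v\<in>E. T v \<in> E) \<and>
    (\<forall>u\<in>E. \<forall>v\<in>E. T (u + v) = T u + T v) \<and>
    (\<forall>c. \<forall>v\<in>E. T (sc c v) = sc c (T v))"

definition alg_rep ::
  "('x::topological_space \<Rightarrow> 'x) \<Rightarrow> (complex \<Rightarrow> 'v::ab_group_add \<Rightarrow> 'v) \<Rightarrow> 'v set
     \<Rightarrow> ((int \<Rightarrow> ('x \<Rightarrow>\<^sub>C complex)) \<Rightarrow> 'v \<Rightarrow> 'v) \<Rightarrow> bool"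
  where "alg_rep \<sigma> sc E \<pi> \<longleftrightarrow>
    vector_space sc \<and> module.subspace sc E \<and>
    (\<forall>a\<in>l1. linear_op_on sc E (\<pi> a)) \<and>
    (\<forall>a\<in>l1. \<forall>b\<in>l1. \<forall>v\<in>E. \<pi> (a + b) v = \<pi> a v + \<pi> b v) \<and>
    (\<forall>c. \<forall>a\<in>l1. \<forall>v\<in>E. \<pi> (l1_scale c a) v = sc c (\<pi> a v)) \<and>
    (\<forall>a\<in>l1. \<forall>b\<in>l1. \<forall>v\<in>E. \<pi> (l1_mult \<sigma> a b) v = \<pi> a (\<pi> b v))"

definition rep_kernel ::
  "'v::ab_group_add set \<Rightarrow> ((int \<Rightarrow> ('x::topological_space \<Rightarrow>\<^sub>C complex)) \<Rightarrow> 'v \<Rightarrow> 'v)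
     \<Rightarrow> (int \<Rightarrow> ('x \<Rightarrow>\<^sub>C complex)) set"
  where "rep_kernel E \<pi> = {a \<in> l1. \<forall>v\<in>E. \<pi> a v = 0}"

definition nonzero_rep ::
  "'v::ab_group_add set \<Rightarrow> ((int \<Rightarrow> ('x::topological_space \<Rightarrow>\<^sub>C complex)) \<Rightarrow> 'v \<Rightarrow> 'v) \<Rightarrow> bool"
  where "nonzero_rep E \<pi> \<longleftrightarrow> (\<exists>a\<in>l1. \<exists>v\<in>E. \<pi> a v \<noteq> 0)"

definition invariant_subspace ::
  "(complex \<Rightarrow> 'v::ab_group_add \<Rightarrow> 'v) \<Rightarrow> 'v set
     \<Rightarrow> ((int \<Rightarrow> ('x::topological_space \<Rightarrow>\<^sub>C complex)) \<Rightarrow> 'v \<Rightarrow> 'v) \<Rightarrow> 'v set \<Rightarrow> bool"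
  where "invariant_subspace sc E \<pi> V \<longleftrightarrow>
    module.subspace sc V \<and> V \<subseteq> E \<and> (\<forall>a\<in>l1. \<forall>v\<in>V. \<pi> a v \<in> V)"

definition alg_irreducible ::
  "('x::topological_space \<Rightarrow> 'x) \<Rightarrow> (complex \<Rightarrow> 'v::ab_group_add \<Rightarrow> 'v) \<Rightarrow> 'v set
     \<Rightarrow> ((int \<Rightarrow> ('x \<Rightarrow>\<^sub>C complex)) \<Rightarrow> 'v \<Rightarrow> 'v) \<Rightarrow> bool"
  where "alg_irreducible \<sigma> sc E \<pi> \<longleftrightarrow>
    alg_rep \<sigma> sc E \<pi> \<and> nonzero_rep E \<pi> \<and>
    (\<forall>V. invariant_subspace sc E \<pi> V \<longrightarrow> V = {0} \<or> V = E)"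

definition fin_dim :: "(complex \<Rightarrow> 'v::ab_group_add \<Rightarrow> 'v) \<Rightarrow> 'v set \<Rightarrow> bool"
  where "fin_dim sc E \<longleftrightarrow> (\<exists>B. finite B \<and> B \<subseteq> E \<and> module.span sc B = E)"

text \<open>
  In the next three definitions the type argument is the ambient type of the representation space.
  As hypotheses of a theorem, with a type variable as argument, they cover representations on all
  complex vector spaces.
\<close>

definition primitive_ideal ::
  "'v::ab_group_add itself \<Rightarrow> ('x::topological_space \<Rightarrow> 'x)
     \<Rightarrow> (int \<Rightarrow> ('x \<Rightarrow>\<^sub>C complex)) set \<Rightarrow> bool"
  where "primitive_ideal t \<sigma> I \<longleftrightarrow>
    (\<exists>(sc :: complex \<Rightarrow> 'v \<Rightarrow> 'v) E \<rho>. alg_irreducible \<sigma> sc E \<rho> \<and> I = rep_kernel E \<rho>)"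

definition kernel_of_fin_dim_irreducible ::
  "'v::ab_group_add itself \<Rightarrow> ('x::topological_space \<Rightarrow> 'x)
     \<Rightarrow> (int \<Rightarrow> ('x \<Rightarrow>\<^sub>C complex)) set \<Rightarrow> bool"
  where "kernel_of_fin_dim_irreducible t \<sigma> I \<longleftrightarrow>
    (\<exists>(sc :: complex \<Rightarrow> 'v \<Rightarrow> 'v) E \<rho>.
       alg_irreducible \<sigma> sc E \<rho> \<and> fin_dim sc E \<and> I = rep_kernel E \<rho>)"

definition kernel_of_inf_dim_irreducible ::
  "'v::ab_group_add itself \<Rightarrow> ('x::topological_space \<Rightarrow> 'x)
     \<Rightarrow> (int \<Rightarrow> ('x \<Rightarrow>\<^sub>C complex)) set \<Rightarrow> bool"
  where "kernel_of_inf_dim_irreducible t \<sigma> I \<longleftrightarrow>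
    (\<exists>(sc :: complex \<Rightarrow> 'v \<Rightarrow> 'v) E \<rho>.
       alg_irreducible \<sigma> sc E \<rho> \<and> \<not> fin_dim sc E \<and> I = rep_kernel E \<rho>)"

section \<open>Hilbert spaces and involutive representations\<close>

definition ip_norm :: "('v \<Rightarrow> 'v \<Rightarrow> complex) \<Rightarrow> 'v \<Rightarrow> real"
  where "ip_norm ip v = sqrt (Re (ip v v))"

definition ip_dist :: "'v::ab_group_add set \<Rightarrow> ('v \<Rightarrow> 'v \<Rightarrow> complex) \<Rightarrow> 'v \<Rightarrow> 'v \<Rightarrow> real"
  where "ip_dist H ip u v = (if u \<in> H \<and> v \<in> H then ip_norm ip (u - v) else 0)"
  \<comment> \<open>\<open>Metric_space\<close> asks for nonnegativity and symmetry on the whole type, hence the value 0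
     off \<open>H\<close>\<close>

locale hilbert_space = vector_space sc
  for sc :: "complex \<Rightarrow> 'v::ab_group_add \<Rightarrow> 'v" +
  fixes H :: "'v set" and ip :: "'v \<Rightarrow> 'v \<Rightarrow> complex"
  assumes subspace_H: "subspace H"
    and ip_add_left: "\<lbrakk>u \<in> H; v \<in> H; w \<in> H\<rbrakk> \<Longrightarrow> ip (u + v) w = ip u w + ip v w"
    and ip_scale_left: "\<lbrakk>u \<in> H; v \<in> H\<rbrakk> \<Longrightarrow> ip (sc c u) v = c * ip u v"
    and ip_commute: "\<lbrakk>u \<in> H; v \<in> H\<rbrakk> \<Longrightarrow> ip u v = cnj (ip v u)"
    and ip_pos: "\<lbrakk>v \<in> H; v \<noteq> 0\<rbrakk> \<Longrightarrow> 0 < Re (ip v v)"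
    and complete_H: "Metric_space.mcomplete H (ip_dist H ip)"

definition bounded_op_on ::
  "(complex \<Rightarrow> 'v::ab_group_add \<Rightarrow> 'v) \<Rightarrow> 'v set \<Rightarrow> ('v \<Rightarrow> 'v \<Rightarrow> complex) \<Rightarrow> ('v \<Rightarrow> 'v) \<Rightarrow> bool"
  where "bounded_op_on sc H ip T \<longleftrightarrow>
    linear_op_on sc H T \<and> (\<exists>C. \<forall>v\<in>H. ip_norm ip (T v) \<le> C * ip_norm ip v)"

definition involutive_rep ::
  "('x::topological_space \<Rightarrow> 'x) \<Rightarrow> (complex \<Rightarrow> 'v::ab_group_add \<Rightarrow> 'v) \<Rightarrow> 'v set
     \<Rightarrow> ('v \<Rightarrow> 'v \<Rightarrow> complex) \<Rightarrow> ((int \<Rightarrow> ('x \<Rightarrow>\<^sub>C complex)) \<Rightarrow> 'v \<Rightarrow> 'v) \<Rightarrow> bool"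
  where "involutive_rep \<sigma> sc H ip \<pi> \<longleftrightarrow>
    hilbert_space sc H ip \<and> alg_rep \<sigma> sc H \<pi> \<and>
    (\<forall>a\<in>l1. bounded_op_on sc H ip (\<pi> a)) \<and>
    (\<forall>a\<in>l1. \<forall>u\<in>H. \<forall>v\<in>H. ip (\<pi> a u) v = ip u (\<pi> (l1_star \<sigma> a) v))"

definition unital_rep ::
  "'v set \<Rightarrow> ((int \<Rightarrow> ('x::topological_space \<Rightarrow>\<^sub>C complex)) \<Rightarrow> 'v \<Rightarrow> 'v) \<Rightarrow> bool"
  where "unital_rep H \<pi> \<longleftrightarrow> (\<forall>v\<in>H. \<pi> l1_one v = v)"

definition top_irreducible ::
  "('x::topological_space \<Rightarrow> 'x) \<Rightarrow> (complex \<Rightarrow> 'v::ab_group_add \<Rightarrow> 'v) \<Rightarrow> 'v set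
     \<Rightarrow> ('v \<Rightarrow> 'v \<Rightarrow> complex) \<Rightarrow> ((int \<Rightarrow> ('x \<Rightarrow>\<^sub>C complex)) \<Rightarrow> 'v \<Rightarrow> 'v) \<Rightarrow> bool"
  where "top_irreducible \<sigma> sc H ip \<pi> \<longleftrightarrow>
    involutive_rep \<sigma> sc H ip \<pi> \<and> nonzero_rep H \<pi> \<and>
    (\<forall>V. invariant_subspace sc H \<pi> V \<and> closedin (Metric_space.mtopology H (ip_dist H ip)) V
       \<longrightarrow> V = {0} \<or> V = H)"

section \<open>The representations attached to points\<close>

text \<open>
  Both kinds of spaces consist of functions \<open>int \<Rightarrow> complex\<close>: all square-summable ones for an aperiodic
  point, and those supported in \<open>{0..<p}\<close> for a point of period \<open>p\<close>.
\<close>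

definition seq_scale :: "complex \<Rightarrow> (int \<Rightarrow> complex) \<Rightarrow> (int \<Rightarrow> complex)"
  where "seq_scale c v = (\<lambda>k. c * v k)"

definition seq_ip :: "(int \<Rightarrow> complex) \<Rightarrow> (int \<Rightarrow> complex) \<Rightarrow> complex"
  where "seq_ip u v = (\<Sum>\<^sub>\<infinity>k. u k * cnj (v k))"

definition seq_basis :: "int \<Rightarrow> (int \<Rightarrow> complex)"
  where "seq_basis k = (\<lambda>j. if j = k then 1 else 0)"

definition H_per :: "nat \<Rightarrow> (int \<Rightarrow> complex) set"
  where "H_per p = {v. \<forall>k. k \<notin> {0..<int p} \<longrightarrow> v k = 0}"

definition ell2 :: "(int \<Rightarrow> complex) set"
  where "ell2 = {v. (\<lambda>k. (cmod (v k))\<^sup>2) summable_on UNIV}"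

definition mult_op ::
  "('x::topological_space \<Rightarrow> 'x) \<Rightarrow> 'x \<Rightarrow> ('x \<Rightarrow>\<^sub>C complex) \<Rightarrow> (int \<Rightarrow> complex) \<Rightarrow> (int \<Rightarrow> complex)"
  where "mult_op \<sigma> x f v = (\<lambda>k. apply_bcontfun f (int_iterate UNIV \<sigma> k x) * v k)"

definition T_op :: "nat \<Rightarrow> complex \<Rightarrow> (int \<Rightarrow> complex) \<Rightarrow> (int \<Rightarrow> complex)"
  where "T_op p c v =
    (\<lambda>k. if k = 0 then c * v (int p - 1) else if 0 < k \<and> k < int p then v (k - 1) else 0)"

definition shift_op :: "(int \<Rightarrow> complex) \<Rightarrow> (int \<Rightarrow> complex)"
  where "shift_op v = (\<lambda>k. v (k - 1))"

text \<open>
  Both representations send \<open>\<Sum>\<^sub>n f\<^sub>n \<delta>\<^sup>n\<close> to \<open>\<Sum>\<^sub>n \<pi>(f\<^sub>n) U\<^sup>n\<close>, where \<open>U\<close> is the image of \<open>\<delta>\<close>. The latter sum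
  converges in operator norm, so its coordinates can be computed separately. For the periodic points
  this is the involutive representation determined by its values on \<open>C(X)\<close> and \<open>\<delta>\<close>; those values are
  checked in the lemmas at the end.
\<close>

definition pi_per ::
  "('x::topological_space \<Rightarrow> 'x) \<Rightarrow> 'x \<Rightarrow> complex
     \<Rightarrow> (int \<Rightarrow> ('x \<Rightarrow>\<^sub>C complex)) \<Rightarrow> (int \<Rightarrow> complex) \<Rightarrow> (int \<Rightarrow> complex)"
  where "pi_per \<sigma> x c a v =
    (\<lambda>k. \<Sum>\<^sub>\<infinity>n. mult_op \<sigma> x (a n)
       (int_iterate (H_per (period \<sigma> x)) (T_op (period \<sigma> x) c) n v) k)"

definition pi_aper ::
  "('x::topological_space \<Rightarrow> 'x) \<Rightarrow> 'x
     \<Rightarrow> (int \<Rightarrow> ('x \<Rightarrow>\<^sub>C complex)) \<Rightarrow> (int \<Rightarrow> complex) \<Rightarrow> (int \<Rightarrow> complex)"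
  where "pi_aper \<sigma> x a v =
    (\<lambda>k. \<Sum>\<^sub>\<infinity>n. mult_op \<sigma> x (a n) (int_iterate ell2 shift_op n v) k)"

lemma infsum_single_int:
  fixes g :: "int \<Rightarrow> complex"
  assumes "\<And>n. n \<noteq> m \<Longrightarrow> g n = 0"
  shows "(\<Sum>\<^sub>\<infinity>n. g n) = g m"
proof -
  have "(\<Sum>\<^sub>\<infinity>n. g n) = (\<Sum>\<^sub>\<infinity>n\<in>{m}. g n)"
    by (rule infsum_cong_neutral) (use assms in auto)
  then show ?thesis by simp
qed

lemma mult_op_basis:
  "mult_op \<sigma> x f (seq_basis k)
     = seq_scale (apply_bcontfun f (int_iterate UNIV \<sigma> k x)) (seq_basis k)"
  by (auto simp: mult_op_def seq_basis_def seq_scale_def)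

lemma T_op_basis:
  "\<lbrakk>0 \<le> k; k + 1 < int p\<rbrakk> \<Longrightarrow> T_op p c (seq_basis k) = seq_basis (k + 1)"
  "0 < p \<Longrightarrow> T_op p c (seq_basis (int p - 1)) = seq_scale c (seq_basis 0)"
  by (auto simp: T_op_def seq_basis_def seq_scale_def fun_eq_iff)

lemma shift_op_basis: "shift_op (seq_basis k) = seq_basis (k + 1)"
  by (auto simp: shift_op_def seq_basis_def)

lemma pi_per_embed: "pi_per \<sigma> x c (l1_embed f) v = mult_op \<sigma> x f v"
  unfolding pi_per_def
  by (rule ext, subst infsum_single_int[where m = 0])
     (auto simp: l1_embed_def mult_op_def int_iterate_def)

lemma pi_per_delta: "pi_per \<sigma> x c l1_delta v = T_op (period \<sigma> x) c v"
  unfolding pi_per_def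
  by (rule ext, subst infsum_single_int[where m = 1])
     (auto simp: l1_delta_def mult_op_def int_iterate_def)

lemma pi_aper_embed: "pi_aper \<sigma> x (l1_embed f) v = mult_op \<sigma> x f v"
  unfolding pi_aper_def
  by (rule ext, subst infsum_single_int[where m = 0])
     (auto simp: l1_embed_def mult_op_def int_iterate_def)

lemma pi_aper_delta: "pi_aper \<sigma> x l1_delta v = shift_op v"
  unfolding pi_aper_def
  by (rule ext, subst infsum_single_int[where m = 1])
     (auto simp: l1_delta_def mult_op_def int_iterate_def)

end

(*
  Let I be the kernel of an algebraically irreducible representation and S the zero set of the
  functions in I. Irreducibility and the Neumann series make I closed, so that I consists at least of
  the elements all of whose coefficients vanish on S, and primeness makes S topologically transitive.

  If S is infinite, transitivity and Baire's theorem make the aperiodic points of S dense in S.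
  Compressing an element of I by a bump function near such a point removes finitely many off-diagonal
  coefficients, and it follows that all coefficients of the element vanish there. Hence I is the
  intersection of the kernels belonging to the aperiodic points of S. If X is metrizable, a
  single point with dense orbit suffices.

  If S is finite, it is one periodic orbit, say of period p. Then the image of delta^p commutes with
  the representation, and the nonemptiness of its spectrum makes it a scalar c of modulus one. The
  ideal is determined by the orbit and c, hence equal to the kernel of the corresponding
  finite-dimensional representation.
*)
theory Submission
  imports Defs
begin

section \<open>Integer iterates\<close>

text \<open>The space E of an algebraically irreducible representation carries no topology, so every
  analytic fact about E has to be extracted from the norm of the algebra. The basic device: an
  element of norm below 1 has no nonzero fixed vector in E. Closedness of the kernel, the estimate
  at an aperiodic point and the lower bound for the quotient norm of a cyclic vector all come from
  exhibiting such a fixed vector. To obtain the scalar c, E receives the norm of l1 modulo the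
  annihilator of a vector; inverses are bounded by explicit representatives, and averaging
  resolvents over roots of unity yields the nonempty spectrum. The representations at periodic
  points, those at aperiodic points and the direct sums used when X need not be metrizable are all
  weighted permutation representations on some l^2(K), so one model serves for all of them. Equality
  of ideals over a periodic orbit is obtained by describing membership through coefficient
  conditions that mention only the orbit and c.\<close>

lemma int_iterate_0 [simp]: "int_iterate S f 0 u = u"
  by (simp add: int_iterate_def)

lemma int_iterate_1 [simp]: "int_iterate S f 1 u = f u"
  by (simp add: int_iterate_def)

lemma int_iterate_of_nat: "int_iterate S f (int n) u = (f ^^ n) u"
  by (simp add: int_iterate_def)

text \<open>Closed formulas for the powers of the shift and of \<open>T_op\<close> are verified
  through this lemma. Only the forward recursion has to be checked; injectivity of f on S gives the
  backward half.\<close>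

lemma int_iterate_unique:
  assumes "bij_betw f S S"
    and in_S: "\<And>n u. u \<in> S \<Longrightarrow> G n u \<in> S"
    and G0: "\<And>u. u \<in> S \<Longrightarrow> G 0 u = u"
    and GS: "\<And>n u. u \<in> S \<Longrightarrow> G (n + 1) u = f (G n u)"
    and u: "u \<in> S"
  shows "int_iterate S f n u = G n u"
proof -
  have pos: "(f ^^ m) u = G (int m) u" for m
  proof (induction m)
    case (Suc m)
    have "G (int (Suc m)) u = f (G (int m) u)"
      using GS[OF u, of "int m"] by (simp add: add.commute)
    with Suc show ?case by simp
  qed (simp add: G0 u)
  have neg: "(inv_into S f ^^ m) u = G (- int m) u" for m
  proof (induction m)
    case (Suc m)
    have "f (G (- int (Suc m)) u) = G (- int m) u"
      using GS[OF u, of "- int (Suc m)"] by simp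
    moreover have "inv_into S f (f (G (- int (Suc m)) u)) = G (- int (Suc m)) u"
      by (intro inv_into_f_f bij_betw_imp_inj_on[OF assms(1)] in_S u)
    ultimately show ?case using Suc by simp
  qed (use G0 u in simp)
  show ?thesis
  proof (cases "0 \<le> n")
    case True
    then show ?thesis using pos[of "nat n"] by (simp add: int_iterate_def)
  next
    case False
    then show ?thesis using neg[of "nat (- n)"] by (simp add: int_iterate_def)
  qed
qed

locale dynamical_system =
  fixes \<sigma> :: "'x::t2_space \<Rightarrow> 'x"
  assumes compact_space: "compact (UNIV :: 'x set)"
    and homeo: "homeomorphism UNIV UNIV \<sigma> (inv \<sigma>)"
begin

abbreviation it :: "int \<Rightarrow> 'x \<Rightarrow> 'x"
  where "it \<equiv> int_iterate UNIV \<sigma>"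

lemma inv_sigma [simp]: "inv \<sigma> (\<sigma> x) = x" "\<sigma> (inv \<sigma> x) = x"
  using homeo by (auto simp: homeomorphism_def)

lemma it_Suc: "it (n + 1) x = \<sigma> (it n x)"
proof -
  \<comment> \<open>At n = -1 the definition switches from powers of the inverse to powers of
    \<sigma>, hence the separate case.\<close>
  consider "0 \<le> n" | "n = - 1" | "n < - 1" by linarith
  then show ?thesis
  proof cases
    case 1
    then have "nat (n + 1) = Suc (nat n)" by simp
    with 1 show ?thesis by (simp add: int_iterate_def)
  next
    case 2
    then show ?thesis by (simp add: int_iterate_def)
  next
    case 3
    then have "nat (- n) = Suc (nat (- (n + 1)))" by simp
    with 3 show ?thesis by (simp add: int_iterate_def)
  qed
qed

lemma it_pred: "it (n - 1) x = inv \<sigma> (it n x)"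
  using it_Suc[of "n - 1" x] by simp

lemma it_add: "it (m + n) x = it m (it n x)"
proof (induction m rule: int_induct[where k = 0])
  case (step1 i)
  have "it (i + 1 + n) x = \<sigma> (it (i + n) x)"
    using it_Suc[of "i + n" x] by (simp add: algebra_simps)
  with step1 show ?case by (simp add: it_Suc)
next
  case (step2 i)
  have "it (i - 1 + n) x = inv \<sigma> (it (i + n) x)"
    using it_pred[of "i + n" x] by (simp add: algebra_simps)
  with step2 show ?case by (simp add: it_pred)
qed simp

lemma it_neg_cancel [simp]: "it (- n) (it n x) = x" "it n (it (- n) x) = x"
  using it_add[of "- n" n x] it_add[of n "- n" x] by auto

lemma continuous_it: "continuous_on A (it n)"
proof -
  have c: "continuous_on UNIV \<sigma>" "continuous_on UNIV (inv \<sigma>)"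
    using homeo by (auto simp: homeomorphism_def)
  have "continuous_on UNIV (f ^^ m)" if "continuous_on UNIV f" for f :: "'x \<Rightarrow> 'x" and m
  proof (induction m)
    case (Suc m)
    then show ?case
      using continuous_on_compose2[OF that Suc] by (simp add: o_def)
  qed (simp add: id_def)
  from this[OF c(1)] this[OF c(2)] have "continuous_on UNIV (it n)"
    by (auto simp: int_iterate_def[abs_def])
  then show ?thesis using continuous_on_subset by blast
qed

lemma open_it_vimage: "open V \<Longrightarrow> open (it n -` V)"
  using continuous_it[of UNIV n] by (simp add: open_vimage)

lemma it_periodic_multiple:
  assumes "it n x = x"
  shows "it (n * m) x = x"
proof (induction m rule: int_induct[where k = 0])
  case (step1 i)
  then show ?case using assms by (simp add: algebra_simps it_add)
next
  case (step2 i)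
  have "it (n * i - n) x = it (- n) (it (n * i) x)"
    using it_add[of "- n" "n * i" x] by simp
  then show ?case using step2 assms by (metis it_neg_cancel(1) right_diff_distrib mult.right_neutral)
qed simp

lemma Per_iff: "x \<in> Per \<sigma> \<longleftrightarrow> (\<exists>n. n \<noteq> 0 \<and> it n x = x)"
proof
  assume "x \<in> Per \<sigma>"
  then obtain n where "n \<ge> 1" "(\<sigma> ^^ n) x = x" by (auto simp: Per_def)
  then show "\<exists>n. n \<noteq> 0 \<and> it n x = x"
    by (intro exI[of _ "int n"]) (simp add: int_iterate_of_nat)
next
  assume "\<exists>n. n \<noteq> 0 \<and> it n x = x"
  then obtain n where n: "n \<noteq> 0" "it n x = x" by blast
  \<comment> \<open>Multiplying the exponent by \<open>sgn n\<close> turns a negative return time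
    into a positive one.\<close>
  have "it \<bar>n\<bar> x = x"
    using it_periodic_multiple[OF n(2), of "sgn n"] by (simp add: abs_sgn mult.commute)
  then have "(\<sigma> ^^ nat \<bar>n\<bar>) x = x" by (simp add: int_iterate_def)
  then show "x \<in> Per \<sigma>" using n(1) unfolding Per_def
    by (intro CollectI exI[of _ "nat \<bar>n\<bar>"]) simp
qed

lemma Per_invariant: "it n x \<in> Per \<sigma> \<longleftrightarrow> x \<in> Per \<sigma>"
proof -
  have "it n y \<in> Per \<sigma>" if y: "y \<in> Per \<sigma>" for n y
  proof -
    from y obtain m where "m \<noteq> 0" "it m y = y" by (auto simp: Per_iff)
    then have "it m (it n y) = it n y" by (metis it_add add.commute)
    with \<open>m \<noteq> 0\<close> show ?thesis by (auto simp: Per_iff)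
  qed
  from this[of x n] this[of "it n x" "- n"] show ?thesis by auto
qed

lemma it_inj_Aper: "x \<in> Aper \<sigma> \<Longrightarrow> it m x = it n x \<longleftrightarrow> m = n"
proof
  assume x: "x \<in> Aper \<sigma>" and eq: "it m x = it n x"
  have "it (m - n) x = it (- n) (it m x)" using it_add[of "- n" m x] by simp
  with eq have "it (m - n) x = x" by simp
  with x show "m = n" unfolding Aper_def Per_iff by (metis Compl_iff Per_iff eq_iff_diff_eq_0)
qed simp

lemma period_pos: "x \<in> Per \<sigma> \<Longrightarrow> 0 < period \<sigma> x"
  and it_period: "x \<in> Per \<sigma> \<Longrightarrow> it (int (period \<sigma> x)) x = x"
  and period_least: "x \<in> Per \<sigma> \<Longrightarrow> 0 < n \<Longrightarrow> it n x = x \<Longrightarrow> int (period \<sigma> x) \<le> n"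
proof -
  assume "x \<in> Per \<sigma>"
  then have ex: "\<exists>n. 1 \<le> n \<and> (\<sigma> ^^ n) x = x" by (auto simp: Per_def)
  from LeastI_ex[OF ex] show "0 < period \<sigma> x" "it (int (period \<sigma> x)) x = x"
    by (auto simp: period_def int_iterate_of_nat)
  assume "0 < n" "it n x = x"
  then have "1 \<le> nat n \<and> (\<sigma> ^^ nat n) x = x" by (auto simp: int_iterate_def)
  then have "period \<sigma> x \<le> nat n" unfolding period_def by (rule Least_le)
  with \<open>0 < n\<close> show "int (period \<sigma> x) \<le> n" by linarith
qed

lemma it_eq_iff_mod_period:
  assumes x: "x \<in> Per \<sigma>"
  shows "it m x = it n x \<longleftrightarrow> m mod int (period \<sigma> x) = n mod int (period \<sigma> x)"
proof -
  let ?p = "int (period \<sigma> x)"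
  have p: "0 < ?p" using period_pos[OF x] by simp
  have red: "it k x = it (k mod ?p) x" for k
  proof -
    have "it k x = it (k mod ?p) (it (?p * (k div ?p)) x)"
      using it_add[of "k mod ?p" "?p * (k div ?p)" x] by simp
    then show ?thesis by (simp add: it_periodic_multiple[OF it_period[OF x]])
  qed
  \<comment> \<open>Two exponents in [0, p) with the same value would differ by a return time
    smaller than the period.\<close>
  have lt: "\<not> i < j" if "it i x = it j x" "0 \<le> i" "j < ?p" for i j
  proof
    assume "i < j"
    have "it (j - i) x = it (- i) (it j x)" using it_add[of "- i" j x] by simp
    with that(1) have "it (j - i) x = x" by (metis it_neg_cancel(1))
    from period_least[OF x _ this] \<open>i < j\<close> that(2,3) show False by simp
  qed
  show ?thesis
  proof
    assume "it m x = it n x"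
    then have eq: "it (m mod ?p) x = it (n mod ?p) x" using red by metis
    from lt[OF eq] lt[OF eq[symmetric]] p show "m mod ?p = n mod ?p"
      by (meson linorder_less_linear pos_mod_bound pos_mod_sign)
  qed (use red in metis)
qed

end

section \<open>The Banach algebra of a dynamical system\<close>

text \<open>Completeness of C(X) makes absolutely summable families of coefficients summable; the
  convolution series rest on it. A Cauchy sequence converges uniformly, and a uniform limit of
  bounded continuous functions is again one.\<close>

instance bcontfun :: (topological_space, complete_space) complete_space
proof
  fix f :: "nat \<Rightarrow> ('a, 'b) bcontfun"
  assume "Cauchy f"
  then obtain g where "uniform_limit UNIV (\<lambda>n. apply_bcontfun (f n)) g sequentially"
    using uniformly_convergent_eq_cauchy[of "\<lambda>_. True" f]
    unfolding Cauchy_def uniform_limit_sequentially_iff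
    by (metis dist_fun_lt_imp_dist_val_lt)
  from uniform_limit_bcontfunE[OF this sequentially_bot]
  obtain l' where "g = apply_bcontfun l'" "(f \<longlonglongrightarrow> l')" by metis
  then show "convergent f"
    by (intro convergentI)
qed

instance bcontfun :: (topological_space, banach) banach ..

text \<open>Fubini for a nonnegative double series: for fixed k the inner sum over n is a translate
  of the sum of g. The order of the pair (n, k) is the one in which the coefficients of a product
  arise.\<close>

lemma convolution_summable:
  fixes f g :: "int \<Rightarrow> real"
  assumes f: "f summable_on UNIV" and g: "g summable_on UNIV"
    and nonneg: "\<And>k. 0 \<le> f k" "\<And>k. 0 \<le> g k"
  shows "(\<lambda>(n, k). f k * g (n - k)) summable_on UNIV \<times> UNIV"
    and "(\<Sum>\<^sub>\<infinity>n. \<Sum>\<^sub>\<infinity>k. f k * g (n - k)) = (\<Sum>\<^sub>\<infinity>k. f k) * (\<Sum>\<^sub>\<infinity>k. g k)"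
proof -
  have inner: "((\<lambda>n. f k * g (n - k)) has_sum f k * (\<Sum>\<^sub>\<infinity>k. g k)) UNIV" for k
  proof (rule has_sum_cmult_right)
    have "((\<lambda>n. g (n - k)) has_sum (\<Sum>\<^sub>\<infinity>k. g k)) UNIV \<longleftrightarrow> (g has_sum (\<Sum>\<^sub>\<infinity>k. g k)) UNIV"
      by (rule has_sum_reindex_bij_betw) (auto intro!: bij_betwI[of _ _ _ "\<lambda>n. n + k"])
    then show "((\<lambda>n. g (n - k)) has_sum (\<Sum>\<^sub>\<infinity>k. g k)) UNIV" using g by simp
  qed
  have outer: "((\<lambda>k. f k * (\<Sum>\<^sub>\<infinity>k. g k)) has_sum (\<Sum>\<^sub>\<infinity>k. f k) * (\<Sum>\<^sub>\<infinity>k. g k)) UNIV"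
    using f by (intro has_sum_cmult_left) simp
  have "(\<lambda>(k, n). f k * g (n - k)) summable_on UNIV \<times> UNIV"
    by (rule summable_on_SigmaI[where g = "\<lambda>k. f k * (\<Sum>\<^sub>\<infinity>k. g k)"])
       (use inner outer nonneg in \<open>auto simp: summable_on_def\<close>)
  then show sw: "(\<lambda>(n, k). f k * g (n - k)) summable_on UNIV \<times> UNIV"
    by (subst summable_on_swap) (simp add: case_prod_unfold)
  have "(\<Sum>\<^sub>\<infinity>n. \<Sum>\<^sub>\<infinity>k. f k * g (n - k)) = (\<Sum>\<^sub>\<infinity>k. \<Sum>\<^sub>\<infinity>n. f k * g (n - k))"
    by (rule infsum_swap_banach[OF sw])
  also have "\<dots> = (\<Sum>\<^sub>\<infinity>k. f k * (\<Sum>\<^sub>\<infinity>k. g k))"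
    by (intro infsum_cong infsumI inner)
  also have "\<dots> = (\<Sum>\<^sub>\<infinity>k. f k) * (\<Sum>\<^sub>\<infinity>k. g k)"
    by (rule infsumI[OF outer])
  finally show "(\<Sum>\<^sub>\<infinity>n. \<Sum>\<^sub>\<infinity>k. f k * g (n - k)) = (\<Sum>\<^sub>\<infinity>k. f k) * (\<Sum>\<^sub>\<infinity>k. g k)" .
qed

lemma infsum_single:
  fixes g :: "'i \<Rightarrow> 'b::{comm_monoid_add, t2_space}"
  assumes "\<And>n. n \<noteq> m \<Longrightarrow> g n = 0"
  shows "(\<Sum>\<^sub>\<infinity>n. g n) = g m"
proof -
  have "(\<Sum>\<^sub>\<infinity>n. g n) = (\<Sum>\<^sub>\<infinity>n\<in>{m}. g n)"
    by (rule infsum_cong_neutral) (use assms in auto)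
  then show ?thesis by simp
qed

lemma apply_const_bcontfun [simp]: "apply_bcontfun (const_bcontfun c) x = c"
  by (simp add: const_bcontfun.rep_eq)

lemma bounded_linear_apply_bcontfun:
  "bounded_linear (\<lambda>f :: 'a::topological_space \<Rightarrow>\<^sub>C 'b::real_normed_vector. apply_bcontfun f x)"
  by (rule bounded_linear_intro[where K = 1])
     (auto simp: plus_bcontfun.rep_eq scaleR_bcontfun.rep_eq norm_bounded)

lemma infsum_apply_bcontfun:
  fixes f :: "'i \<Rightarrow> 'a::topological_space \<Rightarrow>\<^sub>C 'b::real_normed_vector"
  assumes "f summable_on A"
  shows "apply_bcontfun (infsum f A) x = (\<Sum>\<^sub>\<infinity>i\<in>A. apply_bcontfun (f i) x)"
    and "(\<lambda>i. apply_bcontfun (f i) x) summable_on A"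
  using has_sum_bounded_linear[OF bounded_linear_apply_bcontfun, OF has_sum_infsum[OF assms], of x]
  by (auto simp: infsumI summable_on_def)

section \<open>The norm of l1 and the dense subspace of finite sums\<close>

definition l1_norm :: "(int \<Rightarrow> ('x::topological_space \<Rightarrow>\<^sub>C complex)) \<Rightarrow> real"
  where "l1_norm a = (\<Sum>\<^sub>\<infinity>n. norm (a n))"

text \<open>The element f \<delta>^n of the standard expansion.\<close>

definition l1_monom :: "('x::topological_space \<Rightarrow>\<^sub>C complex) \<Rightarrow> int \<Rightarrow> int \<Rightarrow> ('x \<Rightarrow>\<^sub>C complex)"
  where "l1_monom f n = (\<lambda>m. if m = n then f else 0)"

lemma l1_embed_eq_monom: "l1_embed f = l1_monom f 0"
  by (simp add: l1_embed_def l1_monom_def fun_eq_iff)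

lemma l1_one_eq_monom: "l1_one = l1_monom (const_bcontfun 1) 0"
  by (simp add: l1_one_def l1_embed_eq_monom)

lemma norm_summable_l1: "a \<in> l1 \<Longrightarrow> (\<lambda>n. norm (a n)) summable_on UNIV"
  by (simp add: l1_def)

lemma l1_norm_ge_0: "0 \<le> l1_norm a"
  by (simp add: l1_norm_def infsum_nonneg)

lemma l1_has_norm: "a \<in> l1 \<Longrightarrow> ((\<lambda>n. norm (a n)) has_sum l1_norm a) UNIV"
  by (simp add: l1_norm_def l1_def)

lemma l1I_norm_le:
  assumes "(g has_sum c) UNIV" and "\<And>n. norm (a n) \<le> g n"
  shows "a \<in> l1" "l1_norm a \<le> c"
proof -
  show *: "a \<in> l1"
    unfolding l1_def mem_Collect_eq
    by (rule Infinite_Sum.abs_summable_on_comparison_test'[OF has_sum_imp_summable[OF assms(1)]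
        assms(2)])
  show "l1_norm a \<le> c"
    by (rule has_sum_mono[OF l1_has_norm[OF *] assms(1)]) (rule assms(2))
qed

lemma norm_le_l1_norm:
  assumes "a \<in> l1"
  shows "norm (a n) \<le> l1_norm a"
  using finite_sum_le_has_sum[OF l1_has_norm[OF assms], of "{n}"] by simp

lemma l1_monom_has_sum: "((\<lambda>m. norm (l1_monom f n m)) has_sum norm f) UNIV"
proof -
  have "((\<lambda>m. norm (l1_monom f n m)) has_sum norm f) {n}"
    by (rule has_sum_finiteI) (auto simp: l1_monom_def)
  then show ?thesis
    by (subst has_sum_cong_neutral[where T = "{n}" and g = "\<lambda>m. norm (l1_monom f n m)"])
       (auto simp: l1_monom_def)
qed

lemma l1_monom_in [simp, intro]: "l1_monom f n \<in> l1"
  and l1_norm_monom [simp]: "l1_norm (l1_monom f n) = norm f"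
  using l1_monom_has_sum[of f n] by (auto simp: l1_def l1_norm_def summable_on_def infsumI)

lemma l1_embed_in [simp, intro]: "l1_embed f \<in> l1"
  and l1_one_in [simp, intro]: "l1_one \<in> l1"
  by (simp_all add: l1_embed_eq_monom l1_one_eq_monom)

lemma l1_zero [simp, intro]: "0 \<in> l1"
  by (simp add: l1_def)

lemma l1_norm_zero [simp]: "l1_norm 0 = 0"
  by (simp add: l1_norm_def)

lemma l1_add [intro]: "a \<in> l1 \<Longrightarrow> b \<in> l1 \<Longrightarrow> a + b \<in> l1"
  and l1_norm_add_le: "a \<in> l1 \<Longrightarrow> b \<in> l1 \<Longrightarrow> l1_norm (a + b) \<le> l1_norm a + l1_norm b"
  using l1I_norm_le[OF has_sum_add[OF l1_has_norm l1_has_norm], of a b "a + b"]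
  by (auto simp: norm_triangle_ineq)

lemma norm_const_bcontfun_le: "norm (const_bcontfun c :: 'x::topological_space \<Rightarrow>\<^sub>C complex) \<le> cmod c"
  by (rule norm_bound) simp

lemma norm_const_bcontfun_mult: "norm (const_bcontfun c * f) = cmod c * norm f"
  for f :: "'x::topological_space \<Rightarrow>\<^sub>C complex"
proof (rule antisym)
  show le: "norm (const_bcontfun c * f) \<le> cmod c * norm f" for c and f :: "'x \<Rightarrow>\<^sub>C complex"
    by (rule norm_bound) (auto simp: norm_mult intro!: mult_left_mono norm_bounded)
  show "cmod c * norm f \<le> norm (const_bcontfun c * f)"
  proof (cases "c = 0")
    case False
    have "f = const_bcontfun (inverse c) * (const_bcontfun c * f)"
      by (rule bcontfun_eqI) (simp add: False)
    with le[of "inverse c" "const_bcontfun c * f"]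
    have "norm f \<le> cmod (inverse c) * norm (const_bcontfun c * f)" by simp
    with False show ?thesis by (simp add: norm_divide field_simps)
  qed simp
qed

lemma l1_scale_in [intro]: "a \<in> l1 \<Longrightarrow> l1_scale c a \<in> l1"
  and l1_norm_scale: "a \<in> l1 \<Longrightarrow> l1_norm (l1_scale c a) = cmod c * l1_norm a"
proof -
  assume "a \<in> l1"
  from has_sum_cmult_right[OF l1_has_norm[OF this], of "cmod c"]
  have "((\<lambda>n. norm (l1_scale c a n)) has_sum cmod c * l1_norm a) UNIV"
    by (simp add: l1_scale_def norm_const_bcontfun_mult)
  then show "l1_scale c a \<in> l1" "l1_norm (l1_scale c a) = cmod c * l1_norm a"
    by (auto simp: l1_def l1_norm_def summable_on_def infsumI)
qed

lemma l1_scale_minus_one: "l1_scale (- 1) a = - a"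
  by (auto simp: l1_scale_def fun_eq_iff uminus_bcontfun.rep_eq intro!: bcontfun_eqI)

lemma l1_uminus [intro]: "a \<in> l1 \<Longrightarrow> - a \<in> l1"
  by (simp add: l1_def)

lemma l1_norm_uminus [simp]: "l1_norm (- a) = l1_norm a"
  by (simp add: l1_norm_def)

lemma l1_diff [intro]: "a \<in> l1 \<Longrightarrow> b \<in> l1 \<Longrightarrow> a - b \<in> l1"
  using l1_add[of a "- b"] by auto

lemma l1_sum [intro]: "(\<And>i. i \<in> F \<Longrightarrow> a i \<in> l1) \<Longrightarrow> (\<Sum>i\<in>F. a i) \<in> l1"
  by (induction F rule: infinite_finite_induct) auto

lemma sum_fun_apply: "(\<Sum>i\<in>F. a i) n = (\<Sum>i\<in>F. a i n)"
  for a :: "'i \<Rightarrow> 'n \<Rightarrow> 'b::comm_monoid_add"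
  by (induction F rule: infinite_finite_induct) auto

text \<open>Density of the finite sums of monomials. The same F also bounds the tail of the norms,
  which is the form used in \<open>ker_zero_coefficient\<close>.\<close>

lemma l1_finite_approx:
  assumes a: "a \<in> l1" and "0 < \<epsilon>"
  obtains F where "finite F" "l1_norm (a - (\<Sum>n\<in>F. l1_monom (a n) n)) < \<epsilon>"
    "(\<Sum>\<^sub>\<infinity>n\<in>-F. norm (a n)) < \<epsilon>"
proof -
  obtain F where F: "finite F" "dist (\<Sum>n\<in>F. norm (a n)) (l1_norm a) \<le> \<epsilon> / 2"
    using has_sum_finite_approximation[OF l1_has_norm[OF a], of "\<epsilon> / 2"] assms(2) by auto
  let ?b = "a - (\<Sum>n\<in>F. l1_monom (a n) n)"
  have b: "?b m = (if m \<in> F then 0 else a m)" for m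
    using F(1) by (auto simp: sum_fun_apply l1_monom_def)
  have "((\<lambda>n. norm (a n)) has_sum (\<Sum>n\<in>F. norm (a n))) F"
    using F(1) by simp
  from has_sum_Diff[OF l1_has_norm[OF a] this]
  have *: "((\<lambda>n. norm (a n)) has_sum l1_norm a - (\<Sum>n\<in>F. norm (a n))) (- F)"
    by (simp add: Compl_eq_Diff_UNIV)
  then have "((\<lambda>n. norm (?b n)) has_sum l1_norm a - (\<Sum>n\<in>F. norm (a n))) UNIV"
    by (subst has_sum_cong_neutral[where T = "- F" and g
        = "\<lambda>n. norm (a n)"]) (simp_all add: b del: minus_apply)
  then have "l1_norm ?b = l1_norm a - (\<Sum>n\<in>F. norm (a n))"
    by (simp add: l1_norm_def infsumI)
  moreover have "(\<Sum>\<^sub>\<infinity>n\<in>-F. norm (a n)) = l1_norm a - (\<Sum>n\<in>F. norm (a n))"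
    by (rule infsumI[OF *])
  moreover have "l1_norm a - (\<Sum>n\<in>F. norm (a n)) < \<epsilon>"
    using F(2) assms(2) unfolding dist_real_def by linarith
  ultimately show ?thesis using that[OF F(1)] by simp
qed

text \<open>Density of the finite sums, packaged as an induction rule. The limit case only asks for
  approximants satisfying P, which suits membership in closed ideals.\<close>

lemma l1_induct [consumes 1, case_names monom add limit]:
  assumes a: "a \<in> l1"
    and monom: "\<And>f n. P (l1_monom f n)"
    and add: "\<And>a b. a \<in> l1 \<Longrightarrow> b \<in> l1 \<Longrightarrow> P a \<Longrightarrow> P b \<Longrightarrow> P (a + b)"
    and limit: "\<And>a. a \<in> l1 \<Longrightarrow> (\<And>\<epsilon>. 0 < \<epsilon> \<Longrightarrow> \<exists>b\<in>l1. P b \<and> l1_norm (a - b) < \<epsilon>) \<Longrightarrow> P a"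
  shows "P a"
proof (rule limit[OF a])
  fix \<epsilon> :: real assume "0 < \<epsilon>"
  obtain F where F: "finite F" "l1_norm (a - (\<Sum>n\<in>F. l1_monom (a n) n)) < \<epsilon>"
    using l1_finite_approx[OF a \<open>0 < \<epsilon>\<close>] by blast
  have "P 0" using monom[of 0 0] by (simp add: l1_monom_def zero_fun_def)
  from F(1) this have "P (\<Sum>n\<in>F. l1_monom (a n) n)"
    by (induction F rule: finite_induct) (auto intro!: add monom)
  with F(2) show "\<exists>b\<in>l1. P b \<and> l1_norm (a - b) < \<epsilon>" by blast
qed

section \<open>Convolution, involution and the Neumann series\<close>

context dynamical_system
begin

lemma apply_Bcontfun:
  fixes g :: "'x \<Rightarrow> complex"
  assumes "continuous_on UNIV g"
  shows "apply_bcontfun (Bcontfun g) = g"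
proof (rule Bcontfun_inverse)
  have "compact (range g)" by (rule compact_continuous_image[OF assms compact_space])
  then show "g \<in> bcontfun" using assms by (simp add: bcontfun_def compact_imp_bounded)
qed

lemma apply_alpha_pow [simp]:
  "apply_bcontfun (alpha_pow \<sigma> k f) x = apply_bcontfun f (it (- k) x)"
proof -
  have "continuous_on UNIV (\<lambda>x. apply_bcontfun f (it (- k) x))"
    by (rule continuous_on_compose2[OF continuous_on_apply_bcontfun[of UNIV] continuous_it]) auto
  then show ?thesis by (simp add: alpha_pow_def apply_Bcontfun)
qed

lemma apply_cnj_bcontfun [simp]: "apply_bcontfun (cnj_bcontfun f) x = cnj (apply_bcontfun f x)"
  for f :: "'x \<Rightarrow>\<^sub>C complex"
  by (simp add: cnj_bcontfun_def apply_Bcontfun continuous_intros)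

lemma norm_alpha_pow_le: "norm (alpha_pow \<sigma> k f) \<le> norm f"
  by (rule norm_bound) (simp add: norm_bounded)

lemma alpha_pow_diff: "alpha_pow \<sigma> k (f - g) = alpha_pow \<sigma> k f - alpha_pow \<sigma> k g"
  by (rule bcontfun_eqI) (simp add: minus_bcontfun.rep_eq)

lemma alpha_pow_zero [simp]: "alpha_pow \<sigma> k 0 = 0"
  by (rule bcontfun_eqI) (simp add: zero_bcontfun.rep_eq)

lemma l1_star_in [intro]:
  assumes "a \<in> l1"
  shows "l1_star \<sigma> a \<in> l1"
proof -
  have "((\<lambda>n. norm (a (- n))) has_sum l1_norm a) UNIV"
    using has_sum_reindex_bij_betw[of uminus UNIV UNIV "\<lambda>n. norm (a n)" "l1_norm a"]
      l1_has_norm[OF assms] by (simp add: bij_uminus)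
  moreover have "norm (l1_star \<sigma> a n) \<le> norm (a (- n))" for n
    by (rule norm_bound) (simp add: l1_star_def norm_bounded)
  ultimately show ?thesis by (rule l1I_norm_le)
qed

lemma apply_l1_star: "apply_bcontfun (l1_star \<sigma> a n) x = cnj (apply_bcontfun (a (- n)) (it (- n) x))"
  by (simp add: l1_star_def)

lemma norm_mult_term_le: "norm (a k * alpha_pow \<sigma> k (b m)) \<le> norm (a k) * norm (b m)"
  by (rule order_trans[OF norm_mult_ineq]) (intro mult_left_mono norm_alpha_pow_le norm_ge_zero)

lemma mult_terms_summable:
  assumes "a \<in> l1" "b \<in> l1"
  shows "(\<lambda>k. norm (a k * alpha_pow \<sigma> k (b (n - k)))) summable_on UNIV"
proof -
  have "(\<lambda>(n, k). norm (a k) * norm (b (n - k))) summable_on UNIV \<times> UNIV"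
    using assms by (intro convolution_summable norm_summable_l1) auto
  from summable_on_SigmaD1[OF this, of n]
  show ?thesis
    by (intro Infinite_Sum.abs_summable_on_comparison_test'[where g
        = "\<lambda>k. norm (a k) * norm (b (n - k))"]
        norm_mult_term_le) simp
qed

lemmas mult_terms_summable' = abs_summable_summable[OF mult_terms_summable]

lemma apply_l1_mult:
  assumes "a \<in> l1" "b \<in> l1"
  shows "apply_bcontfun (l1_mult \<sigma> a b n) x
    = (\<Sum>\<^sub>\<infinity>k. apply_bcontfun (a k) x * apply_bcontfun (b (n - k)) (it (- k) x))"
  unfolding l1_mult_def
  by (subst infsum_apply_bcontfun(1)[OF mult_terms_summable'[OF assms]]) simp

text \<open>Since \<alpha>^k does not increase norms, each coefficient of the product is dominated
  by the convolution of the two norm sequences, whose total \<open>convolution_summable\<close>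
  evaluates.\<close>

lemma l1_mult_in [intro]: "a \<in> l1 \<Longrightarrow> b \<in> l1 \<Longrightarrow> l1_mult \<sigma> a b \<in> l1"
  and l1_norm_mult_le: "a \<in> l1 \<Longrightarrow> b \<in> l1 \<Longrightarrow> l1_norm (l1_mult \<sigma> a b) \<le> l1_norm a * l1_norm b"
proof -
  assume ab: "a \<in> l1" "b \<in> l1"
  let ?g = "\<lambda>n. \<Sum>\<^sub>\<infinity>k. norm (a k) * norm (b (n - k))"
  have sm: "(\<lambda>(n, k). norm (a k) * norm (b (n - k))) summable_on UNIV \<times> UNIV"
    using ab by (intro convolution_summable norm_summable_l1) auto
  have "(?g has_sum l1_norm a * l1_norm b) UNIV"
    using summable_on_Sigma_banach[OF sm] convolution_summable(2)[of "\<lambda>k. norm (a k)" "\<lambda>k. norm (b k)"]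
      ab by (simp add: has_sum_iff l1_norm_def norm_summable_l1)
  moreover have "norm (l1_mult \<sigma> a b n) \<le> ?g n" for n
    unfolding l1_mult_def
  proof (rule norm_infsum_le[OF has_sum_infsum has_sum_infsum])
    show "(\<lambda>k. norm (a k) * norm (b (n - k))) summable_on UNIV"
      using summable_on_SigmaD1[OF sm, of n] by simp
  qed (auto intro: norm_mult_term_le mult_terms_summable' ab)
  ultimately show "l1_mult \<sigma> a b \<in> l1" "l1_norm (l1_mult \<sigma> a b) \<le> l1_norm a * l1_norm b"
    by (auto intro: l1I_norm_le)
qed

lemma l1_mult_monom_left: "l1_mult \<sigma> (l1_monom f m) a n = f * alpha_pow \<sigma> m (a (n - m))"
  unfolding l1_mult_def by (subst infsum_single[where m = m]) (auto simp: l1_monom_def)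

lemma l1_mult_monom_right:
  "l1_mult \<sigma> a (l1_monom f m) n = a (n - m) * alpha_pow \<sigma> (n - m) f"
  unfolding l1_mult_def
  by (subst infsum_single[where m = "n - m"]) (auto simp: l1_monom_def)

lemma l1_mult_monom_monom:
  "l1_mult \<sigma> (l1_monom f m) (l1_monom g n) = l1_monom (f * alpha_pow \<sigma> m g) (m + n)"
  by (rule ext, subst l1_mult_monom_left) (auto simp: l1_monom_def)

lemma l1_mult_embed_embed: "l1_mult \<sigma> (l1_embed f) (l1_embed g) = l1_embed (f * g)"
proof -
  have "alpha_pow \<sigma> 0 g = g" by (rule bcontfun_eqI) simp
  then show ?thesis by (simp add: l1_embed_eq_monom l1_mult_monom_monom)
qed

lemma l1_monom_cancel:
  "l1_mult \<sigma> (l1_monom (const_bcontfun 1) m) (l1_monom (const_bcontfun 1) (- m)) = l1_one"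
  "l1_mult \<sigma> (l1_monom (const_bcontfun 1) (- m)) (l1_monom (const_bcontfun 1) m) = l1_one"
proof -
  have "const_bcontfun 1 * alpha_pow \<sigma> n (const_bcontfun 1)
      = (const_bcontfun 1 :: 'x \<Rightarrow>\<^sub>C complex)" for n
    by (rule bcontfun_eqI) simp
  then show "l1_mult \<sigma> (l1_monom (const_bcontfun 1) m) (l1_monom (const_bcontfun 1) (- m)) = l1_one"
    "l1_mult \<sigma> (l1_monom (const_bcontfun 1) (- m)) (l1_monom (const_bcontfun 1) m) = l1_one"
    by (simp_all add: l1_mult_monom_monom l1_one_eq_monom)
qed

lemma l1_mult_one_right [simp]: "l1_mult \<sigma> a l1_one = a"
  by (auto simp: fun_eq_iff l1_one_eq_monom l1_mult_monom_right intro!: bcontfun_eqI)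

lemma l1_mult_diff_right:
  assumes "a \<in> l1" "b \<in> l1" "c \<in> l1"
  shows "l1_mult \<sigma> a (b - c) = l1_mult \<sigma> a b - l1_mult \<sigma> a c"
proof (rule ext)
  fix n
  have "(\<lambda>k. a k * alpha_pow \<sigma> k (b (n - k))) summable_on UNIV"
    "(\<lambda>k. a k * alpha_pow \<sigma> k (c (n - k))) summable_on UNIV"
    by (auto intro!: mult_terms_summable' assms)
  from has_sum_add[OF has_sum_infsum[OF this(1)]
      has_sum_bounded_linear[OF bounded_linear_minus[OF bounded_linear_ident] has_sum_infsum[OF
          this(2)]]]
  show "l1_mult \<sigma> a (b - c) n = (l1_mult \<sigma> a b - l1_mult \<sigma> a c) n"
    by (auto intro!: infsumI simp: l1_mult_def alpha_pow_diff right_diff_distrib)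
qed

lemma l1_mult_diff_left:
  assumes "a \<in> l1" "b \<in> l1" "c \<in> l1"
  shows "l1_mult \<sigma> (a - b) c = l1_mult \<sigma> a c - l1_mult \<sigma> b c"
proof (rule ext)
  fix n
  have "(\<lambda>k. a k * alpha_pow \<sigma> k (c (n - k))) summable_on UNIV"
    "(\<lambda>k. b k * alpha_pow \<sigma> k (c (n - k))) summable_on UNIV"
    by (auto intro!: mult_terms_summable' assms)
  from has_sum_add[OF has_sum_infsum[OF this(1)]
      has_sum_bounded_linear[OF bounded_linear_minus[OF bounded_linear_ident] has_sum_infsum[OF
          this(2)]]]
  show "l1_mult \<sigma> (a - b) c n = (l1_mult \<sigma> a c - l1_mult \<sigma> b c) n"
    by (auto intro!: infsumI simp: l1_mult_def left_diff_distrib)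
qed


text \<open>The Neumann series s = 1 + b + b^2 + ... . The powers are built by multiplication on the
  right, so that multiplying s by b on the right just shifts the series by one place.\<close>

lemma l1_left_inverse:
  assumes b: "b \<in> l1" and less: "l1_norm b < 1"
  obtains s where "s \<in> l1" "l1_mult \<sigma> s (l1_one - b) = l1_one"
proof -
  define P where "P = rec_nat l1_one (\<lambda>_ p. l1_mult \<sigma> p b)"
  have P0: "P 0 = l1_one" and PS: "P (Suc j) = l1_mult \<sigma> (P j) b" for j
    by (simp_all add: P_def)
  have P_in: "P j \<in> l1" for j
    by (induction j) (auto simp: P0 PS b)
  have P_norm: "l1_norm (P j) \<le> l1_norm b ^ j * norm (const_bcontfun 1 :: 'x \<Rightarrow>\<^sub>C complex)" for j
  proof (induction j)
    case (Suc j)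
    have "l1_norm (P (Suc j)) \<le> l1_norm (P j) * l1_norm b"
      by (simp add: PS P_in b l1_norm_mult_le)
    also have "\<dots> \<le> l1_norm b ^ j * norm (const_bcontfun 1 :: 'x \<Rightarrow>\<^sub>C complex) * l1_norm b"
      by (intro mult_right_mono Suc l1_norm_ge_0)
    finally show ?case by (simp add: mult_ac)
  qed (simp add: P0 l1_one_eq_monom)
  have "(\<lambda>j. l1_norm (P j)) summable_on UNIV"
  proof (rule summable_on_comparison_test)
    have "summable (\<lambda>j. l1_norm b ^ j * norm (const_bcontfun 1 :: 'x \<Rightarrow>\<^sub>C complex))"
      using less l1_norm_ge_0[of b] by (intro summable_mult2 summable_geometric) auto
    then show "(\<lambda>j. l1_norm b ^ j * norm (const_bcontfun 1 :: 'x \<Rightarrow>\<^sub>C complex)) summable_on UNIV"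
      using l1_norm_ge_0[of b] by (subst summable_on_UNIV_nonneg_real_iff) auto
  qed (auto intro: P_norm l1_norm_ge_0)
  then have "(\<lambda>(j, n). norm (P j n)) summable_on UNIV \<times> UNIV"
    by (intro summable_on_SigmaI[where g = "\<lambda>j. l1_norm (P j)"]) (auto intro: l1_has_norm P_in)
  then have sm: "(\<lambda>(n, j). norm (P j n)) summable_on UNIV \<times> UNIV"
    by (subst summable_on_swap) (simp add: case_prod_unfold)
  have smn: "(\<lambda>j. norm (P j n)) summable_on UNIV" for n
    using summable_on_SigmaD1[OF sm, of n] by simp
  define s where "s n = (\<Sum>\<^sub>\<infinity>j. P j n)" for n
  have s_le: "norm (s n) \<le> (\<Sum>\<^sub>\<infinity>j. norm (P j n))" for n
    unfolding s_def by (rule norm_infsum_bound) (rule smn)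
  have s_in: "s \<in> l1"
    using l1I_norm_le(1)[OF has_sum_infsum[OF summable_on_Sigma_banach[OF sm]] s_le] .
  have shift: "s n = l1_one n + (\<Sum>\<^sub>\<infinity>j. P (Suc j) n)" for n
  proof -
    have ps: "(\<lambda>j. P j n) summable_on UNIV" by (rule abs_summable_summable[OF smn])
    have "((\<lambda>j. P (Suc j) n) has_sum (\<Sum>\<^sub>\<infinity>j\<in>range Suc. P j n)) UNIV \<longleftrightarrow>
        ((\<lambda>j. P j n) has_sum (\<Sum>\<^sub>\<infinity>j\<in>range Suc. P j n)) (range Suc)"
      by (rule has_sum_reindex_bij_betw) (simp add: bij_betw_def)
    then have "(\<Sum>\<^sub>\<infinity>j. P (Suc j) n) = (\<Sum>\<^sub>\<infinity>j\<in>range Suc. P j n)"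
      using summable_on_subset_banach[OF ps, of "range Suc"] by (auto intro!: infsumI)
    moreover have "s n = (\<Sum>\<^sub>\<infinity>j\<in>insert 0 (range Suc). P j n)"
      by (simp add: s_def UNIV_nat_eq[symmetric])
    moreover have "\<dots> = P 0 n + (\<Sum>\<^sub>\<infinity>j\<in>range Suc. P j n)"
      using summable_on_subset_banach[OF ps, of "range Suc"] by (intro infsum_insert) auto
    ultimately show ?thesis by (simp add: P0)
  qed
  have "l1_mult \<sigma> s b n = (\<Sum>\<^sub>\<infinity>j. P (Suc j) n)" for n
  proof -
    have lin: "bounded_linear (\<lambda>f. f * alpha_pow \<sigma> k (b (n - k)))" for k
      by (rule bounded_linear_mult_left)
    have "l1_mult \<sigma> s b n = (\<Sum>\<^sub>\<infinity>k. \<Sum>\<^sub>\<infinity>j. P j k * alpha_pow \<sigma> k (b (n - k)))"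
      unfolding l1_mult_def
    proof (intro infsum_cong)
      fix k
      show "s k * alpha_pow \<sigma> k (b (n - k)) = (\<Sum>\<^sub>\<infinity>j. P j k * alpha_pow \<sigma> k (b (n - k)))"
        using has_sum_bounded_linear[OF lin has_sum_infsum[OF abs_summable_summable[OF smn]], of k k]
        by (simp add: s_def infsumI)
    qed
    \<comment> \<open>The exchange is justified by bounding every coefficient of b by
      \<open>l1_norm b\<close>, which leaves the summable double family of norms of P j k.\<close>
    also have "\<dots> = (\<Sum>\<^sub>\<infinity>j. \<Sum>\<^sub>\<infinity>k. P j k * alpha_pow \<sigma> k (b (n - k)))"
    proof (rule infsum_swap_banach, rule abs_summable_summable)
      have "(\<lambda>(k, j). norm (P j k) * l1_norm b) summable_on UNIV \<times> UNIV"
        using summable_on_cmult_left[OF sm, of "l1_norm b"] by (simp add: case_prod_unfold)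
      then show "(\<lambda>x. norm (case x of (k, j) \<Rightarrow> P j k * alpha_pow \<sigma> k (b (n
          - k)))) summable_on UNIV \<times> UNIV"
        by (rule Infinite_Sum.abs_summable_on_comparison_test')
           (auto intro!: order_trans[OF norm_mult_ineq] mult_left_mono
              order_trans[OF norm_alpha_pow_le] norm_le_l1_norm b)
    qed
    finally show ?thesis by (simp add: PS l1_mult_def)
  qed
  then have "l1_mult \<sigma> s (l1_one - b) = l1_one"
    using shift by (auto simp: l1_mult_diff_right s_in b)
  with s_in that show ?thesis by blast
qed

end

section \<open>Square-summable functions\<close>

text \<open>\<open>seq_scale\<close> and \<open>seq_ip\<close> are generalized here from integers to
  any index type, because direct sums are indexed by points of X.\<close>

definition fun_scale :: "complex \<Rightarrow> ('k \<Rightarrow> complex) \<Rightarrow> 'k \<Rightarrow> complex"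
  where "fun_scale c v = (\<lambda>k. c * v k)"

definition fun_ip :: "('k \<Rightarrow> complex) \<Rightarrow> ('k \<Rightarrow> complex) \<Rightarrow> complex"
  where "fun_ip u v = (\<Sum>\<^sub>\<infinity>k. u k * cnj (v k))"

text \<open>l^2(K) is realized by functions on the whole index type vanishing off K, so that it is a
  subspace of one ambient function space.\<close>

definition l2_on :: "'k set \<Rightarrow> ('k \<Rightarrow> complex) set"
  where "l2_on K = {v. (\<forall>k. k \<notin> K \<longrightarrow> v k = 0) \<and> (\<lambda>k. (cmod (v k))\<^sup>2) summable_on UNIV}"

definition l2_norm :: "('k \<Rightarrow> complex) \<Rightarrow> real"
  where "l2_norm v = sqrt (\<Sum>\<^sub>\<infinity>k. (cmod (v k))\<^sup>2)"

lemma vector_space_fun_scale: "vector_space fun_scale"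
  by unfold_locales (auto simp: fun_scale_def algebra_simps)

lemma l2_norm_ge_0 [simp]: "0 \<le> l2_norm v"
  by (simp add: l2_norm_def infsum_nonneg)

lemma l2_norm_sq: "(l2_norm v)\<^sup>2 = (\<Sum>\<^sub>\<infinity>k. (cmod (v k))\<^sup>2)"
  by (simp add: l2_norm_def infsum_nonneg)

lemma l2_has_sum: "v \<in> l2_on K \<Longrightarrow> ((\<lambda>k. (cmod (v k))\<^sup>2) has_sum (l2_norm v)\<^sup>2) UNIV"
  by (simp add: l2_norm_sq l2_on_def)

lemma L2_set_le_l2_norm:
  assumes "v \<in> l2_on K" "finite F"
  shows "L2_set (\<lambda>k. cmod (v k)) F \<le> l2_norm v"
proof -
  have "(\<Sum>k\<in>F. (cmod (v k))\<^sup>2) \<le> (l2_norm v)\<^sup>2"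
    by (rule finite_sum_le_has_sum[OF l2_has_sum[OF assms(1)]]) (use assms in auto)
  then have "sqrt (\<Sum>k\<in>F. (cmod (v k))\<^sup>2) \<le> sqrt ((l2_norm v)\<^sup>2)"
    by (rule real_sqrt_le_mono)
  then show ?thesis by (simp add: L2_set_def)
qed

lemma cmod_le_l2_norm: "v \<in> l2_on K \<Longrightarrow> cmod (v k) \<le> l2_norm v"
  using L2_set_le_l2_norm[of v K "{k}"] by (simp add: L2_set_def)

text \<open>Through this criterion inequalities for finite sums, such as Minkowski's, pass to
  square-summable functions together with the norm bound.\<close>

lemma l2_onI:
  assumes supp: "\<And>k. k \<notin> K \<Longrightarrow> v k = 0"
    and bound: "\<And>F. finite F \<Longrightarrow> F \<subseteq> K \<Longrightarrow> L2_set (\<lambda>k. cmod (v k)) F \<le> C"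
  shows "v \<in> l2_on K" "l2_norm v \<le> C"
proof -
  have C: "0 \<le> C" using bound[of "{}"] by simp
  have fin: "(\<Sum>k\<in>F. (cmod (v k))\<^sup>2) \<le> C\<^sup>2" if F: "finite F" for F
  proof -
    have "(\<Sum>k\<in>F. (cmod (v k))\<^sup>2) = (\<Sum>k\<in>F \<inter> K. (cmod (v k))\<^sup>2)"
      by (rule sum.mono_neutral_right) (use F supp in auto)
    also have "\<dots> = (L2_set (\<lambda>k. cmod (v k)) (F \<inter> K))\<^sup>2"
      by (simp add: L2_set_def sum_nonneg)
    also have "\<dots> \<le> C\<^sup>2"
      by (intro power_mono bound) (use F in auto)
    finally show ?thesis .
  qed
  then have sm: "(\<lambda>k. (cmod (v k))\<^sup>2) summable_on UNIV"
    by (intro nonneg_bdd_above_summable_on) (auto intro!: bdd_aboveI)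
  then show v: "v \<in> l2_on K" using supp by (simp add: l2_on_def)
  have "(l2_norm v)\<^sup>2 \<le> C\<^sup>2"
    unfolding l2_norm_sq by (rule infsum_le_finite_sums[OF sm]) (rule fin)
  then show "l2_norm v \<le> C" using C by (simp add: power2_le_iff_abs_le)
qed

lemma l2_norm_zero_iff: "v \<in> l2_on K \<Longrightarrow> l2_norm v = 0 \<longleftrightarrow> v = 0"
proof
  assume v: "v \<in> l2_on K" and "l2_norm v = 0"
  then have "cmod (v k) \<le> 0" for k using cmod_le_l2_norm[OF v, of k] by simp
  then show "v = 0" by (auto simp: fun_eq_iff)
qed (simp add: l2_norm_def)

lemma l2_zero [simp]: "0 \<in> l2_on K"
  by (simp add: l2_on_def)

lemma l2_add: "u \<in> l2_on K \<Longrightarrow> v \<in> l2_on K \<Longrightarrow> u + v \<in> l2_on K"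
  and l2_norm_triangle: "u \<in> l2_on K \<Longrightarrow> v \<in> l2_on K \<Longrightarrow> l2_norm (u + v) \<le> l2_norm u + l2_norm v"
proof -
  assume uv: "u \<in> l2_on K" "v \<in> l2_on K"
  have bound: "L2_set (\<lambda>k. cmod ((u + v) k)) F \<le> l2_norm u + l2_norm v"
    if "finite F" "F \<subseteq> K" for F
  proof -
    have "L2_set (\<lambda>k. cmod ((u + v) k)) F \<le> L2_set (\<lambda>k. cmod (u k) + cmod (v k)) F"
      by (rule L2_set_mono) (auto simp: norm_triangle_ineq)
    also have "\<dots> \<le> L2_set (\<lambda>k. cmod (u k)) F + L2_set (\<lambda>k. cmod (v k)) F"
      by (rule L2_set_triangle_ineq)
    also have "\<dots> \<le> l2_norm u + l2_norm v"
      by (intro add_mono L2_set_le_l2_norm[OF uv(1) that(1)] L2_set_le_l2_norm[OF uv(2) that(1)])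
    finally show ?thesis .
  qed
  have supp: "(u + v) k = 0" if "k \<notin> K" for k
    using uv that by (simp add: l2_on_def)
  show "u + v \<in> l2_on K" "l2_norm (u + v) \<le> l2_norm u + l2_norm v"
    using l2_onI[OF supp bound] by blast+
qed

lemma l2_scale: "v \<in> l2_on K \<Longrightarrow> fun_scale c v \<in> l2_on K"
  by (auto simp: l2_on_def fun_scale_def norm_mult power_mult_distrib intro!: summable_on_cmult_right)

lemma l2_norm_scale: "l2_norm (fun_scale c v) = cmod c * l2_norm v"
  by (simp add: l2_norm_def fun_scale_def norm_mult power_mult_distrib infsum_cmult_right'
      real_sqrt_mult)

lemma l2_diff: "u \<in> l2_on K \<Longrightarrow> v \<in> l2_on K \<Longrightarrow> u - v \<in> l2_on K"
  using l2_add[of u K "- v"] by (simp add: l2_on_def)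

lemma l2_norm_minus_commute: "l2_norm (u - v) = l2_norm (v - u)"
  by (simp add: l2_norm_def norm_minus_commute)

lemma mult_le_sum_squares:
  fixes x y :: real
  assumes "0 \<le> x" "0 \<le> y"
  shows "x * y \<le> x\<^sup>2 + y\<^sup>2"
  using sum_squares_bound[of x y] mult_nonneg_nonneg[OF assms] by linarith

lemma fun_ip_summable:
  assumes "u \<in> l2_on K" "v \<in> l2_on L"
  shows "(\<lambda>k. norm (u k * cnj (v k))) summable_on A"
proof (rule Infinite_Sum.abs_summable_on_comparison_test')
  show "(\<lambda>k. (cmod (u k))\<^sup>2 + (cmod (v k))\<^sup>2) summable_on A"
    using assms by (intro summable_on_subset_banach[OF summable_on_add, of _ UNIV])
        (auto simp: l2_on_def)
  show "norm (u k * cnj (v k)) \<le> (cmod (u k))\<^sup>2 + (cmod (v k))\<^sup>2" for k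
    by (simp add: norm_mult mult_le_sum_squares)
qed

lemma fun_ip_has_sum:
  assumes "u \<in> l2_on K" "v \<in> l2_on L"
  shows "((\<lambda>k. u k * cnj (v k)) has_sum fun_ip u v) UNIV"
  unfolding fun_ip_def by (rule has_sum_infsum[OF abs_summable_summable[OF fun_ip_summable[OF assms]]])

lemma fun_ip_on:
  assumes "u \<in> l2_on K \<or> v \<in> l2_on K"
  shows "fun_ip u v = (\<Sum>\<^sub>\<infinity>k\<in>K. u k * cnj (v k))"
  unfolding fun_ip_def by (rule infsum_cong_neutral) (use assms in \<open>auto simp: l2_on_def\<close>)

lemma fun_ip_self:
  assumes "v \<in> l2_on K"
  shows "fun_ip v v = complex_of_real ((l2_norm v)\<^sup>2)"
  unfolding fun_ip_def
proof (rule infsumI)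
  have "((\<lambda>k. complex_of_real ((cmod (v k))\<^sup>2)) has_sum complex_of_real ((l2_norm v)\<^sup>2)) UNIV"
    by (rule has_sum_of_real[OF l2_has_sum[OF assms]])
  then show "((\<lambda>k. v k * cnj (v k)) has_sum complex_of_real ((l2_norm v)\<^sup>2)) UNIV"
    by (simp only: complex_norm_square)
qed

lemma ip_norm_fun_ip: "v \<in> l2_on K \<Longrightarrow> ip_norm fun_ip v = l2_norm v"
  by (simp add: ip_norm_def fun_ip_self)

lemma ip_dist_fun_ip:
  "u \<in> l2_on K \<Longrightarrow> v \<in> l2_on K \<Longrightarrow> ip_dist (l2_on K) fun_ip u v = l2_norm (u - v)"
  by (simp add: ip_dist_def ip_norm_fun_ip[OF l2_diff])

lemma Metric_space_l2: "Metric_space (l2_on K) (ip_dist (l2_on K) fun_ip)"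
proof
  fix u v w :: "'a \<Rightarrow> complex"
  show "0 \<le> ip_dist (l2_on K) fun_ip u v"
    by (auto simp: ip_dist_def ip_norm_fun_ip[OF l2_diff])
  show "ip_dist (l2_on K) fun_ip u v = ip_dist (l2_on K) fun_ip v u"
    by (auto simp: ip_dist_def ip_norm_fun_ip[OF l2_diff] l2_norm_minus_commute)
  assume u: "u \<in> l2_on K" and v: "v \<in> l2_on K"
  then show "ip_dist (l2_on K) fun_ip u v = 0 \<longleftrightarrow> u = v"
    by (simp add: ip_dist_fun_ip l2_norm_zero_iff[OF l2_diff])
  assume w: "w \<in> l2_on K"
  show "ip_dist (l2_on K) fun_ip u w \<le> ip_dist (l2_on K) fun_ip u v + ip_dist (l2_on K) fun_ip v w"
    using l2_norm_triangle[OF l2_diff[OF u v] l2_diff[OF v w]] u v w by (simp add: ip_dist_fun_ip)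
qed

text \<open>Coordinates converge because they are dominated by the norm. The Cauchy estimate on a
  finite set of coordinates passes to the limit, and its bound is independent of that set, so
  \<open>l2_onI\<close> applies.\<close>

lemma mcomplete_l2: "Metric_space.mcomplete (l2_on K) (ip_dist (l2_on K) fun_ip)"
proof -
  interpret Metric_space "l2_on K" "ip_dist (l2_on K) fun_ip" by (rule Metric_space_l2)
  show ?thesis
    unfolding mcomplete_def
  proof (intro allI impI)
    fix s assume "MCauchy s"
    then have s: "s n \<in> l2_on K" for n
      by (auto simp: MCauchy_def)
    have cau: "\<exists>N. \<forall>n\<ge>N. \<forall>m\<ge>N. l2_norm (s n - s m) < \<epsilon>" if "0 < \<epsilon>" for \<epsilon>
      using \<open>MCauchy s\<close> that unfolding MCauchy_def by (simp add: ip_dist_fun_ip s)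
    have "Cauchy (\<lambda>n. s n k)" for k
    proof (rule metric_CauchyI)
      fix \<epsilon> :: real assume "0 < \<epsilon>"
      from cau[OF this] obtain N where "\<forall>n\<ge>N. \<forall>m\<ge>N. l2_norm (s n - s m) < \<epsilon>" by blast
      moreover have "dist (s n k) (s m k) \<le> l2_norm (s n - s m)" for n m
        using cmod_le_l2_norm[OF l2_diff[OF s s], of n m k] by (simp add: dist_norm)
      ultimately show "\<exists>M. \<forall>m\<ge>M. \<forall>n\<ge>M. dist (s m k) (s n k) < \<epsilon>"
        by (meson le_less_trans)
    qed
    then have "\<exists>l. (\<lambda>n. s n k) \<longlonglongrightarrow> l" for k
      by (simp add: Cauchy_convergent_iff convergent_def)
    then obtain w where w: "\<And>k. (\<lambda>n. s n k) \<longlonglongrightarrow> w k" by metis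
    have w_supp: "w k = 0" if "k \<notin> K" for k
    proof -
      have "(\<lambda>n. s n k) = (\<lambda>_. 0)" using s that by (auto simp: l2_on_def)
      then show ?thesis using w[of k] by (simp add: LIMSEQ_const_iff)
    qed
    have close: "\<exists>N. \<forall>n\<ge>N. s n - w \<in> l2_on K \<and> l2_norm (s n - w) \<le> \<epsilon>" if "0 < \<epsilon>" for \<epsilon>
    proof -
      from cau[OF that] obtain N where N: "\<And>n m. n \<ge> N \<Longrightarrow> m \<ge> N \<Longrightarrow> l2_norm (s n - s m) < \<epsilon>"
        by blast
      have "s n - w \<in> l2_on K \<and> l2_norm (s n - w) \<le> \<epsilon>" if n: "n \<ge> N" for n
      proof -
        have bound: "L2_set (\<lambda>k. cmod ((s n - w) k)) F \<le> \<epsilon>" if F: "finite F" "F \<subseteq> K" for F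
        proof (rule tendsto_upperbound)
          show "(\<lambda>m. L2_set (\<lambda>k. cmod ((s n - s m) k)) F) \<longlonglongrightarrow> L2_set (\<lambda>k. cmod ((s n - w) k)) F"
            unfolding L2_set_def by (auto intro!: tendsto_intros w)
          show "\<forall>\<^sub>F m in sequentially. L2_set (\<lambda>k. cmod ((s n - s m) k)) F \<le> \<epsilon>"
            using eventually_ge_at_top[of N]
          proof eventually_elim
            case (elim m)
            show ?case
              using L2_set_le_l2_norm[OF l2_diff[OF s s] F(1), of n m] N[OF n elim] by linarith
          qed
        qed simp
        have supp: "(s n - w) k = 0" if "k \<notin> K" for k
          using s[of n] w_supp that by (simp add: l2_on_def)
        show ?thesis using l2_onI[OF supp bound] by blast
      qed
      then show ?thesis by blast
    qed
    from close[of 1] obtain n where "s n - w \<in> l2_on K" by auto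
    from l2_diff[OF s this, of n] have w_in: "w \<in> l2_on K" by simp
    have "limitin mtopology s w sequentially"
      unfolding limit_metric_sequentially
    proof (intro conjI allI impI w_in)
      fix \<epsilon> :: real assume "0 < \<epsilon>"
      then obtain N where N: "\<And>n. n \<ge> N \<Longrightarrow> l2_norm (s n - w) \<le> \<epsilon> / 2"
        using close[of "\<epsilon> / 2"] by auto
      have "ip_dist (l2_on K) fun_ip (s n) w < \<epsilon>" if "n \<ge> N" for n
        using N[OF that] \<open>0 < \<epsilon>\<close> by (simp add: ip_dist_fun_ip s w_in)
      then show "\<exists>N. \<forall>n\<ge>N. s n \<in> l2_on K \<and> ip_dist (l2_on K) fun_ip (s n) w < \<epsilon>"
        using s by blast
    qed
    then show "\<exists>w. limitin mtopology s w sequentially" by blast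
  qed
qed

lemma subspace_l2: "module.subspace fun_scale (l2_on K)"
proof -
  interpret vector_space fun_scale by (rule vector_space_fun_scale)
  show ?thesis by (rule subspaceI) (auto intro: l2_add l2_scale)
qed

lemma hilbert_space_l2: "hilbert_space fun_scale (l2_on K) fun_ip"
proof -
  interpret vector_space fun_scale by (rule vector_space_fun_scale)
  show ?thesis
  proof
    fix u v w :: "'a \<Rightarrow> complex" and c
    assume u: "u \<in> l2_on K" and v: "v \<in> l2_on K"
    show "fun_ip (fun_scale c u) v = c * fun_ip u v"
      by (simp add: fun_ip_def fun_scale_def mult.assoc infsum_cmult_right')
    show "fun_ip u v = cnj (fun_ip v u)"
      by (simp add: fun_ip_def mult.commute flip: infsum_cnj)
    assume w: "w \<in> l2_on K"
    show "fun_ip (u + v) w = fun_ip u w + fun_ip v w"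
      using has_sum_add[OF fun_ip_has_sum[OF u w] fun_ip_has_sum[OF v w]]
      by (subst fun_ip_def) (auto intro!: infsumI simp: algebra_simps)
  next
    fix v :: "'a \<Rightarrow> complex" assume v: "v \<in> l2_on K" "v \<noteq> 0"
    then have "l2_norm v \<noteq> 0" by (simp add: l2_norm_zero_iff[OF v(1)])
    then show "0 < Re (fun_ip v v)" by (simp add: fun_ip_self[OF v(1)])
  qed (rule subspace_l2 mcomplete_l2)+
qed

lemma l2_closed_limit:
  assumes V: "closedin (Metric_space.mtopology (l2_on K) (ip_dist (l2_on K) fun_ip)) V"
    and w: "w \<in> l2_on K" and approx: "\<And>\<epsilon>. 0 < \<epsilon> \<Longrightarrow> \<exists>v\<in>V. l2_norm (w - v) < \<epsilon>"
  shows "w \<in> V"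
proof (rule ccontr)
  interpret Metric_space "l2_on K" "ip_dist (l2_on K) fun_ip" by (rule Metric_space_l2)
  assume "w \<notin> V"
  with V w obtain r where r: "0 < r" "disjnt V (mball w r)" and sub: "V \<subseteq> l2_on K"
    unfolding closedin_metric by blast
  from approx[OF r(1)] obtain v where "v \<in> V" "l2_norm (w - v) < r" by blast
  with sub w have "v \<in> mball w r" by (auto simp: ip_dist_fun_ip)
  with r(2) \<open>v \<in> V\<close> show False by (auto simp: disjnt_def)
qed

definition fun_basis :: "'k \<Rightarrow> 'k \<Rightarrow> complex"
  where "fun_basis j = (\<lambda>k. if k = j then 1 else 0)"

lemma fun_basis_in_l2: "j \<in> K \<Longrightarrow> fun_basis j \<in> l2_on K"
proof -
  assume "j \<in> K"
  have "finite {k \<in> UNIV. (cmod (fun_basis j k))\<^sup>2 \<noteq> 0}"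
    by (rule finite_subset[of _ "{j}"]) (auto simp: fun_basis_def)
  from finite_nonzero_values_imp_summable_on[OF this] \<open>j \<in> K\<close> show ?thesis
    by (auto simp: l2_on_def fun_basis_def)
qed

text \<open>Stated for all u dominated by v rather than for truncations of v alone: it is applied
  both to remainders of finite sums and to v multiplied by a function bounded by 1.\<close>

lemma l2_tail:
  assumes v: "v \<in> l2_on K" and "0 < \<epsilon>"
  obtains F where "finite F" "F \<subseteq> K"
    "\<And>u. (\<And>k. k \<in> F \<Longrightarrow> u k = 0) \<Longrightarrow> (\<And>k. cmod (u k) \<le> cmod (v k)) \<Longrightarrow> l2_norm u < \<epsilon>"
proof -
  \<comment> \<open>Half of \<epsilon>^2, so that the final comparison is strict.\<close>
  obtain F where F: "finite F" "dist (\<Sum>k\<in>F. (cmod (v k))\<^sup>2) ((l2_norm v)\<^sup>2) \<le> \<epsilon>\<^sup>2 / 2"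
    using has_sum_finite_approximation[OF l2_has_sum[OF v], of "\<epsilon>\<^sup>2 / 2"] assms(2) by auto
  have "l2_norm u < \<epsilon>" if u: "\<And>k. k \<in> F \<inter> K \<Longrightarrow> u k = 0" "\<And>k. cmod (u k) \<le> cmod (v k)" for u
  proof -
    have u': "u k = 0" if "k \<in> F" for k
    proof (cases "k \<in> K")
      case False
      then show ?thesis using u(2)[of k] v by (auto simp: l2_on_def)
    qed (use u that in auto)
    have "((\<lambda>k. (cmod (v k))\<^sup>2) has_sum (\<Sum>k\<in>F. (cmod (v k))\<^sup>2)) F"
      using F(1) by simp
    from has_sum_Diff[OF l2_has_sum[OF v] this]
    have *: "((\<lambda>k. (cmod (v k))\<^sup>2) has_sum (l2_norm v)\<^sup>2 - (\<Sum>k\<in>F. (cmod (v k))\<^sup>2)) (- F)"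
      by (simp add: Compl_eq_Diff_UNIV)
    have sm: "(\<lambda>k. (cmod (u k))\<^sup>2) summable_on (- F)"
      by (rule summable_on_comparison_test[OF has_sum_imp_summable[OF *]])
         (auto intro!: power_mono u)
    have "(l2_norm u)\<^sup>2 = (\<Sum>\<^sub>\<infinity>k\<in>-F. (cmod (u k))\<^sup>2)"
      unfolding l2_norm_sq by (rule infsum_cong_neutral) (auto simp: u')
    also have "\<dots> \<le> (l2_norm v)\<^sup>2 - (\<Sum>k\<in>F. (cmod (v k))\<^sup>2)"
      by (rule has_sum_mono[OF has_sum_infsum[OF sm] *]) (auto intro!: power_mono u)
    also have "\<dots> \<le> \<epsilon>\<^sup>2 / 2" using F(2) unfolding dist_real_def by linarith
    also have "\<dots> < \<epsilon>\<^sup>2" using assms(2) by simp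
    finally show ?thesis by (rule power2_less_imp_less) (use assms(2) in simp)
  qed
  with F(1) show ?thesis by (intro that[of "F \<inter> K"]) auto
qed

section \<open>Involutive representations from orbits\<close>

text \<open>
  The representation \<open>rep\<close> below specializes to \<open>\<pi>\<^bsub>x,\<lambda>\<^esub>\<close> (\<open>K = {0..<p}\<close>, where the cocycle \<open>w\<close> counts
  the crossings of \<open>p\<close>), to \<open>\<pi>\<^sub>x\<^sup>2\<close> (\<open>K\<close> the integers) and to direct sums of the latter (\<open>K\<close> an
  invariant set of points).
\<close>

locale orbit_rep = dynamical_system \<sigma>
  for \<sigma> :: "'x::t2_space \<Rightarrow> 'x" +
  fixes K :: "'k set" and \<tau> :: "int \<Rightarrow> 'k \<Rightarrow> 'k" and q :: "'k \<Rightarrow> 'x" and w :: "int \<Rightarrow> 'k \<Rightarrow> complex"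
  assumes act_in: "k \<in> K \<Longrightarrow> \<tau> n k \<in> K"
    and act_0: "k \<in> K \<Longrightarrow> \<tau> 0 k = k"
    and act_add: "k \<in> K \<Longrightarrow> \<tau> (m + n) k = \<tau> m (\<tau> n k)"
    and equivariant: "k \<in> K \<Longrightarrow> q (\<tau> n k) = it n (q k)"
    and cocycle_norm: "k \<in> K \<Longrightarrow> cmod (w n k) = 1"
    and cocycle: "k \<in> K \<Longrightarrow> w (m + n) k = w m k * w n (\<tau> (- m) k)"
begin

text \<open>This is the sum of the f_n U^n, where (U^n v)(k) =
  \<open>w n k * v (\<tau> (- n) k)\<close>. The cocycle identity says that the U^n multiply like
  powers, and \<open>cocycle_norm\<close> that they are isometric.\<close>

definition rep :: "(int \<Rightarrow> ('x \<Rightarrow>\<^sub>C complex)) \<Rightarrow> ('k \<Rightarrow> complex) \<Rightarrow> 'k \<Rightarrow> complex"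
  where "rep a v = (\<lambda>k. if k \<in> K then
    \<Sum>\<^sub>\<infinity>n. apply_bcontfun (a n) (q k) * w n k * v (\<tau> (- n) k) else 0)"

lemma act_cancel: "k \<in> K \<Longrightarrow> \<tau> (- n) (\<tau> n k) = k" "k \<in> K \<Longrightarrow> \<tau> n (\<tau> (- n) k) = k"
  using act_add[of k "- n" n] act_add[of k n "- n"] act_0 by auto

lemma bij_act: "bij_betw (\<tau> n) K K"
  by (rule bij_betwI[where g = "\<tau> (- n)"]) (auto simp: act_in act_cancel)

lemma cocycle_0: "k \<in> K \<Longrightarrow> w 0 k = 1"
  using cocycle[of k 0 0] cocycle_norm[of k 0] act_0[of k] by auto

text \<open>Both sides are inverse to \<open>w (- n) k\<close>, one by the cocycle identity and one
  because the modulus is 1. In terms of operators, the adjoint of U^n is U^(-n).\<close>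

lemma cocycle_neg: "k \<in> K \<Longrightarrow> cnj (w (- n) k) = w n (\<tau> n k)"
proof -
  assume k: "k \<in> K"
  have "w n (\<tau> n k) * w (- n) k = 1"
    using cocycle[OF act_in[OF k], of n "- n" n] k by (simp add: act_cancel cocycle_0 act_in)
  moreover have "cnj (w (- n) k) * w (- n) k = 1"
    using complex_norm_square[of "w (- n) k"] cocycle_norm[OF k, of "- n"] by (simp add: mult.commute)
  ultimately show ?thesis
    by (metis mult_cancel_right zero_neq_one mult_zero_right)
qed

lemma norm_apply_le: "cmod (apply_bcontfun f y * w n k * z) \<le> norm f * cmod z" if "k \<in> K"
  using norm_bounded[of f y] by (auto simp: norm_mult cocycle_norm that intro: mult_right_mono)

lemma rep_terms_abs_summable:
  assumes a: "a \<in> l1" and v: "v \<in> l2_on K" and k: "k \<in> K"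
  shows "(\<lambda>n. norm (apply_bcontfun (a n) (q k) * w n k * v (\<tau> (- n) k))) summable_on UNIV"
proof (rule Infinite_Sum.abs_summable_on_comparison_test')
  show "(\<lambda>n. norm (a n) * l2_norm v) summable_on UNIV"
    by (rule summable_on_cmult_left[OF norm_summable_l1[OF a]])
  show "cmod (apply_bcontfun (a n) (q k) * w n k * v (\<tau> (- n) k)) \<le> norm (a n) * l2_norm v" for n
    by (rule order_trans[OF norm_apply_le[OF k]])
        (intro mult_left_mono cmod_le_l2_norm[OF v] norm_ge_zero)
qed

lemma rep_has_sum:
  assumes a: "a \<in> l1" and v: "v \<in> l2_on K" and k: "k \<in> K"
  shows "((\<lambda>n. apply_bcontfun (a n) (q k) * w n k * v (\<tau> (- n) k)) has_sum rep a v k) UNIV"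
  using abs_summable_summable[OF rep_terms_abs_summable[OF assms]] k by (simp add: rep_def)

text \<open>Each U^n is isometric, so on a finite set of coordinates a finite partial sum over n is
  bounded by the partial sum of \<open>norm (a n)\<close> times the norm of v. The bound survives
  the limit in n, and \<open>l2_onI\<close> then frees it from the finite set of
  coordinates.\<close>

lemma rep_in_l2: "a \<in> l1 \<Longrightarrow> v \<in> l2_on K \<Longrightarrow> rep a v \<in> l2_on K"
  and l2_norm_rep_le: "a \<in> l1 \<Longrightarrow> v \<in> l2_on K \<Longrightarrow> l2_norm (rep a v) \<le> l1_norm a * l2_norm v"
proof -
  assume a: "a \<in> l1" and v: "v \<in> l2_on K"
  define t where "t n k = apply_bcontfun (a n) (q k) * w n k * v (\<tau> (- n) k)" for n k
  have bound: "L2_set (\<lambda>k. cmod (rep a v k)) F \<le> l1_norm a * l2_norm v"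
    if F: "finite F" "F \<subseteq> K" for F
  proof -
    have one: "L2_set (\<lambda>k. cmod (t n k)) F \<le> norm (a n) * l2_norm v" for n
    proof -
      have inj: "inj_on (\<tau> (- n)) F"
        using bij_act[of "- n"] F(2) by (meson bij_betw_imp_inj_on inj_on_subset)
      have "L2_set (\<lambda>k. cmod (t n k)) F \<le> L2_set (\<lambda>k. norm (a n) * cmod (v (\<tau> (- n) k))) F"
        by (rule L2_set_mono) (use F(2) in \<open>auto simp: t_def intro!: norm_apply_le\<close>)
      also have "\<dots> = norm (a n) * L2_set (\<lambda>k. cmod (v (\<tau> (- n) k))) F"
        by (simp add: L2_set_right_distrib)
      also have "L2_set (\<lambda>k. cmod (v (\<tau> (- n) k))) F = L2_set (\<lambda>k. cmod (v k)) (\<tau> (- n) ` F)"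
        by (simp add: L2_set_def sum.reindex[OF inj])
      also have "norm (a n) * \<dots> \<le> norm (a n) * l2_norm v"
        by (intro mult_left_mono L2_set_le_l2_norm[OF v]) (use F in auto)
      finally show ?thesis .
    qed
    have fin: "L2_set (\<lambda>k. cmod (\<Sum>n\<in>G. t n k)) F \<le> l1_norm a * l2_norm v" if G: "finite G" for G
    proof -
      from G have "L2_set (\<lambda>k. cmod (\<Sum>n\<in>G. t n k)) F \<le> (\<Sum>n\<in>G. norm (a n) * l2_norm v)"
      proof (induction G rule: finite_induct)
        case (insert m G)
        have "L2_set (\<lambda>k. cmod (\<Sum>n\<in>insert m G. t n k)) F
            \<le> L2_set (\<lambda>k. cmod (t m k) + cmod (\<Sum>n\<in>G. t n k)) F"
          by (rule L2_set_mono) (use insert in \<open>auto simp: norm_triangle_ineq\<close>)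
        also have "\<dots> \<le> L2_set (\<lambda>k. cmod (t m k)) F + L2_set (\<lambda>k. cmod (\<Sum>n\<in>G. t n k)) F"
          by (rule L2_set_triangle_ineq)
        also have "\<dots> \<le> norm (a m) * l2_norm v + (\<Sum>n\<in>G. norm (a n) * l2_norm v)"
          by (intro add_mono one insert.IH)
        finally show ?case using insert by simp
      qed (simp add: L2_set_def)
      also have "\<dots> = (\<Sum>n\<in>G. norm (a n)) * l2_norm v"
        by (simp add: sum_distrib_right)
      also have "\<dots> \<le> l1_norm a * l2_norm v"
        by (intro mult_right_mono finite_sum_le_has_sum[OF l1_has_norm[OF a]]) (use G in auto)
      finally show ?thesis .
    qed
    show ?thesis
    proof (rule tendsto_upperbound)
      have "((\<lambda>G. \<Sum>n\<in>G. t n k) \<longlongrightarrow> rep a v k) (finite_subsets_at_top UNIV)" if "k \<in> F" for k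
        using rep_has_sum[OF a v, of k] F(2) that by (auto simp: has_sum_def t_def)
      then show "((\<lambda>G. L2_set (\<lambda>k. cmod (\<Sum>n\<in>G. t n k)) F) \<longlongrightarrow> L2_set (\<lambda>k. cmod (rep a v k)) F)
          (finite_subsets_at_top UNIV)"
        unfolding L2_set_def by (intro tendsto_intros)
      show "\<forall>\<^sub>F G in finite_subsets_at_top UNIV.
          L2_set (\<lambda>k. cmod (\<Sum>n\<in>G. t n k)) F \<le> l1_norm a * l2_norm v"
        by (rule eventually_finite_subsets_at_top_weakI) (rule fin)
    qed simp
  qed
  have supp: "rep a v k = 0" if "k \<notin> K" for k
    using that by (simp add: rep_def)
  show "rep a v \<in> l2_on K" "l2_norm (rep a v) \<le> l1_norm a * l2_norm v"
    using l2_onI[OF supp bound] by blast+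
qed

lemma rep_eqI:
  assumes "\<And>k. k \<in> K \<Longrightarrow>
      ((\<lambda>n. apply_bcontfun (a n) (q k) * w n k * v (\<tau> (- n) k)) has_sum u k) UNIV"
    and "u \<in> l2_on K"
  shows "rep a v = u"
  using assms by (auto simp: rep_def l2_on_def fun_eq_iff intro!: infsumI)

lemma linear_op_rep:
  assumes a: "a \<in> l1"
  shows "linear_op_on fun_scale (l2_on K) (rep a)"
  unfolding linear_op_on_def
proof (intro conjI ballI allI)
  fix u v c assume u: "u \<in> l2_on K" and v: "v \<in> l2_on K"
  show "rep a (u + v) = rep a u + rep a v"
    by (rule rep_eqI)
       (use has_sum_add[OF rep_has_sum[OF a u] rep_has_sum[OF a v]]
         in \<open>auto simp: algebra_simps intro!: l2_add rep_in_l2 a u v\<close>)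
next
  fix v c assume v: "v \<in> l2_on K"
  show "rep a (fun_scale c v) = fun_scale c (rep a v)"
    by (rule rep_eqI)
       (use has_sum_cmult_right[OF rep_has_sum[OF a v], of _ c]
         in \<open>auto simp: fun_scale_def mult_ac intro!: l2_scale[unfolded fun_scale_def] rep_in_l2 a v\<close>)
qed (rule rep_in_l2[OF a])

lemma rep_add:
  assumes "a \<in> l1" "b \<in> l1" "v \<in> l2_on K"
  shows "rep (a + b) v = rep a v + rep b v"
  by (rule rep_eqI)
     (use has_sum_add[OF rep_has_sum[OF assms(1,3)] rep_has_sum[OF assms(2,3)]]
       in \<open>auto simp: algebra_simps intro!: l2_add rep_in_l2 assms\<close>)

lemma rep_scale:
  assumes "a \<in> l1" "v \<in> l2_on K"
  shows "rep (l1_scale c a) v = fun_scale c (rep a v)"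
  by (rule rep_eqI)
     (use has_sum_cmult_right[OF rep_has_sum[OF assms], of _ c]
       in \<open>auto simp: fun_scale_def l1_scale_def mult_ac intro!: l2_scale[unfolded fun_scale_def]
           rep_in_l2 assms\<close>)

text \<open>The double series converges absolutely, so its sums may be exchanged. Replacing n by n -
  m in the inner sum separates the factors, the cocycle identity splitting the weight
  \<open>w n k\<close>.\<close>

lemma rep_mult:
  assumes a: "a \<in> l1" and b: "b \<in> l1" and v: "v \<in> l2_on K"
  shows "rep (l1_mult \<sigma> a b) v = rep a (rep b v)"
proof (rule ext)
  fix k
  show "rep (l1_mult \<sigma> a b) v k = rep a (rep b v) k"
  proof (cases "k \<in> K")
    case k: True
    let ?A = "\<lambda>m. apply_bcontfun (a m) (q k)"
    let ?B = "\<lambda>m n. apply_bcontfun (b (n - m)) (it (- m) (q k))"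
    define T where "T n m = ?A m * ?B m n * w n k * v (\<tau> (- n) k)" for n m
    have T_le: "norm (T n m) \<le> norm (a m) * norm (b (n - m)) * l2_norm v" for n m
      unfolding T_def
      by (simp add: norm_mult cocycle_norm k)
         (intro mult_mono norm_bounded cmod_le_l2_norm[OF v] mult_nonneg_nonneg norm_ge_zero)
    have "(\<lambda>(n, m). norm (a m) * norm (b (n - m))) summable_on UNIV \<times> UNIV"
      by (intro convolution_summable norm_summable_l1 a b) auto
    from summable_on_cmult_left[OF this, of "l2_norm v"]
    have "(\<lambda>(n, m). norm (a m) * norm (b (n - m)) * l2_norm v) summable_on UNIV \<times> UNIV"
      by (simp add: case_prod_unfold)
    then have "(\<lambda>x. norm (case x of (n, m) \<Rightarrow> T n m)) summable_on UNIV \<times> UNIV"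
      by (rule Infinite_Sum.abs_summable_on_comparison_test') (auto simp: T_le)
    then have T_sm: "(\<lambda>(n, m). T n m) summable_on UNIV \<times> UNIV"
      by (rule abs_summable_summable)
    have "rep (l1_mult \<sigma> a b) v k = (\<Sum>\<^sub>\<infinity>n. \<Sum>\<^sub>\<infinity>m. T n m)"
      using k by (simp add: rep_def T_def apply_l1_mult[OF a b] flip: infsum_cmult_left')
    also have "\<dots> = (\<Sum>\<^sub>\<infinity>m. \<Sum>\<^sub>\<infinity>n. T n m)"
      by (rule infsum_swap_banach[OF T_sm])
    also have "\<dots> = (\<Sum>\<^sub>\<infinity>m. ?A m * w m k * rep b v (\<tau> (- m) k))"
    proof (rule infsum_cong)
      fix m
      have "((\<lambda>n. apply_bcontfun (b (n - m)) (q (\<tau> (- m) k)) * w (n - m) (\<tau> (- m) k)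
          * v (\<tau> (- (n - m)) (\<tau> (- m) k))) has_sum rep b v (\<tau> (- m) k)) UNIV"
        using rep_has_sum[OF b v act_in[OF k], of "- m"]
        by (subst has_sum_reindex_bij_betw[where g = "\<lambda>n. n - m" and B = UNIV and f =
            "\<lambda>n. apply_bcontfun (b n) (q (\<tau> (- m) k)) * w n (\<tau> (- m) k) * v (\<tau> (- n) (\<tau> (- m) k))"])
           (auto intro!: bij_betwI[of _ _ _ "\<lambda>n. n + m"])
      from has_sum_cmult_right[OF this, of "?A m * w m k"]
      have "((\<lambda>n. T n m) has_sum ?A m * w m k * rep b v (\<tau> (- m) k)) UNIV"
      proof (rule has_sum_cong[THEN iffD1, rotated])
        fix n
        have "\<tau> (- (n - m)) (\<tau> (- m) k) = \<tau> (- n) k"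
          using act_add[OF k, of "- (n - m)" "- m"] by simp
        moreover have "w n k = w m k * w (n - m) (\<tau> (- m) k)"
          using cocycle[OF k, of m "n - m"] by simp
        ultimately show "?A m * w m k * (apply_bcontfun (b (n - m)) (q (\<tau> (- m) k)) *
            w (n - m) (\<tau> (- m) k) * v (\<tau> (- (n - m)) (\<tau> (- m) k))) = T n m"
          by (simp add: T_def equivariant[OF k])
      qed
      then show "(\<Sum>\<^sub>\<infinity>n. T n m) = ?A m * w m k * rep b v (\<tau> (- m) k)"
        by (rule infsumI)
    qed
    also have "\<dots> = rep a (rep b v) k"
      using k by (simp add: rep_def[of a])
    finally show ?thesis .
  qed (simp add: rep_def)
qed

text \<open>The double series over n and k converges absolutely because a product of two coordinates
  is bounded by the sum of their squares. Substituting k = \<open>\<tau> n j\<close> moves the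
  action to the other argument, and \<open>cocycle_neg\<close> converts the weights.\<close>

lemma rep_star:
  assumes a: "a \<in> l1" and u: "u \<in> l2_on K" and v: "v \<in> l2_on K"
  shows "fun_ip (rep a u) v = fun_ip u (rep (l1_star \<sigma> a) v)"
proof -
  let ?c = "\<lambda>n k. apply_bcontfun (a n) (q k) * w n k"
  define T where "T k n = ?c n k * u (\<tau> (- n) k) * cnj (v k)" for k n
  have T_le: "norm (T k n) \<le> norm (a n) * (cmod (u (\<tau> (- n) k)) * cmod (v k))" if "k \<in> K" for k n
  proof -
    have "norm (T k n) = norm (?c n k * u (\<tau> (- n) k)) * cmod (v k)"
      by (simp add: T_def norm_mult)
    also have "\<dots> \<le> (norm (a n) * cmod (u (\<tau> (- n) k))) * cmod (v k)"
      by (intro mult_right_mono norm_apply_le that norm_ge_zero)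
    finally show ?thesis by (simp add: mult.assoc)
  qed
  have "(\<lambda>x. norm (case x of (n, k) \<Rightarrow> T k n)) summable_on UNIV \<times> K"
  proof (rule Infinite_Sum.abs_summable_on_comparison_test')
    show "(\<lambda>(n, k). norm (a n) * ((cmod (u (\<tau> (- n) k)))\<^sup>2 + (cmod (v k))\<^sup>2)) summable_on UNIV \<times> K"
    proof (rule summable_on_SigmaI[where g = "\<lambda>n. norm (a n) * ((l2_norm u)\<^sup>2 + (l2_norm v)\<^sup>2)"])
      have on_K: "((\<lambda>k. (cmod (f k))\<^sup>2) has_sum (l2_norm f)\<^sup>2) K" if "f \<in> l2_on K" for f ::
          "'k \<Rightarrow> complex"
        using l2_has_sum[OF that] that
        by (subst has_sum_cong_neutral[where T = UNIV and g
            = "\<lambda>k. (cmod (f k))\<^sup>2"]) (auto simp: l2_on_def)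
      fix n :: int
      have "((\<lambda>k. (cmod (u (\<tau> (- n) k)))\<^sup>2) has_sum (l2_norm u)\<^sup>2) K"
        using has_sum_reindex_bij_betw[OF bij_act[of "- n"], of "\<lambda>k. (cmod (u k))\<^sup>2"] on_K[OF u] by simp
      from has_sum_cmult_right[OF has_sum_add[OF this on_K[OF v]], of "norm (a n)"]
      show "((\<lambda>k. case (n, k) of (n, k) \<Rightarrow> norm (a n) * ((cmod (u (\<tau> (- n) k)))\<^sup>2 + (cmod (v k))\<^sup>2))
          has_sum norm (a n) * ((l2_norm u)\<^sup>2 + (l2_norm v)\<^sup>2)) K" by simp
    qed (simp_all add: summable_on_cmult_left[OF norm_summable_l1[OF a]])
  next
    fix x assume x: "x \<in> (UNIV :: int set) \<times> K"
    obtain n k where [simp]: "x = (n, k)" by fastforce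
    show "norm (case x of (n, k) \<Rightarrow> T k n)
        \<le> (case x of (n, k) \<Rightarrow> norm (a n) * ((cmod (u (\<tau> (- n) k)))\<^sup>2 + (cmod (v k))\<^sup>2))"
      using x by (auto intro!: order_trans[OF T_le] mult_left_mono mult_le_sum_squares)
  qed
  then have T_sm': "(\<lambda>(n, k). T k n) summable_on UNIV \<times> K"
    by (rule abs_summable_summable)
  have reindex: "bij_betw (\<lambda>(n, j). (n, \<tau> n j)) (UNIV \<times> K) (UNIV \<times> K)"
    by (rule bij_betwI[where g = "\<lambda>(n, j). (n, \<tau> (- n) j)"]) (auto simp: act_in act_cancel)
  have T_sm'': "(\<lambda>(n, j). T (\<tau> n j) n) summable_on UNIV \<times> K"
    using T_sm' summable_on_reindex_bij_betw[OF reindex, of "\<lambda>(n, k). T k n"]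
    by (simp add: case_prod_unfold)
  have "fun_ip (rep a u) v = (\<Sum>\<^sub>\<infinity>k\<in>K. rep a u k * cnj (v k))"
    by (rule fun_ip_on) (use v in simp)
  also have "\<dots> = (\<Sum>\<^sub>\<infinity>k\<in>K. \<Sum>\<^sub>\<infinity>n. T k n)"
    by (rule infsum_cong) (simp add: rep_def T_def flip: infsum_cmult_left')
  also have "\<dots> = (\<Sum>\<^sub>\<infinity>n. \<Sum>\<^sub>\<infinity>k\<in>K. T k n)"
    by (rule infsum_swap_banach[symmetric, OF T_sm'])
  also have "\<dots> = (\<Sum>\<^sub>\<infinity>n. \<Sum>\<^sub>\<infinity>j\<in>K. T (\<tau> n j) n)"
    by (intro infsum_cong infsum_reindex_bij_betw[symmetric] bij_act)
  also have "\<dots> = (\<Sum>\<^sub>\<infinity>j\<in>K. \<Sum>\<^sub>\<infinity>n. T (\<tau> n j) n)"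
    by (rule infsum_swap_banach[OF T_sm''])
  also have "\<dots> = (\<Sum>\<^sub>\<infinity>j\<in>K. u j * cnj (rep (l1_star \<sigma> a) v j))"
  proof (rule infsum_cong)
    fix j assume j: "j \<in> K"
    let ?R = "\<lambda>n. apply_bcontfun (l1_star \<sigma> a n) (q j) * w n j * v (\<tau> (- n) j)"
    have "(\<Sum>\<^sub>\<infinity>n. T (\<tau> n j) n) = (\<Sum>\<^sub>\<infinity>n. u j * cnj (?R (- n)))"
      by (rule infsum_cong)
         (simp add: T_def equivariant j act_cancel apply_l1_star cocycle_neg mult_ac)
    also have "\<dots> = (\<Sum>\<^sub>\<infinity>n. u j * cnj (?R n))"
      by (rule infsum_reindex_bij_betw[of uminus UNIV UNIV "\<lambda>n. u j
          * cnj (?R n)"]) (simp add: bij_uminus)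
    also have "\<dots> = u j * cnj (rep (l1_star \<sigma> a) v j)"
      using j by (simp add: rep_def infsum_cmult_right' del: complex_cnj_mult)
    finally show "(\<Sum>\<^sub>\<infinity>n. T (\<tau> n j) n) = u j * cnj (rep (l1_star \<sigma> a) v j)" .
  qed
  also have "\<dots> = fun_ip u (rep (l1_star \<sigma> a) v)"
    by (rule fun_ip_on[symmetric]) (use u in simp)
  finally show ?thesis .
qed

lemma alg_rep_rep: "alg_rep \<sigma> fun_scale (l2_on K) rep"
  unfolding alg_rep_def
  by (auto simp: vector_space_fun_scale subspace_l2 linear_op_rep rep_add rep_scale rep_mult)

theorem involutive_rep_rep: "involutive_rep \<sigma> fun_scale (l2_on K) fun_ip rep"
proof -
  have "bounded_op_on fun_scale (l2_on K) fun_ip (rep a)" if a: "a \<in> l1" for a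
    unfolding bounded_op_on_def
  proof (intro conjI exI ballI linear_op_rep a)
    fix v assume v: "v \<in> l2_on K"
    show "ip_norm fun_ip (rep a v) \<le> l1_norm a * ip_norm fun_ip v"
      using l2_norm_rep_le[OF a v] by
          (simp add: ip_norm_fun_ip[OF v] ip_norm_fun_ip[OF rep_in_l2[OF a v]])
  qed
  then show ?thesis
    unfolding involutive_rep_def by (simp add: hilbert_space_l2 alg_rep_rep rep_star)
qed

lemma rep_monom:
  "rep (l1_monom f m) v = (\<lambda>k. if k \<in> K then apply_bcontfun f (q k) * w m k * v (\<tau> (- m) k) else 0)"
proof -
  have "(\<Sum>\<^sub>\<infinity>n. apply_bcontfun (l1_monom f m n) (q k) * w n k * v (\<tau> (- n) k))
      = apply_bcontfun f (q k) * w m k * v (\<tau> (- m) k)" for k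
    by (subst infsum_single[where m = m]) (auto simp: l1_monom_def)
  then show ?thesis by (simp add: rep_def fun_eq_iff)
qed

lemma unital_rep_rep: "unital_rep (l2_on K) rep"
  unfolding unital_rep_def
  by (auto simp: l1_one_eq_monom rep_monom act_0 cocycle_0 l2_on_def fun_eq_iff)

lemma kernel_rep_subset:
  "{a \<in> l1. \<forall>n. \<forall>k\<in>K. apply_bcontfun (a n) (q k) = 0} \<subseteq> rep_kernel (l2_on K) rep"
  by (auto simp: rep_kernel_def rep_def fun_eq_iff)

text \<open>On a free orbit the points \<open>\<tau> (- m) k\<close> are distinct, so applying the
  operator to the point mass at \<open>\<tau> (- n) k\<close> and evaluating at k isolates the n-th
  coefficient.\<close>

lemma kernel_rep_free:
  assumes free: "\<And>k n. k \<in> K \<Longrightarrow> \<tau> n k = k \<Longrightarrow> n = 0"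
  shows "rep_kernel (l2_on K) rep = {a \<in> l1. \<forall>n. \<forall>k\<in>K. apply_bcontfun (a n) (q k) = 0}"
proof
  show "rep_kernel (l2_on K) rep \<subseteq> {a \<in> l1. \<forall>n. \<forall>k\<in>K. apply_bcontfun (a n) (q k) = 0}"
  proof (clarsimp simp: rep_kernel_def)
    fix a n k assume a: "a \<in> l1" and zero: "\<forall>v\<in>l2_on K. rep a v = 0" and k: "k \<in> K"
    have eq: "\<tau> (- m) k = \<tau> (- n) k \<longleftrightarrow> m = n" for m
    proof
      assume "\<tau> (- m) k = \<tau> (- n) k"
      then have "\<tau> (n - m) k = k"
        using act_add[OF k, of n "- m"] act_cancel(2)[OF k] by simp
      with free[OF k] show "m = n" by force
    qed simp
    have "rep a (fun_basis (\<tau> (- n) k)) k = apply_bcontfun (a n) (q k) * w n k"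
      using k by (simp add: rep_def fun_basis_def) (subst infsum_single[where m = n], auto simp: eq)
    moreover have "rep a (fun_basis (\<tau> (- n) k)) = 0"
      using zero k by (simp add: fun_basis_in_l2 act_in)
    ultimately have "apply_bcontfun (a n) (q k) * w n k = 0" by simp
    then show "apply_bcontfun (a n) (q k) = 0" using cocycle_norm[OF k, of n] by auto
  qed
qed (rule kernel_rep_subset)

end

section \<open>Separation of closed sets by continuous functions\<close>

context dynamical_system
begin

lemma normal_space_X: "normal_space (euclidean :: 'x topology)"
  and regular_space_X: "regular_space (euclidean :: 'x topology)"
  and compact_space_X: "compact_space (euclidean :: 'x topology)"
proof -
  show c: "compact_space (euclidean :: 'x topology)"
    using compact_space by (simp add: compact_space_def)
  have h: "Hausdorff_space (euclidean :: 'x topology)"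
    unfolding Hausdorff_space_def disjnt_def using hausdorff by (metis open_openin)
  show "normal_space (euclidean :: 'x topology)"
    using compact_Hausdorff_or_regular_imp_normal_space[OF c] h by blast
  show "regular_space (euclidean :: 'x topology)"
    using compact_Hausdorff_imp_regular_space[OF c h] .
qed

lemma bump_function:
  fixes S T :: "'x set"
  assumes "closed S" "closed T" "S \<inter> T = {}"
  obtains f :: "'x \<Rightarrow>\<^sub>C complex" where "\<And>x. cmod (apply_bcontfun f x) \<le> 1"
    "\<And>x. x \<in> S \<Longrightarrow> apply_bcontfun f x = 1" "\<And>x. x \<in> T \<Longrightarrow> apply_bcontfun f x = 0"
proof -
  obtain g :: "'x \<Rightarrow> real" where g: "continuous_map euclidean (top_of_set {0..1}) g"
    "g ` T \<subseteq> {0}" "g ` S \<subseteq> {1}"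
    using Urysohn_lemma[OF normal_space_X, of T S 0 1] assms by (auto simp: disjnt_def)
  then have "continuous_on UNIV g" and range: "g x \<in> {0..1}" for x
    by (auto simp: continuous_map_in_subtopology image_subset_iff)
  then have f: "apply_bcontfun (Bcontfun (\<lambda>x. complex_of_real (g x))) = (\<lambda>x. complex_of_real (g x))"
    by (intro apply_Bcontfun continuous_intros)
  have "\<bar>g x\<bar> \<le> 1" for x using range[of x] by auto
  then show ?thesis
    by (intro that[of "Bcontfun (\<lambda>x. complex_of_real (g x))"])
       (use g(2,3) in \<open>auto simp: f image_subset_iff\<close>)
qed

end

section \<open>Topological irreducibility on a single orbit\<close>

context orbit_rep
begin

lemma rep_embed:
  assumes "v \<in> l2_on K"
  shows "rep (l1_embed f) v = (\<lambda>k. apply_bcontfun f (q k) * v k)"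
  using assms by (auto simp: l1_embed_eq_monom rep_monom act_0 cocycle_0 l2_on_def fun_eq_iff)

lemma rep_shift_basis:
  assumes j: "j \<in> K"
  shows "rep (l1_monom (const_bcontfun 1) m) (fun_basis j)
      = fun_scale (w m (\<tau> m j)) (fun_basis (\<tau> m j))"
proof -
  have "\<tau> (- m) k = j \<longleftrightarrow> k = \<tau> m j" if "k \<in> K" for k
    using act_cancel[OF j] act_cancel[OF that] by metis
  then show ?thesis
    using act_in[OF j] by (auto simp: rep_monom fun_scale_def fun_basis_def fun_eq_iff)
qed

text \<open>Injectivity of q lets a function be 1 at q j and 0 at finitely many other points of the
  orbit. Applied to a vector of V with nonzero j-th coordinate it yields a multiple of the j-th
  basis vector up to a small tail. As V is closed it contains this basis vector, then all others by
  shifting, and finally their closed span.\<close>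

theorem top_irreducible_rep:
  assumes k0: "k0 \<in> K" and orbit: "\<And>k. k \<in> K \<Longrightarrow> \<exists>n. k = \<tau> n k0" and inj: "inj_on q K"
  shows "top_irreducible \<sigma> fun_scale (l2_on K) fun_ip rep"
  unfolding top_irreducible_def
proof (intro conjI involutive_rep_rep allI impI; (elim conjE)?)
  show "nonzero_rep (l2_on K) rep"
    unfolding nonzero_rep_def
  proof (intro bexI)
    show "rep l1_one (fun_basis k0) \<noteq> 0"
      using unital_rep_rep fun_basis_in_l2[OF k0]
      by (auto simp: unital_rep_def fun_basis_def fun_eq_iff)
  qed (auto intro: fun_basis_in_l2 k0)
next
  interpret vector_space fun_scale by (rule vector_space_fun_scale)
  fix V
  assume inv: "invariant_subspace fun_scale (l2_on K) rep V"
    and cl: "closedin (Metric_space.mtopology (l2_on K) (ip_dist (l2_on K) fun_ip)) V"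
  from inv have sub: "subspace V" and V: "V \<subseteq> l2_on K"
    and rep_V: "\<And>a v. a \<in> l1 \<Longrightarrow> v \<in> V \<Longrightarrow> rep a v \<in> V"
    by (auto simp: invariant_subspace_def)
  show "V = {0} \<or> V = l2_on K"
  proof (cases "V = {0}")
    case False
    then obtain v where v: "v \<in> V" "v \<noteq> 0"
      using subspace_0[OF sub] by blast
    have v2: "v \<in> l2_on K" using v V by blast
    from v(2) obtain j where j: "v j \<noteq> 0" by (auto simp: fun_eq_iff)
    with v2 have jK: "j \<in> K" by (auto simp: l2_on_def)
    have basis_j: "fun_basis j \<in> V"
    proof (rule l2_closed_limit[OF cl fun_basis_in_l2[OF jK]])
      fix \<epsilon> :: real assume "0 < \<epsilon>"
      \<comment> \<open>The error is later divided by v j when the j-th coordinate is normalized to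
        1.\<close>
      with j have "0 < \<epsilon> * cmod (v j)" by simp
      from l2_tail[OF v2 this] obtain F where F: "finite F" "F \<subseteq> K"
        and small: "\<And>u. (\<And>k. k \<in> F \<Longrightarrow> u k = 0) \<Longrightarrow> (\<And>k. cmod (u k) \<le> cmod (v k))
          \<Longrightarrow> l2_norm u < \<epsilon> * cmod (v j)" by blast
      have "{q j} \<inter> q ` (F - {j}) = {}"
        using inj F(2) jK by (auto dest: inj_onD)
      then obtain f :: "'x \<Rightarrow>\<^sub>C complex" where f: "\<And>x. cmod (apply_bcontfun f x) \<le> 1"
        "apply_bcontfun f (q j) = 1" "\<And>k. k \<in> F - {j} \<Longrightarrow> apply_bcontfun f (q k) = 0"
        using bump_function[of "{q j}" "q ` (F - {j})"] F(1)
        by (metis finite_Diff finite_imageI finite_imp_closed closed_singleton imageI singletonI)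
      define g where "g k = (if k = j then 0 else apply_bcontfun f (q k) * v k)" for k
      have "l2_norm g < \<epsilon> * cmod (v j)"
      proof (rule small)
        show "g k = 0" if "k \<in> F" for k using that f(3)[of k] by (auto simp: g_def)
        show "cmod (g k) \<le> cmod (v k)" for k
          using mult_right_mono[OF f(1)[of "q k"], of "cmod (v k)"] by (auto simp: g_def norm_mult)
      qed
      let ?u = "fun_scale (inverse (v j)) (rep (l1_embed f) v)"
      have "fun_basis j - ?u = fun_scale (- inverse (v j)) g"
        using j f(2) by (auto simp: fun_eq_iff fun_basis_def fun_scale_def g_def rep_embed[OF v2])
      then have "l2_norm (fun_basis j - ?u) = l2_norm g / cmod (v j)"
        by (simp only: l2_norm_scale norm_minus_cancel norm_inverse divide_inverse mult.commute)
      also have "\<dots> < \<epsilon>"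
        using \<open>l2_norm g < _\<close> j by (simp add: divide_less_eq)
      finally show "\<exists>u\<in>V. l2_norm (fun_basis j - u) < \<epsilon>"
        using subspace_scale[OF sub rep_V[OF l1_embed_in v(1)]] by blast
    qed
    have basis: "fun_basis k \<in> V" if k: "k \<in> K" for k
    proof -
      obtain m n where mn: "j = \<tau> m k0" "k = \<tau> n k0" using orbit jK k by meson
      have "\<tau> (n - m) j = k"
        using act_add[OF k0, of "n - m" m] mn by simp
      then have "fun_scale (w (n - m) k) (fun_basis k) \<in> V"
        using rep_shift_basis[OF jK, of "n - m"] rep_V[OF l1_monom_in basis_j] by metis
      from subspace_scale[OF sub this, of "inverse (w (n - m) k)"]
      have "fun_scale (inverse (w (n - m) k) * w (n - m) k) (fun_basis k) \<in> V" by simp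
      moreover have "w (n - m) k \<noteq> 0" using cocycle_norm[OF k, of "n - m"] by auto
      ultimately show ?thesis by simp
    qed
    have "u \<in> V" if u: "u \<in> l2_on K" for u
    proof (rule l2_closed_limit[OF cl u])
      fix \<epsilon> :: real assume "0 < \<epsilon>"
      from l2_tail[OF u this] obtain F where F: "finite F" "F \<subseteq> K"
        and small: "\<And>z. (\<And>k. k \<in> F \<Longrightarrow> z k = 0) \<Longrightarrow> (\<And>k. cmod (z k) \<le> cmod (u k)) \<Longrightarrow> l2_norm z < \<epsilon>"
        by blast
      let ?s = "\<Sum>k\<in>F. fun_scale (u k) (fun_basis k)"
      have s: "?s k = (if k \<in> F then u k else 0)" for k
        using F(1) by (auto simp: sum_fun_apply fun_scale_def fun_basis_def if_distrib cong: if_cong)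
      have "?s \<in> V"
        by (intro subspace_sum[OF sub] subspace_scale[OF sub] basis) (use F in auto)
      moreover have "l2_norm (u - ?s) < \<epsilon>"
        by (rule small) (auto simp: s)
      ultimately show "\<exists>v\<in>V. l2_norm (u - v) < \<epsilon>" by blast
    qed
    with V show ?thesis by blast
  qed simp
qed

end

text \<open>\<open>pi_per\<close> and \<open>pi_aper\<close> are matched with \<open>rep\<close>
  only on their carriers, where the inverse iterates formed by \<open>inv_into\<close> are
  meaningful. This and the next two congruences show that such agreement suffices.\<close>

lemma alg_rep_cong:
  assumes eq: "\<And>a v. a \<in> l1 \<Longrightarrow> v \<in> H \<Longrightarrow> \<pi>' a v = \<pi> a v" and alg: "alg_rep \<sigma> sc H \<pi>"
    and l1: "\<And>a b. a \<in> l1 \<Longrightarrow> b \<in> l1 \<Longrightarrow> l1_mult \<sigma> a b \<in> l1"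
  shows "alg_rep \<sigma> sc H \<pi>'"
proof -
  from alg interpret vector_space sc by (simp add: alg_rep_def)
  have sub: "subspace H" and op: "\<And>a. a \<in> l1 \<Longrightarrow> linear_op_on sc H (\<pi> a)"
    using alg by (auto simp: alg_rep_def)
  have op': "linear_op_on sc H (\<pi>' a)" if a: "a \<in> l1" for a
    using op[OF a] subspace_add[OF sub] subspace_scale[OF sub] unfolding linear_op_on_def
    by (simp add: eq[OF a])
  have "\<pi> b v \<in> H" if "b \<in> l1" "v \<in> H" for b v
    using op[OF that(1)] that(2) by (auto simp: linear_op_on_def)
  with alg op' show ?thesis
    unfolding alg_rep_def by (simp add: eq l1 l1_add l1_scale_in)
qed

lemma rep_kernel_cong:
  assumes "\<And>a v. a \<in> l1 \<Longrightarrow> v \<in> H \<Longrightarrow> \<pi>' a v = \<pi> a v"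
  shows "rep_kernel H \<pi>' = rep_kernel H \<pi>"
  using assms by (auto simp: rep_kernel_def)

context dynamical_system
begin

lemma top_irreducible_cong:
  assumes eq: "\<And>a v. a \<in> l1 \<Longrightarrow> v \<in> H \<Longrightarrow> \<pi>' a v = \<pi> a v" and irr: "top_irreducible \<sigma> sc H ip \<pi>"
  shows "top_irreducible \<sigma> sc H ip \<pi>'"
proof -
  have inv: "involutive_rep \<sigma> sc H ip \<pi>" and nz: "nonzero_rep H \<pi>"
    and subs: "\<And>V. invariant_subspace sc H \<pi> V \<Longrightarrow>
      closedin (Metric_space.mtopology H (ip_dist H ip)) V \<Longrightarrow> V = {0} \<or> V = H"
    using irr by (auto simp: top_irreducible_def)
  have hs: "hilbert_space sc H ip" and alg: "alg_rep \<sigma> sc H \<pi>"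
    and bd: "\<And>a. a \<in> l1 \<Longrightarrow> bounded_op_on sc H ip (\<pi> a)"
    using inv by (auto simp: involutive_rep_def)
  have alg': "alg_rep \<sigma> sc H \<pi>'"
    by (rule alg_rep_cong[OF eq alg]) auto
  have "bounded_op_on sc H ip (\<pi>' a)" if a: "a \<in> l1" for a
    using bd[OF a] alg' a eq[OF a] unfolding bounded_op_on_def alg_rep_def by simp
  with inv alg' have "involutive_rep \<sigma> sc H ip \<pi>'"
    unfolding involutive_rep_def by (simp add: eq l1_star_in)
  moreover have "nonzero_rep H \<pi>'"
    using nz by (auto simp: nonzero_rep_def eq)
  moreover have "invariant_subspace sc H \<pi> V" if "invariant_subspace sc H \<pi>' V" for V
  proof -
    have "V \<subseteq> H" using that by (simp add: invariant_subspace_def)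
    then have "\<pi>' a v = \<pi> a v" if "a \<in> l1" "v \<in> V" for a v
      using that by (auto intro: eq)
    with that show ?thesis by (simp add: invariant_subspace_def)
  qed
  ultimately show ?thesis
    unfolding top_irreducible_def using subs by blast
qed

end

section \<open>The representations attached to points\<close>

lemma seq_scale_eq: "seq_scale = fun_scale"
  by (simp add: seq_scale_def fun_scale_def fun_eq_iff)

lemma seq_ip_eq: "seq_ip = fun_ip"
  by (simp add: seq_ip_def fun_ip_def fun_eq_iff)

lemma ell2_eq: "ell2 = l2_on UNIV"
  by (simp add: ell2_def l2_on_def)

lemma l2_on_finite:
  assumes "finite K"
  shows "l2_on K = {v. \<forall>k. k \<notin> K \<longrightarrow> v k = 0}"
proof -
  have "(\<lambda>k. (cmod (v k))\<^sup>2) summable_on UNIV" if "\<forall>k. k \<notin> K \<longrightarrow> v k = 0" for v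
  proof -
    have "finite {k \<in> UNIV. (cmod (v k))\<^sup>2 \<noteq> 0}"
      by (rule finite_subset[OF _ assms]) (use that in auto)
    then show ?thesis by (rule finite_nonzero_values_imp_summable_on)
  qed
  then show ?thesis by (auto simp: l2_on_def)
qed

lemma H_per_eq: "H_per p = l2_on {0..<int p}"
  by (simp add: H_per_def l2_on_finite)

lemma fin_dim_H_per: "fin_dim seq_scale (H_per p)"
proof -
  interpret vector_space fun_scale by (rule vector_space_fun_scale)
  let ?B = "fun_basis ` {0..<int p}"
  have B: "?B \<subseteq> H_per p" by (auto simp: H_per_eq intro: fun_basis_in_l2)
  have "v \<in> span ?B" if v: "v \<in> H_per p" for v
  proof -
    have "v = (\<Sum>k\<in>{0..<int p}. fun_scale (v k) (fun_basis k))"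
      using v by (auto simp: fun_eq_iff sum_fun_apply fun_scale_def fun_basis_def H_per_def
          if_distrib cong: if_cong)
    also have "\<dots> \<in> span ?B"
      by (intro span_sum span_scale span_base) auto
    finally show ?thesis .
  qed
  moreover have "span ?B \<subseteq> H_per p"
    by (rule span_minimal[OF B]) (simp add: H_per_eq subspace_l2)
  ultimately have "span ?B = H_per p" by blast
  with B show ?thesis unfolding fin_dim_def seq_scale_eq by blast
qed

lemma shift_in_ell2: "v \<in> ell2 \<Longrightarrow> (\<lambda>k. v (k - n)) \<in> ell2"
  unfolding ell2_def mem_Collect_eq
  by (subst summable_on_reindex_bij_betw[where g = "\<lambda>k. k - n" and B = UNIV and f
      = "\<lambda>k. (cmod (v k))\<^sup>2"])
     (auto intro!: bij_betwI[of _ _ _ "\<lambda>k. k + n"])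

lemma int_iterate_shift: "v \<in> ell2 \<Longrightarrow> int_iterate ell2 shift_op n v = (\<lambda>k. v (k - n))"
proof (rule int_iterate_unique)
  show "bij_betw shift_op ell2 ell2"
  proof (rule bij_betwI[where g = "\<lambda>v k. v (k + 1)"])
    show "shift_op \<in> ell2 \<rightarrow> ell2" using shift_in_ell2[where n = 1] by (auto simp: shift_op_def[abs_def])
    show "(\<lambda>v k. v (k + 1)) \<in> ell2 \<rightarrow> ell2" using shift_in_ell2[where n = "- 1"] by auto
  qed (auto simp: shift_op_def)
qed (auto simp: shift_in_ell2 shift_op_def algebra_simps)

text \<open>Closed form of the n-th power of T_\<lambda>. The coordinate k receives its value from
  (k - n) mod p, and -((k - n) div p) is the number of passages from p - 1 to 0 on the way, each
  contributing a factor c.\<close>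

definition per_iterate :: "nat \<Rightarrow> complex \<Rightarrow> int \<Rightarrow> (int \<Rightarrow> complex) \<Rightarrow> int \<Rightarrow> complex"
  where "per_iterate p c n v = (\<lambda>k. if k \<in> {0..<int p}
    then c powi (- ((k - n) div int p)) * v ((k - n) mod int p) else 0)"

lemma int_iterate_T_op:
  assumes p: "0 < p" and c: "c \<noteq> 0" and v: "v \<in> H_per p"
  shows "int_iterate (H_per p) (T_op p c) n v = per_iterate p c n v"
proof (rule int_iterate_unique[OF _ _ _ _ v])
  show "bij_betw (T_op p c) (H_per p) (H_per p)"
  proof (rule bij_betwI[where g = "\<lambda>v k. if k = int p - 1 then v 0 / c
        else if 0 \<le> k \<and> k < int p then v (k + 1) else 0"])
  qed (use p c in \<open>auto simp: T_op_def H_per_def fun_eq_iff\<close>)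
  fix u n assume u: "u \<in> H_per p"
  show "per_iterate p c n u \<in> H_per p"
    by (auto simp: per_iterate_def H_per_def)
  show "per_iterate p c 0 u = u"
    using u by (auto simp: per_iterate_def H_per_def fun_eq_iff)
  show "per_iterate p c (n + 1) u = T_op p c (per_iterate p c n u)"
  proof (rule ext)
    fix k
    consider "k = 0" | "0 < k" "k < int p" | "k < 0 \<or> int p \<le> k" by linarith
    then show "per_iterate p c (n + 1) u k = T_op p c (per_iterate p c n u) k"
    proof cases
      case 1
      \<comment> \<open>The value at 0 is fetched from position p - 1; this raises the quotient by
        one, which compensates the factor c.\<close>
      have wrap: "(int p - 1 - n) div int p = (- 1 - n) div int p + 1"
        "(int p - 1 - n) mod int p = (- 1 - n) mod int p"
        using div_add_self2[of "int p" "- 1 - n"] mod_add_self2[of "- 1 - n" "int p"] p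
        by (simp_all add: algebra_simps)
      have "c * c powi (- ((- 1 - n) div int p + 1)) = c powi (- ((- 1 - n) div int p))"
        using c by (simp add: power_int_diff)
      moreover have "0 - (n + 1) = - 1 - n" by simp
      ultimately show ?thesis
        using p by (simp only: 1 per_iterate_def T_op_def wrap) simp
    next
      case 2
      then have "k - (n + 1) = k - 1 - n" by simp
      with 2 show ?thesis by (simp only: per_iterate_def T_op_def) simp
    qed (use p in \<open>auto simp: per_iterate_def T_op_def\<close>)
  qed
qed

context dynamical_system
begin

lemma orbit_rep_per:
  assumes x: "x \<in> Per \<sigma>" and c: "cmod c = 1"
  shows "orbit_rep \<sigma> {0..<int (period \<sigma> x)} (\<lambda>n k. (k + n) mod int (period \<sigma> x)) (\<lambda>k. it k x)
      (\<lambda>n k. c powi (- ((k - n) div int (period \<sigma> x))))"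
proof -
  let ?p = "int (period \<sigma> x)"
  have p: "0 < ?p" using period_pos[OF x] by simp
  show ?thesis
  proof
    fix k m n :: int assume "k \<in> {0..<?p}"
    show "it ((k + n) mod ?p) x = it n (it k x)"
      by (simp add: it_eq_iff_mod_period[OF x] flip: it_add) (simp add: add.commute)
    show "cmod (c powi - ((k - n) div ?p)) = 1"
      by (simp add: norm_power_int c)
    \<comment> \<open>Passages add up: those made during the shift by m, and those made during the
      shift by n after reducing modulo p.\<close>
    have "(k - (m + n)) div ?p = (k - m) div ?p + ((k + - m) mod ?p - n) div ?p"
    proof -
      have "k - (m + n) = ((k - m) mod ?p - n) + (k - m) div ?p * ?p"
        using div_mult_mod_eq[of "k - m" ?p] by linarith
      then show ?thesis using p by (metis div_mult_self1 add.commute diff_conv_add_uminus less_irrefl)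
    qed
    moreover have "c \<noteq> 0" using c by auto
    ultimately show "c powi - ((k - (m + n)) div ?p)
        = c powi - ((k - m) div ?p) * c powi - (((k + - m) mod ?p - n) div ?p)"
      by (simp flip: power_int_add)
  qed (use p in \<open>auto simp: mod_simps algebra_simps\<close>)
qed

lemma orbit_rep_aper: "orbit_rep \<sigma> UNIV (\<lambda>n k. k + n) (\<lambda>k. it k x) (\<lambda>n k. 1)"
  by unfold_locales (auto simp: it_add[symmetric] add.commute)

lemma pi_per_eq_rep:
  assumes x: "x \<in> Per \<sigma>" and c: "cmod c = 1" and v: "v \<in> H_per (period \<sigma> x)"
  shows "pi_per \<sigma> x c a v = orbit_rep.rep {0..<int (period \<sigma> x)}
      (\<lambda>n k. (k + n) mod int (period \<sigma> x)) (\<lambda>k. it k x)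
      (\<lambda>n k. c powi (- ((k - n) div int (period \<sigma> x)))) a v"
proof -
  have "c \<noteq> 0" using c by auto
  then show ?thesis
    unfolding orbit_rep.rep_def[OF orbit_rep_per[OF x c]] pi_per_def
    by (auto simp: fun_eq_iff int_iterate_T_op[OF period_pos[OF x] _ v] mult_op_def per_iterate_def
        mult.assoc)
qed

lemma pi_aper_eq_rep:
  assumes "v \<in> ell2"
  shows "pi_aper \<sigma> x a v = orbit_rep.rep UNIV (\<lambda>n k. k + n) (\<lambda>k. it k x) (\<lambda>n k. 1) a v"
  unfolding orbit_rep.rep_def[OF orbit_rep_aper] pi_aper_def
  by (auto simp: fun_eq_iff int_iterate_shift[OF assms] mult_op_def)

lemma top_irreducible_per:
  assumes x: "x \<in> Per \<sigma>" and c: "cmod c = 1"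
  shows "top_irreducible \<sigma> seq_scale (H_per (period \<sigma> x)) seq_ip (pi_per \<sigma> x c)"
proof (rule top_irreducible_cong[OF pi_per_eq_rep[OF x c]])
  let ?p = "int (period \<sigma> x)"
  have p: "0 < ?p" using period_pos[OF x] by simp
  interpret orbit_rep \<sigma> "{0..<?p}" "\<lambda>n k. (k + n) mod ?p" "\<lambda>k. it k x"
    "\<lambda>n k. c powi (- ((k - n) div ?p))"
    by (rule orbit_rep_per[OF x c])
  have "inj_on (\<lambda>k. it k x) {0..<?p}"
    by (auto simp: inj_on_def it_eq_iff_mod_period[OF x])
  then show "top_irreducible \<sigma> seq_scale (H_per (period \<sigma> x)) seq_ip rep"
    unfolding seq_scale_eq seq_ip_eq H_per_eq
    by (rule top_irreducible_rep[of 0, rotated 2])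
       (use p in \<open>auto intro: mod_pos_pos_trivial[symmetric]\<close>)
qed auto

lemma top_irreducible_aper:
  assumes x: "x \<in> Aper \<sigma>"
  shows "top_irreducible \<sigma> seq_scale ell2 seq_ip (pi_aper \<sigma> x)"
proof (rule top_irreducible_cong[OF pi_aper_eq_rep])
  interpret orbit_rep \<sigma> UNIV "\<lambda>n k. k + n" "\<lambda>k. it k x" "\<lambda>n k. 1"
    by (rule orbit_rep_aper)
  show "top_irreducible \<sigma> seq_scale ell2 seq_ip rep"
    unfolding seq_scale_eq seq_ip_eq ell2_eq
    by (rule top_irreducible_rep[of 0]) (auto simp: inj_on_def it_inj_Aper[OF x])
qed auto

lemma rep_kernel_aper:
  assumes x: "x \<in> Aper \<sigma>"
  shows "rep_kernel ell2 (pi_aper \<sigma> x) = {a \<in> l1. \<forall>n k. apply_bcontfun (a n) (it k x) = 0}"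
proof -
  interpret orbit_rep \<sigma> UNIV "\<lambda>n k. k + n" "\<lambda>k. it k x" "\<lambda>n k. 1"
    by (rule orbit_rep_aper)
  have "rep_kernel ell2 (pi_aper \<sigma> x) = rep_kernel ell2 rep"
    by (rule rep_kernel_cong) (rule pi_aper_eq_rep)
  then show ?thesis by (simp add: ell2_eq kernel_rep_free)
qed

end

section \<open>Closed ideals\<close>

text \<open>Kept abstract because it is applied both to kernels of algebraically irreducible
  representations and to kernels of representations on l^2(K).\<close>

locale closed_ideal = dynamical_system \<sigma>
  for \<sigma> :: "'x::t2_space \<Rightarrow> 'x" +
  fixes J :: "(int \<Rightarrow> ('x \<Rightarrow>\<^sub>C complex)) set"
  assumes ideal_l1: "a \<in> J \<Longrightarrow> a \<in> l1"
    and ideal_0: "0 \<in> J"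
    and ideal_add: "a \<in> J \<Longrightarrow> b \<in> J \<Longrightarrow> a + b \<in> J"
    and ideal_left: "a \<in> l1 \<Longrightarrow> b \<in> J \<Longrightarrow> l1_mult \<sigma> a b \<in> J"
    and ideal_right: "a \<in> J \<Longrightarrow> b \<in> l1 \<Longrightarrow> l1_mult \<sigma> a b \<in> J"
    and ideal_closed: "a \<in> l1 \<Longrightarrow> (\<And>\<epsilon>. 0 < \<epsilon> \<Longrightarrow> \<exists>b\<in>J. l1_norm (a - b) < \<epsilon>) \<Longrightarrow> a \<in> J"
begin

lemma ideal_scale: "a \<in> J \<Longrightarrow> l1_scale c a \<in> J"
proof -
  have "l1_scale c a = l1_mult \<sigma> (l1_monom (const_bcontfun c) 0) a"
    by (rule ext, subst l1_mult_monom_left) (auto simp: l1_scale_def intro!: bcontfun_eqI)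
  then show "a \<in> J \<Longrightarrow> l1_scale c a \<in> J" by (simp add: ideal_left)
qed

lemma ideal_diff: "a \<in> J \<Longrightarrow> b \<in> J \<Longrightarrow> a - b \<in> J"
  using ideal_add[of a "- b"] ideal_scale[of b "- 1"] by (simp add: l1_scale_minus_one)

lemma ideal_sum: "(\<And>i. i \<in> F \<Longrightarrow> a i \<in> J) \<Longrightarrow> (\<Sum>i\<in>F. a i) \<in> J"
  by (induction F rule: infinite_finite_induct) (auto simp: ideal_0 ideal_add)

lemma ideal_monom: "l1_embed f \<in> J \<Longrightarrow> l1_monom f n \<in> J"
proof -
  assume "l1_embed f \<in> J"
  from ideal_right[OF this, of "l1_monom (const_bcontfun 1) n"]
  have "l1_monom (f * alpha_pow \<sigma> 0 (const_bcontfun 1)) n \<in> J"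
    by (simp add: l1_embed_eq_monom l1_mult_monom_monom)
  moreover have "f * alpha_pow \<sigma> 0 (const_bcontfun 1) = f"
    by (rule bcontfun_eqI) simp
  ultimately show ?thesis by simp
qed

lemma ideal_coefficients:
  assumes a: "a \<in> l1" and coeff: "\<And>n. l1_embed (a n) \<in> J"
  shows "a \<in> J"
proof (rule ideal_closed[OF a])
  fix \<epsilon> :: real assume "0 < \<epsilon>"
  from l1_finite_approx[OF a this] obtain F where
    "finite F" "l1_norm (a - (\<Sum>n\<in>F. l1_monom (a n) n)) < \<epsilon>" by blast
  moreover have "(\<Sum>n\<in>F. l1_monom (a n) n) \<in> J"
    by (intro ideal_sum ideal_monom coeff)
  ultimately show "\<exists>b\<in>J. l1_norm (a - b) < \<epsilon>" by blast
qed

lemma embed_mult_left: "l1_embed f \<in> J \<Longrightarrow> l1_embed (g * f) \<in> J"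
  using ideal_left[of "l1_embed g" "l1_embed f"] by (simp add: l1_mult_embed_embed)

lemma embed_add: "l1_embed f \<in> J \<Longrightarrow> l1_embed g \<in> J \<Longrightarrow> l1_embed (f + g) \<in> J"
proof -
  have "l1_embed (f + g) = l1_embed f + l1_embed g"
    by (auto simp: l1_embed_def)
  then show "l1_embed f \<in> J \<Longrightarrow> l1_embed g \<in> J \<Longrightarrow> l1_embed (f + g) \<in> J"
    using ideal_add by simp
qed

lemma embed_alpha_pow: "l1_embed f \<in> J \<Longrightarrow> l1_embed (alpha_pow \<sigma> n f) \<in> J"
proof -
  assume "l1_embed f \<in> J"
  from ideal_right[OF ideal_left[OF l1_monom_in this], of "l1_monom (const_bcontfun 1) (- n)"
      "const_bcontfun 1" n]
  have "l1_monom (const_bcontfun 1 * alpha_pow \<sigma> n f * alpha_pow \<sigma> n (const_bcontfun 1)) 0 \<in> J"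
    by (simp add: l1_embed_eq_monom l1_mult_monom_monom)
  moreover have "const_bcontfun 1 * alpha_pow \<sigma> n f * alpha_pow \<sigma> n (const_bcontfun 1)
      = alpha_pow \<sigma> n f"
    by (rule bcontfun_eqI) simp
  ultimately show ?thesis by (simp add: l1_embed_eq_monom)
qed

text \<open>The hull of the intersection of J with C(X).\<close>

definition zero_set :: "'x set"
  where "zero_set = {x. \<forall>f. l1_embed f \<in> J \<longrightarrow> apply_bcontfun f x = 0}"

lemma closed_zero_set: "closed zero_set"
proof -
  have "zero_set = (\<Inter>f\<in>{f. l1_embed f \<in> J}. apply_bcontfun f -` {0})"
    by (auto simp: zero_set_def)
  moreover have "closed (apply_bcontfun f -` {0})" for f :: "'x \<Rightarrow>\<^sub>C complex"
    by (rule closed_vimage) auto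
  ultimately show ?thesis by auto
qed

lemma zero_set_invariant: "it n x \<in> zero_set \<longleftrightarrow> x \<in> zero_set"
proof -
  have "it n y \<in> zero_set" if "y \<in> zero_set" for y n
    unfolding zero_set_def
  proof (intro CollectI allI impI)
    fix f :: "'x \<Rightarrow>\<^sub>C complex" assume "l1_embed f \<in> J"
    from embed_alpha_pow[OF this, of "- n"] that show "apply_bcontfun f (it n y) = 0"
      by (auto simp: zero_set_def)
  qed
  from this[of x n] this[of "it n x" "- n"] show ?thesis by auto
qed

text \<open>
  Off a neighbourhood of the zero set some nonnegative \<open>h\<close> in the ideal is bounded below by
  some \<open>m > 0\<close>, and then \<open>f h / max h m\<close> is close to \<open>f\<close>.
\<close>

lemma embed_in_iff: "l1_embed f \<in> J \<longleftrightarrow> (\<forall>x\<in>zero_set. apply_bcontfun f x = 0)"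
proof (intro iffI)
  assume f0: "\<forall>x\<in>zero_set. apply_bcontfun f x = 0"
  show "l1_embed f \<in> J"
  proof (rule ideal_closed)
    fix \<epsilon> :: real assume "0 < \<epsilon>"
    \<comment> \<open>The compact set where f is not small; it is disjoint from the zero set, so
      each of its points is detected by some function in the ideal.\<close>
    define C where "C = {x. \<epsilon> / 2 \<le> cmod (apply_bcontfun f x)}"
    have "closed C"
      unfolding C_def by (intro closed_Collect_le continuous_intros) auto
    then have compC: "compact C"
      using compact_Int_closed[OF compact_space] by simp
    have "\<exists>g. l1_embed g \<in> J \<and> apply_bcontfun g x \<noteq> 0" if "x \<in> C" for x
      using that f0 \<open>0 < \<epsilon>\<close> unfolding C_def zero_set_def by force
    then obtain g where g: "\<And>x. x \<in> C \<Longrightarrow> l1_embed (g x) \<in> J"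
      "\<And>x. x \<in> C \<Longrightarrow> apply_bcontfun (g x) x \<noteq> 0" by metis
    have "\<exists>G\<subseteq>C. finite G \<and> C \<subseteq> (\<Union>x\<in>G. {y. apply_bcontfun (g x) y \<noteq> 0})"
    proof -
      have op: "open {y. apply_bcontfun (g x) y \<noteq> 0}" for x
        by (intro open_Collect_neq continuous_intros) auto
      show ?thesis
        by (rule compactE_image[OF compC, of C "\<lambda>x. {y. apply_bcontfun (g x) y \<noteq> 0}"])
           (use op g(2) in blast)+
    qed
    then obtain G where G: "G \<subseteq> C" "finite G" "C \<subseteq> (\<Union>x\<in>G. {y. apply_bcontfun (g x) y \<noteq> 0})"
      by blast
    \<comment> \<open>Multiplication by conjugates stays in the ideal and merges the finite cover
      into one nonnegative function that is positive on all of C.\<close>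
    define h where "h = (\<Sum>x\<in>G. cnj_bcontfun (g x) * g x)"
    define r where "r y = (\<Sum>x\<in>G. (cmod (apply_bcontfun (g x) y))\<^sup>2)" for y
    have h_apply: "apply_bcontfun h y = complex_of_real (r y)" for y
    proof -
      have "apply_bcontfun (\<Sum>x\<in>F. cnj_bcontfun (g x) * g x) y
          = (\<Sum>x\<in>F. cnj (apply_bcontfun (g x) y) * apply_bcontfun (g x) y)" for F
        by (induction F rule: infinite_finite_induct) auto
      moreover have "cnj z * z = complex_of_real ((cmod z)\<^sup>2)" for z
        by (metis complex_norm_square mult.commute)
      ultimately show ?thesis by (simp add: h_def r_def del: of_real_power)
    qed
    have h_in: "l1_embed h \<in> J"
    proof -
      have "l1_embed (\<Sum>x\<in>F. cnj_bcontfun (g x) * g x) \<in> J" if "finite F" "F \<subseteq> C" for F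
        using that
      proof (induction F rule: finite_induct)
        case empty
        have zero: "l1_embed (0 :: 'x \<Rightarrow>\<^sub>C complex) = 0" by (auto simp: l1_embed_def)
        show ?case unfolding sum.empty zero by (rule ideal_0)
      qed (auto intro!: embed_add embed_mult_left g)
      then show ?thesis using G unfolding h_def by blast
    qed
    have contr: "continuous_on A r" for A
      unfolding r_def by (intro continuous_intros) auto
    have r_nonneg: "0 \<le> r y" for y by (simp add: r_def sum_nonneg)
    have r_pos: "0 < r y" if "y \<in> C" for y
    proof -
      obtain x where "x \<in> G" "apply_bcontfun (g x) y \<noteq> 0" using G(3) \<open>y \<in> C\<close> by blast
      then have "0 < (cmod (apply_bcontfun (g x) y))\<^sup>2" "x \<in> G" by auto
      then show ?thesis unfolding r_def
        using G(2) by (intro sum_pos2[of G x]) auto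
    qed
    obtain m where m: "0 < m" "\<And>y. y \<in> C \<Longrightarrow> m \<le> r y"
    proof (cases "C = {}")
      case False
      from continuous_attains_inf[OF compC False contr] obtain y where "y \<in> C" "\<forall>z\<in>C. r y \<le> r z"
        by blast
      then show ?thesis using that[of "r y"] r_pos by blast
    qed (use that[of 1] in auto)
    \<comment> \<open>The product of k and h is 1 on C and lies between 0 and 1 elsewhere, so f - f
      k h vanishes on C and is no larger than f off C.\<close>
    define k where "k = Bcontfun (\<lambda>y. complex_of_real (1 / max (r y) m))"
    have maxpos: "0 < max (r y) m" for y using m(1) by simp
    have k_apply: "apply_bcontfun k = (\<lambda>y. complex_of_real (1 / max (r y) m))"
      unfolding k_def using maxpos by (intro apply_Bcontfun continuous_intros contr) (metis less_irrefl)
    have b_in: "l1_embed (f * k * h) \<in> J" by (rule embed_mult_left[OF h_in])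
    have "norm (f - f * k * h) \<le> \<epsilon> / 2"
    proof (rule norm_bound)
      fix y
      have eq: "apply_bcontfun (f - f * k * h) y
          = apply_bcontfun f y * complex_of_real (1 - r y / max (r y) m)"
        by (simp add: k_apply h_apply algebra_simps)
      show "norm (apply_bcontfun (f - f * k * h) y) \<le> \<epsilon> / 2"
      proof (cases "y \<in> C")
        case True
        then have "max (r y) m = r y" "r y \<noteq> 0" using m(2) r_pos by force+
        then show ?thesis unfolding eq using \<open>0 < \<epsilon>\<close> by simp
      next
        case False
        have "0 \<le> 1 - r y / max (r y) m" "1 - r y / max (r y) m \<le> 1"
          using maxpos[of y] r_nonneg[of y] by (auto simp: divide_le_eq_1)
        then have "cmod (apply_bcontfun (f - f * k * h) y) \<le> cmod (apply_bcontfun f y)"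
          unfolding eq norm_mult norm_of_real by (intro mult_left_le) auto
        with False show ?thesis by (simp add: C_def)
      qed
    qed
    moreover have "l1_embed f - l1_embed (f * k * h) = l1_embed (f - f * k * h)"
      by (auto simp: l1_embed_def)
    ultimately have "l1_norm (l1_embed f - l1_embed (f * k * h)) \<le> \<epsilon> / 2"
      by (simp add: l1_embed_eq_monom)
    with b_in \<open>0 < \<epsilon>\<close> show "\<exists>b\<in>J. l1_norm (l1_embed f - b) < \<epsilon>" by force
  qed simp
qed (auto simp: zero_set_def)

lemma vanishing_in_ideal:
  assumes "a \<in> l1" "\<And>n x. x \<in> zero_set \<Longrightarrow> apply_bcontfun (a n) x = 0"
  shows "a \<in> J"
  by (rule ideal_coefficients[OF assms(1)]) (simp add: embed_in_iff assms(2))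

end

section \<open>Algebraically irreducible representations\<close>

locale irreducible_rep = dynamical_system \<sigma> + vector_space sc
  for \<sigma> :: "'x::t2_space \<Rightarrow> 'x" and sc :: "complex \<Rightarrow> 'v::ab_group_add \<Rightarrow> 'v" +
  fixes E :: "'v set" and \<rho> :: "(int \<Rightarrow> ('x \<Rightarrow>\<^sub>C complex)) \<Rightarrow> 'v \<Rightarrow> 'v"
  assumes irreducible: "alg_irreducible \<sigma> sc E \<rho>"
begin

lemma subspace_E: "subspace E"
  and rho_in: "a \<in> l1 \<Longrightarrow> v \<in> E \<Longrightarrow> \<rho> a v \<in> E"
  and rho_add_right: "a \<in> l1 \<Longrightarrow> u \<in> E \<Longrightarrow> v \<in> E \<Longrightarrow> \<rho> a (u + v) = \<rho> a u + \<rho> a v"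
  and rho_scale_right: "a \<in> l1 \<Longrightarrow> v \<in> E \<Longrightarrow> \<rho> a (sc c v) = sc c (\<rho> a v)"
  and rho_add: "a \<in> l1 \<Longrightarrow> b \<in> l1 \<Longrightarrow> v \<in> E \<Longrightarrow> \<rho> (a + b) v = \<rho> a v + \<rho> b v"
  and rho_scale: "a \<in> l1 \<Longrightarrow> v \<in> E \<Longrightarrow> \<rho> (l1_scale c a) v = sc c (\<rho> a v)"
  and rho_mult: "a \<in> l1 \<Longrightarrow> b \<in> l1 \<Longrightarrow> v \<in> E \<Longrightarrow> \<rho> (l1_mult \<sigma> a b) v = \<rho> a (\<rho> b v)"
  using irreducible by (auto simp: alg_irreducible_def alg_rep_def linear_op_on_def)

lemma rho_nonzero: "nonzero_rep E \<rho>"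
  using irreducible by (simp add: alg_irreducible_def)

lemma invariant_trivial:
  assumes "subspace V" "V \<subseteq> E" "\<And>a v. a \<in> l1 \<Longrightarrow> v \<in> V \<Longrightarrow> \<rho> a v \<in> V"
  shows "V = {0} \<or> V = E"
  using irreducible assms by (auto simp: alg_irreducible_def invariant_subspace_def)

lemma zero_in_E: "0 \<in> E" by (rule subspace_0[OF subspace_E])

lemma rho_zero_right [simp]: "a \<in> l1 \<Longrightarrow> \<rho> a 0 = 0"
  using rho_scale_right[of a 0 0] zero_in_E by simp

lemma rho_minus_right: "a \<in> l1 \<Longrightarrow> v \<in> E \<Longrightarrow> \<rho> a (- v) = - \<rho> a v"
  using rho_scale_right[of a v "- 1"] by simp

lemma rho_minus: "a \<in> l1 \<Longrightarrow> v \<in> E \<Longrightarrow> \<rho> (- a) v = - \<rho> a v"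
  using rho_scale[of a v "- 1"] by (simp add: l1_scale_minus_one)

lemma rho_diff: "a \<in> l1 \<Longrightarrow> b \<in> l1 \<Longrightarrow> v \<in> E \<Longrightarrow> \<rho> (a - b) v = \<rho> a v - \<rho> b v"
  using rho_add[of a "- b" v] by (simp add: l1_uminus rho_minus)

lemma rho_diff_right: "a \<in> l1 \<Longrightarrow> u \<in> E \<Longrightarrow> v \<in> E \<Longrightarrow> \<rho> a (u - v) = \<rho> a u - \<rho> a v"
  using rho_add_right[of a u "- v"] by (simp add: rho_minus_right subspace_neg[OF subspace_E])

text \<open>The vectors killed by the unit form an invariant subspace. It is not E because the
  representation is nonzero, and it contains v - \<rho> 1 v for every v in E.\<close>

lemma rho_one: "v \<in> E \<Longrightarrow> \<rho> l1_one v = v"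
proof -
  let ?V = "{v \<in> E. \<rho> l1_one v = 0}"
  have "?V = {0} \<or> ?V = E"
  proof (rule invariant_trivial)
    show "subspace ?V"
      by (rule subspaceI)
         (auto simp: zero_in_E rho_add_right rho_scale_right
           intro: subspace_add[OF subspace_E] subspace_scale[OF subspace_E])
    fix a :: "int \<Rightarrow> ('x \<Rightarrow>\<^sub>C complex)" and v assume a: "a \<in> l1" and v: "v \<in> ?V"
    have "\<rho> a v = \<rho> a (\<rho> l1_one v)"
      using rho_mult[OF a l1_one_in, of v] v by simp
    then show "\<rho> a v \<in> ?V" using a v by (auto simp: zero_in_E)
  qed auto
  moreover have "?V \<noteq> E"
  proof
    assume V: "?V = E"
    have "\<rho> a v = 0" if "a \<in> l1" "v \<in> E" for a v
    proof -
      have "\<rho> a v = \<rho> a (\<rho> l1_one v)" using rho_mult[OF that(1) l1_one_in that(2)] by simp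
      also have "\<rho> l1_one v = 0" using that(2) V by blast
      finally show ?thesis using that(1) by simp
    qed
    with rho_nonzero show False by (auto simp: nonzero_rep_def)
  qed
  ultimately have V: "?V = {0}" by blast
  assume v: "v \<in> E"
  have "\<rho> l1_one (\<rho> l1_one v) = \<rho> l1_one v"
    using rho_mult[OF l1_one_in l1_one_in v] by simp
  then have "v - \<rho> l1_one v \<in> ?V"
    using v by (simp add: rho_diff_right rho_in subspace_diff[OF subspace_E])
  with V show "\<rho> l1_one v = v" by auto
qed

text \<open>The vectors \<rho> a v form an invariant subspace, which contains v because the unit
  acts as the identity.\<close>

lemma rho_cyclic:
  assumes v: "v \<in> E" "v \<noteq> 0" and u: "u \<in> E"
  obtains a where "a \<in> l1" "\<rho> a v = u"
proof -
  let ?V = "(\<lambda>a. \<rho> a v) ` l1"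
  have "?V = {0} \<or> ?V = E"
  proof (rule invariant_trivial)
    show "subspace ?V"
    proof (rule subspaceI)
      show "0 \<in> ?V"
        using rho_diff[OF l1_one_in l1_one_in v(1)] by (intro image_eqI[of _ _ 0]) auto
      fix x y c assume x: "x \<in> ?V" 
      then obtain a where a: "a \<in> l1" "x = \<rho> a v" by blast
      then show "sc c x \<in> ?V"
        using v(1) by (auto simp: l1_scale_in intro!: image_eqI[of _ _
            "l1_scale c a"] rho_scale[symmetric])
      assume "y \<in> ?V"
      then obtain b where "b \<in> l1" "y = \<rho> b v" by blast
      with a show "x + y \<in> ?V"
        using v(1) by (auto intro!: image_eqI[of _ _ "a + b"] rho_add[symmetric])
    qed
    show "?V \<subseteq> E" using rho_in v(1) by auto
    fix a :: "int \<Rightarrow> ('x \<Rightarrow>\<^sub>C complex)" and x assume a: "a \<in> l1" and "x \<in> ?V"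
    then obtain b where "b \<in> l1" "x = \<rho> b v" by blast
    with a show "\<rho> a x \<in> ?V"
      using v(1) by (auto intro!: image_eqI[of _ _ "l1_mult \<sigma> a b"] rho_mult[symmetric])
  qed
  moreover have "v \<in> ?V" using rho_one[OF v(1)] by (intro image_eqI[of _ _ l1_one]) auto
  ultimately have "?V = E" using v(2) by blast
  with u that show ?thesis by blast
qed

lemma exists_nonzero: obtains v where "v \<in> E" "v \<noteq> 0"
  using rho_nonzero rho_in unfolding nonzero_rep_def by blast

text \<open>The left inverse of 1 - b recovers u from (1 - b) u = 0. In this way the norm of the
  algebra becomes visible on E.\<close>

lemma rho_no_fixed_vector:
  assumes b: "b \<in> l1" "l1_norm b < 1" and u: "u \<in> E" "\<rho> b u = u"
  shows "u = 0"
proof -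
  obtain s where s: "s \<in> l1" "l1_mult \<sigma> s (l1_one - b) = l1_one"
    using l1_left_inverse[OF b] by blast
  have "u = \<rho> s (\<rho> (l1_one - b) u)"
    using rho_mult[OF s(1) l1_diff[OF l1_one_in b(1)] u(1)] s(2) rho_one[OF u(1)] by simp
  also have "\<rho> (l1_one - b) u = 0"
    using b(1) u by (simp add: rho_diff rho_one)
  finally show ?thesis using s(1) by simp
qed

abbreviation ker :: "(int \<Rightarrow> ('x \<Rightarrow>\<^sub>C complex)) set"
  where "ker \<equiv> rep_kernel E \<rho>"

text \<open>If a moved some u to a nonzero vector, cyclicity would give c returning that vector to
  u. For b in the kernel close to a, the element c (a - b) would then have norm below 1 and still
  fix u.\<close>

lemma ker_closed:
  assumes a: "a \<in> l1" and approx: "\<And>\<epsilon>. 0 < \<epsilon> \<Longrightarrow> \<exists>b\<in>ker. l1_norm (a - b) < \<epsilon>"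
  shows "a \<in> ker"
proof (rule ccontr)
  assume "a \<notin> ker"
  with a obtain u where u: "u \<in> E" "\<rho> a u \<noteq> 0" by (auto simp: rep_kernel_def)
  obtain c where c: "c \<in> l1" "\<rho> c (\<rho> a u) = u"
    using rho_cyclic[OF rho_in[OF a u(1)] u(2) u(1)] by blast
  \<comment> \<open>Adding 1 keeps the denominator positive when c has norm 0 and makes the final
    product strictly smaller than 1.\<close>
  have pos: "0 < l1_norm c + 1" using l1_norm_ge_0[of c] by linarith
  then obtain b where b: "b \<in> ker" "l1_norm (a - b) < 1 / (l1_norm c + 1)"
    using approx[of "1 / (l1_norm c + 1)"] by auto
  then have bl: "b \<in> l1" "\<rho> b u = 0" using u by (auto simp: rep_kernel_def)
  have "l1_norm (l1_mult \<sigma> c (a - b)) \<le> l1_norm c * l1_norm (a - b)"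
    by (rule l1_norm_mult_le) (use a bl c in auto)
  also have "\<dots> \<le> l1_norm c * (1 / (l1_norm c + 1))"
    using b(2) by (intro mult_left_mono l1_norm_ge_0) simp
  also have "\<dots> < 1" using pos by simp
  finally have "u = 0"
    by (intro rho_no_fixed_vector[of "l1_mult \<sigma> c (a - b)"])
       (use a bl c u in \<open>auto simp: rho_mult rho_diff l1_diff\<close>)
  with u a show False by simp
qed

sublocale ker: closed_ideal \<sigma> ker
proof
  show "a \<in> l1 \<Longrightarrow> (\<And>\<epsilon>. 0 < \<epsilon> \<Longrightarrow> \<exists>b\<in>ker. l1_norm (a - b) < \<epsilon>) \<Longrightarrow> a \<in> ker" for a
    by (rule ker_closed)
  show "0 \<in> ker"
    using rho_diff[OF l1_one_in l1_one_in] by (auto simp: rep_kernel_def)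
qed (auto simp: rep_kernel_def rho_add rho_mult rho_in)

text \<open>For a = h \<delta>^n the product f a g equals (f \<alpha>^n(g)) h \<delta>^n, so f a g
  lies in the kernel for all a by density and closedness. Since g does not annihilate some u,
  cyclicity writes every vector as \<rho> a (\<rho> g u), and f kills it.\<close>

lemma ker_prime:
  assumes "\<And>n. l1_embed (f * alpha_pow \<sigma> n g) \<in> ker" and g: "l1_embed g \<notin> ker"
  shows "l1_embed f \<in> ker"
proof -
  let ?P = "\<lambda>a. l1_mult \<sigma> (l1_embed f) (l1_mult \<sigma> a (l1_embed g))"
  have P: "?P a \<in> ker" if "a \<in> l1" for a
    using that
  proof (induction rule: l1_induct)
    case (monom h n)
    have "?P (l1_monom h n) = l1_mult \<sigma> (l1_embed (f * alpha_pow \<sigma> n g)) (l1_monom h n)"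
      by (simp add: l1_embed_eq_monom l1_mult_monom_monom)
         (auto intro!: arg_cong[where f = "\<lambda>h. l1_monom h n"] bcontfun_eqI simp: mult_ac)
    then show ?case using assms(1) by (simp add: ker.ideal_right)
  next
    case (add a b)
    have "\<rho> (?P (a + b)) v = 0" if v: "v \<in> E" for v
    proof -
      have "\<rho> (?P (a + b)) v = \<rho> (?P a) v + \<rho> (?P b) v"
        using v add.hyps by (simp add: rho_mult rho_add rho_add_right rho_in l1_mult_in l1_add)
      also have "\<dots> = 0"
        using v add.IH by (simp add: rep_kernel_def)
      finally show ?thesis .
    qed
    moreover have "?P (a + b) \<in> l1"
      by (intro l1_mult_in l1_add l1_embed_in add.hyps)
    ultimately show ?case unfolding rep_kernel_def by blast
  next
    case (limit a)
    show ?case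
    proof (rule ker_closed)
      fix \<epsilon> :: real assume "0 < \<epsilon>"
      define C where "C = norm f * norm g + 1"
      have C: "0 < C" by (simp add: C_def add_nonneg_pos)
      with \<open>0 < \<epsilon>\<close> obtain b where b: "b \<in> l1" "?P b \<in> ker" "l1_norm (a - b) < \<epsilon> / C"
        using limit(2)[of "\<epsilon> / C"] by auto
      have "?P a - ?P b = ?P (a - b)"
        using limit(1) b(1) by (simp add: l1_mult_diff_left l1_mult_diff_right l1_mult_in)
      moreover have "l1_norm (?P (a - b)) \<le> norm f * (l1_norm (a - b) * norm g)"
        using limit(1) b(1) l1_norm_mult_le[of "l1_embed f" "l1_mult \<sigma> (a - b) (l1_embed g)"]
          mult_left_mono[OF l1_norm_mult_le[of "a - b" "l1_embed g"], of "norm f"]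
        by (simp add: l1_embed_eq_monom l1_diff l1_mult_in)
      moreover have "norm f * (l1_norm (a - b) * norm g) \<le> C * l1_norm (a - b)"
        using l1_norm_ge_0[of "a - b"] by (simp add: C_def algebra_simps)
      moreover have "C * l1_norm (a - b) < \<epsilon>"
        using b(3) C by (simp add: field_simps)
      ultimately show "\<exists>b\<in>ker. l1_norm (?P a - b) < \<epsilon>" using b(2) by force
    qed (use limit(1) in auto)
  qed
  from g obtain u where u: "u \<in> E" "\<rho> (l1_embed g) u \<noteq> 0" by (auto simp: rep_kernel_def)
  have "\<rho> (l1_embed f) v = 0" if v: "v \<in> E" for v
  proof -
    obtain a where a: "a \<in> l1" "\<rho> a (\<rho> (l1_embed g) u) = v"
      using rho_cyclic[OF rho_in[OF l1_embed_in u(1)] u(2) v] by blast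
    have "\<rho> (?P a) u = 0" using P[OF a(1)] u(1) by (simp add: rep_kernel_def)
    with a u(1) show ?thesis by (simp add: rho_mult l1_mult_in)
  qed
  then show ?thesis by (simp add: rep_kernel_def)
qed

end

text \<open>Finite nets for the radii 1/(n + 1) have balls forming a countable base.\<close>

lemma compact_metrizable_second_countable:
  assumes "compact_space X" "metrizable_space X"
  shows "second_countable X"
proof -
  obtain M d where Md: "Metric_space M d" and X: "X = Metric_space.mtopology M d"
    using assms(2) by (auto simp: metrizable_space_def)
  interpret Metric_space M d by (rule Md)
  have "mtotally_bounded M"
    using compactin_imp_mtotally_bounded[of M] assms(1) by (simp add: X compact_space_def)
  then have "\<exists>F. finite F \<and> F \<subseteq> M \<and> M \<subseteq> (\<Union>x\<in>F. mball x (inverse (real (Suc n))))" for n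
    unfolding mtotally_bounded_def by simp
  then obtain F where F: "\<And>n. finite (F n)" "\<And>n. F n \<subseteq> M"
    "\<And>n. M \<subseteq> (\<Union>x\<in>F n. mball x (inverse (real (Suc n))))" by metis
  let ?\<B> = "\<Union>n. (\<lambda>x. mball x (inverse (real (Suc n)))) ` F n"
  show ?thesis
    unfolding second_countable_def
  proof (intro exI[of _ ?\<B>] conjI ballI allI impI; (elim conjE)?)
    show "countable ?\<B>" by (intro countable_UN countableI_type countable_image countable_finite F(1))
    show "openin X V" if "V \<in> ?\<B>" for V using that by (auto simp: X)
    fix U x assume "openin X U" "x \<in> U"
    then obtain r where r: "0 < r" "mball x r \<subseteq> U" and x: "x \<in> M"
      unfolding X openin_mtopology by blast
    obtain n where n: "inverse (real (Suc n)) < r / 2"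
      using reals_Archimedean[of "r / 2"] r(1) by auto
    obtain y where y: "y \<in> F n" "x \<in> mball y (inverse (real (Suc n)))"
      using F(3)[of n] x by blast
    have "mball y (inverse (real (Suc n))) \<subseteq> mball x r"
    proof
      fix z assume z: "z \<in> mball y (inverse (real (Suc n)))"
      have "d x z \<le> d x y + d y z" using x y z by (intro triangle) auto
      moreover have "d x y < inverse (real (Suc n))" "d y z < inverse (real (Suc n))"
        using y(2) z by (auto simp: commute)
      ultimately have "d x z < r" using n by linarith
      with x z show "z \<in> mball x r" by auto
    qed
    with y r(2) show "\<exists>V\<in>?\<B>. x \<in> V \<and> V \<subseteq> U"
      by (intro bexI[of _ "mball y (inverse (real (Suc n)))"]) auto
  qed
qed

section \<open>The zero set of the kernel\<close>

context irreducible_rep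
begin

lemma zero_set_nonempty: "ker.zero_set \<noteq> {}"
proof
  assume "ker.zero_set = {}"
  then have "l1_one \<in> ker" by (simp add: l1_one_def ker.embed_in_iff)
  moreover obtain v where "v \<in> E" "v \<noteq> 0" by (rule exists_nonzero)
  ultimately show False using rho_one by (auto simp: rep_kernel_def)
qed

text \<open>If no orbit led from U to V inside the zero set, functions f and g equal to 1 at x and y
  and vanishing off U and V would satisfy f \<alpha>^n(g) = 0 on the zero set for all n, against
  primeness.\<close>

lemma zero_set_transitive:
  assumes U: "open U" "x \<in> U" "x \<in> ker.zero_set" and V: "open V" "y \<in> V" "y \<in> ker.zero_set"
  obtains z n where "z \<in> ker.zero_set" "z \<in> U" "it n z \<in> V"
proof (rule ccontr)
  assume "\<not> thesis"
  with that have disj: "\<And>z n. z \<in> ker.zero_set \<Longrightarrow> z \<in> U \<Longrightarrow> it n z \<notin> V" by blast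
  obtain f :: "'x \<Rightarrow>\<^sub>C complex" where f: "\<And>z. z \<in> {x} \<Longrightarrow> apply_bcontfun f z = 1"
    "\<And>z. z \<in> - U \<Longrightarrow> apply_bcontfun f z = 0"
    using bump_function[of "{x}"
        "- U"] U by (metis ComplD Int_insert_left_if0 closed_Compl closed_singleton inf_bot_left)
  obtain g :: "'x \<Rightarrow>\<^sub>C complex" where g: "\<And>z. z \<in> {y} \<Longrightarrow> apply_bcontfun g z = 1"
    "\<And>z. z \<in> - V \<Longrightarrow> apply_bcontfun g z = 0"
    using bump_function[of "{y}"
        "- V"] V by (metis ComplD Int_insert_left_if0 closed_Compl closed_singleton inf_bot_left)
  have "l1_embed (f * alpha_pow \<sigma> n g) \<in> ker" for n
    unfolding ker.embed_in_iff using disj f(2) g(2) by fastforce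
  moreover have "l1_embed g \<notin> ker" using g(1)[of y] V(3) by
      (auto simp: ker.embed_in_iff intro!: bexI[of _ y])
  ultimately have "l1_embed f \<in> ker" by (rule ker_prime)
  then show False using f(1)[of x] U(3) by (auto simp: ker.embed_in_iff)
qed

text \<open>All points of the zero set in U return after m steps, so only the exponents 0, ..., m -
  1 matter for them. A point y off the listed orbit segment could be separated from those finitely
  many images, and transitivity would fail between the resulting neighbourhoods.\<close>

lemma zero_set_finite_orbit:
  assumes U: "open U" "x \<in> U" "x \<in> ker.zero_set" and m: "0 < m"
    and fix_m: "\<And>z. z \<in> U \<Longrightarrow> z \<in> ker.zero_set \<Longrightarrow> it m z = z"
  shows "ker.zero_set = (\<lambda>i. it i x) ` {0..<m}"
proof
  show "(\<lambda>i. it i x) ` {0..<m} \<subseteq> ker.zero_set"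
    using U(3) by (auto simp: ker.zero_set_invariant)
  show "ker.zero_set \<subseteq> (\<lambda>i. it i x) ` {0..<m}"
  proof (rule ccontr)
    assume "\<not> ker.zero_set \<subseteq> (\<lambda>i. it i x) ` {0..<m}"
    then obtain y where y: "y \<in> ker.zero_set" "\<And>i. i \<in> {0..<m} \<Longrightarrow> it i x \<noteq> y" by blast
    then have "\<exists>A B. open A \<and> open B \<and> it i x \<in> A \<and> y \<in> B \<and> A \<inter> B = {}" if "i \<in> {0..<m}" for i
      using that by (intro hausdorff) blast
    then obtain A B where AB: "\<And>i. i \<in> {0..<m} \<Longrightarrow> open (A i)" "\<And>i. i \<in> {0..<m} \<Longrightarrow> open (B i)"
      "\<And>i. i \<in> {0..<m} \<Longrightarrow> it i x \<in> A i" "\<And>i. i \<in> {0..<m} \<Longrightarrow> y \<in> B i"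
      "\<And>i. i \<in> {0..<m} \<Longrightarrow> A i \<inter> B i = {}" by metis
    have op: "open (U \<inter> (\<Inter>i\<in>{0..<m}. it i -` A i))" "open (\<Inter>i\<in>{0..<m}. B i)"
      using AB U(1) by (auto intro!: open_INT open_Int open_it_vimage)
    have mem: "x \<in> U \<inter> (\<Inter>i\<in>{0..<m}. it i -` A i)" "y \<in> (\<Inter>i\<in>{0..<m}. B i)"
      using AB U(2) by auto
    obtain z n where z: "z \<in> ker.zero_set" "z \<in> U \<inter> (\<Inter>i\<in>{0..<m}. it i -` A i)"
      "it n z \<in> (\<Inter>i\<in>{0..<m}. B i)"
      by (rule zero_set_transitive[OF op(1) mem(1) U(3) op(2) mem(2) y(1)])
    have "it n z = it (n mod m) (it (m * (n div m)) z)"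
      using it_add[of "n mod m" "m * (n div m)" z] by simp
    also have "it (m * (n div m)) z = z"
      by (rule it_periodic_multiple) (use fix_m z in blast)
    finally have "it n z = it (n mod m) z" .
    moreover have "n mod m \<in> {0..<m}" using m by simp
    ultimately show False using z(2,3) AB(5)[of "n mod m"] by fastforce
  qed
qed

text \<open>
  Compressing by a bump function \<open>f\<close> supported near an aperiodic point kills finitely many
  off-diagonal coefficients, so that \<open>c f\<^sup>2\<close> with \<open>c = a(0)(y)\<close> lies within distance \<open>< |c|\<close> of the
  ideal. On functions supported where \<open>f = 1\<close> this forces the representation to vanish.
\<close>

lemma ker_zero_coefficient:
  assumes a: "a \<in> ker" and y: "y \<in> ker.zero_set" "y \<in> Aper \<sigma>"
  shows "apply_bcontfun (a 0) y = 0"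
proof (rule ccontr)
  define c where "c = apply_bcontfun (a 0) y"
  assume "apply_bcontfun (a 0) y \<noteq> 0"
  then have c: "c \<noteq> 0" by (simp add: c_def)
  have al: "a \<in> l1" using a by (rule ker.ideal_l1)
  \<comment> \<open>One quarter pays for the variation of a 0 near y and one for the tail off F;
    together they stay below \<open>cmod c\<close>.\<close>
  have "0 < cmod c / 4" using c by simp
  from l1_finite_approx[OF al this] obtain F where F: "finite F"
    "(\<Sum>\<^sub>\<infinity>n\<in>-F. norm (a n)) < cmod c / 4" by blast
  have "\<exists>A B. open A \<and> open B \<and> y \<in> A \<and> it k y \<in> B \<and> A \<inter> B = {}" if "k \<in> F - {0}" for k
    using it_inj_Aper[OF y(2), of 0 k] that by (intro hausdorff) auto
  then obtain A B where AB: "\<And>k. k \<in> F - {0} \<Longrightarrow> open (A k)" "\<And>k. k \<in> F - {0} \<Longrightarrow> open (B k)"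
    "\<And>k. k \<in> F - {0} \<Longrightarrow> y \<in> A k" "\<And>k. k \<in> F - {0} \<Longrightarrow> it k y \<in> B k"
    "\<And>k. k \<in> F - {0} \<Longrightarrow> A k \<inter> B k = {}" by metis
  \<comment> \<open>On W the coefficient a 0 is nearly c. Moreover W lies in A k while its image
    under \<open>it k\<close> lies in B k, so W is disjoint from its translates by the nonzero
    exponents in F.\<close>
  define W where "W = {x. cmod (c - apply_bcontfun (a 0) x) < cmod c / 4} \<inter>
    (\<Inter>k\<in>F - {0}. A k \<inter> it k -` B k)"
  have "open {x. cmod (c - apply_bcontfun (a 0) x) < cmod c / 4}"
    by (intro open_Collect_less continuous_intros) auto
  then have W: "open W" "y \<in> W"
    unfolding W_def using F(1) AB c
    by (auto intro!: open_INT open_Int open_it_vimage simp: c_def)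
  \<comment> \<open>The smaller U leaves room for f to equal 1 on the support of h, which gives f f
    h = h below.\<close>
  obtain U where U: "open U" "y \<in> U" "closure U \<subseteq> W"
  proof -
    obtain U C where "openin euclidean U" "closedin euclidean C" "y \<in> U" "U \<subseteq> C" "C \<subseteq> W"
      using regular_space_X W neighbourhood_base_of_closedin[of "euclidean :: 'x topology"]
      unfolding neighbourhood_base_of by (metis open_openin)
    then show ?thesis
      using that[of U] closure_minimal[of U C] by auto
  qed
  obtain f :: "'x \<Rightarrow>\<^sub>C complex" where f: "\<And>x. cmod (apply_bcontfun f x) \<le> 1"
    "\<And>x. x \<in> closure U \<Longrightarrow> apply_bcontfun f x = 1" "\<And>x. x \<in> - W \<Longrightarrow> apply_bcontfun f x = 0"
    by (rule bump_function[of "closure U" "- W"]) (use U(3) W(1) in auto)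
  obtain h :: "'x \<Rightarrow>\<^sub>C complex" where h: "\<And>x. x \<in> {y} \<Longrightarrow> apply_bcontfun h x = 1"
    "\<And>x. x \<in> - U \<Longrightarrow> apply_bcontfun h x = 0"
    by (rule bump_function[of "{y}" "- U"]) (use U(1,2) in auto)
  define d where "d = l1_mult \<sigma> (l1_embed f) (l1_mult \<sigma> a (l1_embed f))"
  have d_ker: "d \<in> ker" unfolding d_def by (intro ker.ideal_left ker.ideal_right a) auto
  have d_apply: "apply_bcontfun (d n) x
      = apply_bcontfun f x * apply_bcontfun (a n) x * apply_bcontfun f (it (- n) x)" for n x
    by (simp add: d_def l1_embed_eq_monom l1_mult_monom_left l1_mult_monom_right)
  define b where "b = l1_scale c (l1_embed (f * f)) - d"
  have b_in: "b \<in> l1" unfolding b_def by (intro l1_diff l1_scale_in ker.ideal_l1[OF d_ker]) auto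
  have b_norm: "l1_norm b < cmod c"
  proof -
    have b_apply: "apply_bcontfun (b n) x = (if n
        = 0 then c * apply_bcontfun f x * apply_bcontfun f x else 0)
        - apply_bcontfun f x * apply_bcontfun (a n) x * apply_bcontfun f (it (- n) x)" for n x
      by (simp add: b_def l1_scale_def l1_embed_def d_apply)
    have b0: "norm (b 0) \<le> cmod c / 4"
    proof (rule norm_bound)
      fix x
      have eq: "apply_bcontfun (b 0) x
          = apply_bcontfun f x * (apply_bcontfun f x * (c - apply_bcontfun (a 0) x))"
        by (simp add: b_apply algebra_simps)
      show "cmod (apply_bcontfun (b 0) x) \<le> cmod c / 4"
      proof (cases "x \<in> W")
        case True
        then have "cmod (c - apply_bcontfun (a 0) x) \<le> cmod c / 4" by (simp add: W_def)
        then have "cmod (apply_bcontfun f x) * (cmod (apply_bcontfun f x) * cmod (c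
            - apply_bcontfun (a 0) x))
            \<le> 1 * (1 * (cmod c / 4))"
          by (intro mult_mono f(1)) auto
        then show ?thesis by (simp add: eq norm_mult)
      qed (simp add: eq f(3))
    qed
    \<comment> \<open>The two factors f would need x and its translate by -n both in W.\<close>
    have bF: "b n = 0" if n: "n \<in> F - {0}" for n
    proof (rule bcontfun_eqI)
      fix x
      have "apply_bcontfun f x = 0 \<or> apply_bcontfun f (it (- n) x) = 0"
      proof (rule ccontr)
        assume "\<not> ?thesis"
        then have "x \<in> W" "it (- n) x \<in> W" using f(3) by blast+
        then have "x \<in> A n" "it n (it (- n) x) \<in> B n" using n unfolding W_def by blast+
        then show False using AB(5)[OF n] by auto
      qed
      then show "apply_bcontfun (b n) x = apply_bcontfun 0 x" using n by (auto simp: b_apply)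
    qed
    have bn: "norm (b n) \<le> norm (a n)" if "n \<noteq> 0" for n
    proof (rule norm_bound)
      fix x
      have "cmod (apply_bcontfun f x) * cmod (apply_bcontfun (a n) x)
          * cmod (apply_bcontfun f (it (- n) x))
          \<le> 1 * norm (a n) * 1"
        by (intro mult_mono f(1) norm_bounded) auto
      then show "cmod (apply_bcontfun (b n) x) \<le> norm (a n)"
        using that by (simp add: b_apply norm_mult)
    qed
    have "((\<lambda>n. if n = 0 then cmod c / 4 else 0) has_sum cmod c / 4) UNIV"
      by (rule has_sum_finite_neutralI[of "{0}"]) auto
    moreover have "((\<lambda>n. if n \<in> - F then norm (a n) else 0) has_sum (\<Sum>\<^sub>\<infinity>n\<in>-F. norm (a n))) UNIV"
      by (subst has_sum_cong_neutral[where T = "- F" and g = "\<lambda>n. norm (a n)"])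
         (auto intro!: has_sum_infsum summable_on_subset_banach[OF norm_summable_l1[OF al]])
    ultimately have "l1_norm b \<le> cmod c / 4 + (\<Sum>\<^sub>\<infinity>n\<in>-F. norm (a n))"
    proof (rule l1I_norm_le(2)[OF has_sum_add])
      show "norm (b n) \<le> (if n = 0 then cmod c / 4 else 0) + (if n \<in> - F then norm (a n) else 0)" for n
        using b0 bF[of n] bn[of n] by (cases "n = 0"; cases "n \<in> F") (auto intro: add_increasing2)
    qed
    also have "\<dots> < cmod c / 4 + cmod c / 4" using F(2) by simp
    also have "\<dots> < cmod c" using c by simp
    finally show ?thesis .
  qed
  \<comment> \<open>On the range of h both f f = 1 and d = 0 hold, so b acts there as the scalar c.
    Divided by c it has norm below 1 and fixes these vectors, which therefore vanish.\<close>
  have "\<rho> (l1_embed h) v = 0" if v: "v \<in> E" for v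
  proof (rule rho_no_fixed_vector)
    let ?u = "\<rho> (l1_embed h) v"
    show u: "?u \<in> E" by (intro rho_in v) auto
    show "l1_scale (inverse c) b \<in> l1" by (rule l1_scale_in[OF b_in])
    show "l1_norm (l1_scale (inverse c) b) < 1"
      using b_norm c by (simp add: l1_norm_scale[OF b_in] norm_divide divide_simps)
    have "f * f * h = h"
    proof (rule bcontfun_eqI)
      show "apply_bcontfun (f * f * h) x = apply_bcontfun h x" for x
        using f(2)[of x] h(2)[of x] closure_subset[of U] by (cases "x \<in> U") auto
    qed
    then have "l1_mult \<sigma> (l1_embed (f * f)) (l1_embed h) = l1_embed h"
      by (simp add: l1_mult_embed_embed)
    then have "\<rho> (l1_embed (f * f)) ?u = ?u"
      using rho_mult[OF l1_embed_in l1_embed_in v, of "f * f" h] by simp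
    moreover have "\<rho> d ?u = 0" using d_ker u by (simp add: rep_kernel_def)
    ultimately have "\<rho> b ?u = sc c ?u"
      using u ker.ideal_l1[OF d_ker] by (simp add: b_def rho_diff rho_scale l1_scale_in)
    then show "\<rho> (l1_scale (inverse c) b) ?u = ?u"
      using c by (simp add: rho_scale[OF b_in u])
  qed
  then have "l1_embed h \<in> ker" by (simp add: rep_kernel_def)
  with y(1) h(1) show False by (auto simp: ker.embed_in_iff)
qed

text \<open>Multiplication by \<delta>^(-n) on the right moves the n-th coefficient to position
  0.\<close>

lemma ker_coefficients:
  assumes a: "a \<in> ker" and y: "y \<in> ker.zero_set" "y \<in> Aper \<sigma>"
  shows "apply_bcontfun (a n) y = 0"
proof -
  have "l1_mult \<sigma> a (l1_monom (const_bcontfun 1) (- n)) \<in> ker"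
    by (rule ker.ideal_right[OF a]) simp
  from ker_zero_coefficient[OF this y] show ?thesis
    by (simp add: l1_mult_monom_right)
qed

text \<open>Aperiodicity of the points of S gives the inclusion of the kernel; conversely,
  continuity carries the vanishing of coefficients from S to its closure and hence to the zero
  set.\<close>

lemma ker_eq_dense:
  assumes S: "S \<subseteq> ker.zero_set \<inter> Aper \<sigma>" and dense: "ker.zero_set \<subseteq> closure S"
  shows "ker = {a \<in> l1. \<forall>n. \<forall>x\<in>S. apply_bcontfun (a n) x = 0}"
proof
  show "ker \<subseteq> {a \<in> l1. \<forall>n. \<forall>x\<in>S. apply_bcontfun (a n) x = 0}"
    using ker_coefficients S ker.ideal_l1 by blast
  show "{a \<in> l1. \<forall>n. \<forall>x\<in>S. apply_bcontfun (a n) x = 0} \<subseteq> ker"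
  proof clarify
    fix a :: "int \<Rightarrow> ('x \<Rightarrow>\<^sub>C complex)"
    assume a: "a \<in> l1" "\<forall>n. \<forall>x\<in>S. apply_bcontfun (a n) x = 0"
    show "a \<in> ker"
    proof (rule ker.vanishing_in_ideal[OF a(1)])
      fix n x assume "x \<in> ker.zero_set"
      moreover have "closure S \<subseteq> apply_bcontfun (a n) -` {0}"
        by (rule closure_minimal) (use a(2) in \<open>auto intro!: closed_vimage\<close>)
      ultimately show "apply_bcontfun (a n) x = 0" using dense by blast
    qed
  qed
qed

section \<open>Baire category on the zero set\<close>

abbreviation zero_top :: "'x topology"
  where "zero_top \<equiv> subtopology euclidean ker.zero_set"

lemma zero_set_Baire:
  assumes "countable \<G>" "\<And>T. T \<in> \<G> \<Longrightarrow> closedin zero_top T \<and> zero_top interior_of T = {}"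
  shows "zero_top interior_of \<Union>\<G> = {}"
proof (rule Baire_category_alt[OF disjI2 assms])
  have "compact_space zero_top"
    using compact_Int_closed[OF compact_space ker.closed_zero_set] by
        (simp add: compact_space_subtopology)
  then have "locally_compact_space zero_top"
    by (rule compact_imp_locally_compact_space)
  moreover have "regular_space zero_top"
    by (rule regular_space_subtopology[OF regular_space_X])
  ultimately show "locally_compact_space zero_top \<and> regular_space zero_top" ..
qed

lemma zero_top_interior_emptyI:
  assumes "\<And>U x. open U \<Longrightarrow> x \<in> U \<Longrightarrow> x \<in> ker.zero_set \<Longrightarrow> U \<inter> ker.zero_set \<subseteq> T \<Longrightarrow> False"
  shows "zero_top interior_of T = {}"
  using assms unfolding interior_of_def openin_subtopology by (auto simp: open_openin[symmetric])

text \<open>The exponent \<open>Suc m\<close> excludes the trivial power, so the sets over all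
  naturals m exhaust exactly the periodic points of the zero set.\<close>

definition fixed_set :: "nat \<Rightarrow> 'x set"
  where "fixed_set m = {x \<in> ker.zero_set. it (int (Suc m)) x = x}"

lemma closedin_fixed_set: "closedin zero_top (fixed_set m)"
proof -
  have "closed {x. it (int (Suc m)) x = x}"
    by (intro closed_Collect_eq continuous_it continuous_intros)
  then have "closedin zero_top (ker.zero_set \<inter> {x. it (int (Suc m)) x = x})"
    by (rule closedin_closed_Int)
  moreover have "fixed_set m = ker.zero_set \<inter> {x. it (int (Suc m)) x = x}"
    by (auto simp: fixed_set_def)
  ultimately show ?thesis by simp
qed

text \<open>A nonempty relatively open set of such points would make the whole zero set a single
  finite orbit, by \<open>zero_set_finite_orbit\<close>.\<close>

lemma fixed_set_interior:
  assumes "infinite ker.zero_set"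
  shows "zero_top interior_of fixed_set m = {}"
proof (rule zero_top_interior_emptyI)
  fix U x assume "open U" "x \<in> U" "x \<in> ker.zero_set" and sub: "U \<inter> ker.zero_set \<subseteq> fixed_set m"
  then have "ker.zero_set = (\<lambda>i. it i x) ` {0..<int (Suc m)}"
    by (intro zero_set_finite_orbit[of U]) (auto simp: fixed_set_def)
  with assms show False by (metis finite_imageI finite_atLeastLessThan_int)
qed

lemma fixed_set_Per: "x \<in> ker.zero_set \<Longrightarrow> x \<in> Per \<sigma> \<longleftrightarrow> (\<exists>m. x \<in> fixed_set m)"
proof
  assume "x \<in> ker.zero_set" "x \<in> Per \<sigma>"
  then obtain n where n: "n \<ge> 1" "(\<sigma> ^^ n) x = x" by (auto simp: Per_def)
  then have "it (int (Suc (n - 1))) x = x" unfolding int_iterate_of_nat by simp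
  with \<open>x \<in> ker.zero_set\<close> show "\<exists>m. x \<in> fixed_set m" unfolding fixed_set_def by blast
next
  assume "\<exists>m. x \<in> fixed_set m"
  then obtain m where "it (int (Suc m)) x = x" by (auto simp: fixed_set_def)
  then show "x \<in> Per \<sigma>" unfolding Per_iff by (intro exI[of _ "int (Suc m)"]) simp
qed

text \<open>A nonempty relatively open set without aperiodic points would be covered by the
  countably many nowhere dense closed sets \<open>fixed_set m\<close>.\<close>

lemma Aper_dense:
  assumes "infinite ker.zero_set"
  shows "ker.zero_set \<subseteq> closure (ker.zero_set \<inter> Aper \<sigma>)"
proof (rule ccontr)
  assume "\<not> ?thesis"
  then obtain x where x: "x \<in> ker.zero_set" "x \<in> - closure (ker.zero_set \<inter> Aper \<sigma>)" by blast
  let ?U = "- closure (ker.zero_set \<inter> Aper \<sigma>) \<inter> ker.zero_set"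
  have "?U \<subseteq> \<Union> (range fixed_set)"
  proof
    fix z assume z: "z \<in> ?U"
    then have "z \<notin> ker.zero_set \<inter> Aper \<sigma>"
      using closure_subset[of "ker.zero_set \<inter> Aper \<sigma>"] by (meson ComplD IntD1 subsetD)
    with z show "z \<in> \<Union> (range fixed_set)" using fixed_set_Per[of z] by (simp add: Aper_def)
  qed
  moreover have "openin zero_top ?U"
    by (simp add: openin_open_Int Int_commute open_Compl)
  ultimately have "?U \<subseteq> zero_top interior_of \<Union> (range fixed_set)"
    by (rule interior_of_maximal)
  also have "\<dots> = {}"
    by (rule zero_set_Baire) (use closedin_fixed_set fixed_set_interior[OF assms] in auto)
  finally show False using x by blast
qed

text \<open>One application of Baire's theorem avoids both the periodic points and, for each basic
  open V meeting the zero set, the points whose orbit misses V. The latter sets have empty interior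
  by transitivity.\<close>

lemma dense_orbit:
  assumes inf: "infinite ker.zero_set" and metr: "metrizable_space (euclidean :: 'x topology)"
  obtains x where "x \<in> ker.zero_set" "x \<in> Aper \<sigma>" "ker.zero_set \<subseteq> closure (range (\<lambda>n. it n x))"
proof -
  have "second_countable (euclidean :: 'x topology)"
    by (rule compact_metrizable_second_countable[OF compact_space_X metr])
  then obtain \<B> :: "'x set set" where \<B>: "countable \<B>" "\<And>V. V \<in> \<B> \<Longrightarrow> open V"
    "\<And>U x. open U \<Longrightarrow> x \<in> U \<Longrightarrow> \<exists>V\<in>\<B>. x \<in> V \<and> V \<subseteq> U"
    unfolding second_countable_def by (metis UNIV_I open_openin topspace_euclidean)
  define N where "N V = {x \<in> ker.zero_set. \<forall>n. it n x \<notin> V}" for V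
  let ?\<G> = "range fixed_set \<union> N ` {V \<in> \<B>. V \<inter> ker.zero_set \<noteq> {}}"
  have "zero_top interior_of \<Union> ?\<G> = {}"
  proof (rule zero_set_Baire)
    show "countable ?\<G>" using \<B>(1) by auto
    fix T assume "T \<in> ?\<G>"
    then consider m where "T = fixed_set m" | V where "T = N V" "V \<in> \<B>" "V \<inter> ker.zero_set \<noteq> {}"
      by blast
    then show "closedin zero_top T \<and> zero_top interior_of T = {}"
    proof cases
      case 1
      then show ?thesis using closedin_fixed_set fixed_set_interior[OF inf] by simp
    next
      case 2
      have "N V = ker.zero_set \<inter> - (\<Union>n. it n -` V)" by (auto simp: N_def)
      moreover have "closed (- (\<Union>n. it n -` V))"
        using \<B>(2)[OF 2(2)] by (intro closed_Compl open_UN) (auto intro: open_it_vimage)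
      ultimately have "closedin zero_top (N V)"
        by (metis closedin_closed_Int)
      moreover have "zero_top interior_of N V = {}"
      proof (rule zero_top_interior_emptyI)
        fix U x assume U: "open U" "x \<in> U" "x \<in> ker.zero_set" "U \<inter> ker.zero_set \<subseteq> N V"
        from 2(3) obtain y where y: "y \<in> V" "y \<in> ker.zero_set" by blast
        obtain z n where "z \<in> ker.zero_set" "z \<in> U" "it n z \<in> V"
          by (rule zero_set_transitive[OF U(1-3) \<B>(2)[OF 2(2)] y])
        with U(4) show False by (auto simp: N_def)
      qed
      ultimately show ?thesis using 2(1) by simp
    qed
  qed
  moreover have "openin zero_top ker.zero_set" using openin_topspace[of zero_top] by simp
  ultimately have "\<not> ker.zero_set \<subseteq> \<Union> ?\<G>"
    using interior_of_maximal[of ker.zero_set "\<Union> ?\<G>" zero_top] zero_set_nonempty by blast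
  then obtain x where x: "x \<in> ker.zero_set" "x \<notin> \<Union> ?\<G>" by (meson subsetI)
  have not_fixed: "x \<notin> fixed_set m" for m using x(2) by auto
  have visits: "x \<notin> N V" if "V \<in> \<B>" "V \<inter> ker.zero_set \<noteq> {}" for V using x(2) that by auto
  have "y \<in> closure (range (\<lambda>n. it n x))" if y: "y \<in> ker.zero_set" for y
  proof (rule ccontr)
    assume "y \<notin> closure (range (\<lambda>n. it n x))"
    then have "open (- closure (range (\<lambda>n. it n x)))" "y \<in> - closure (range (\<lambda>n. it n x))"
      by auto
    from \<B>(3)[OF this] obtain V where V: "V \<in> \<B>" "y \<in> V" "V \<subseteq> - closure (range (\<lambda>n. it n x))"
      by blast
    from V(2) y have "V \<inter> ker.zero_set \<noteq> {}" by blast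
    from visits[OF V(1) this] x(1) obtain n where "it n x \<in> V" by (auto simp: N_def)
    moreover have "it n x \<in> closure (range (\<lambda>n. it n x))"
      using closure_subset[of "range (\<lambda>n. it n x)"] by (meson rangeI subsetD)
    ultimately show False using V(3) by auto
  qed
  moreover have "x \<in> Aper \<sigma>" using x(1) not_fixed fixed_set_Per[of x] by (simp add: Aper_def)
  ultimately show ?thesis using that[of x] x(1) by (meson subsetI)
qed

end

section \<open>Nonempty spectrum of an isometry\<close>

text \<open>Exchanging the roles of i and j turns the sum into a geometric series whose ratio
  differs from 1 unless i = 0.\<close>

lemma sum_root_of_unity_powers:
  assumes "i < n"
  shows "(\<Sum>j<n. exp (2 * of_real pi * \<i> * of_nat j / of_nat n) ^ i) = (if i = 0 then of_nat n else 0)"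
proof -
  define z where "z = exp (2 * of_real pi * \<i> * of_nat i / of_nat n)"
  have n: "n \<noteq> 0" using assms by auto
  have "exp (2 * of_real pi * \<i> * of_nat j / of_nat n) ^ i = z ^ j" for j
    by (simp add: z_def exp_of_nat_mult[symmetric] mult_ac)
  then have eq: "(\<Sum>j<n. exp (2 * of_real pi * \<i> * of_nat j / of_nat n) ^ i) = (\<Sum>j<n. z ^ j)" by simp
  show ?thesis
  proof (cases "i = 0")
    case False
    have "z \<noteq> 1"
      using complex_root_unity_eq[of n i 0] assms False n by (auto simp: z_def cong_def)
    moreover have "z ^ n = 1" unfolding z_def using n by (rule complex_root_unity)
    ultimately show ?thesis unfolding eq using False by (simp add: geometric_sum)
  qed simp
qed

text \<open>
  If all \<open>1 - z T\<close> were invertible, then for \<open>\<omega>\<close> running through the \<open>n\<close>-th roots of unity the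
  mean of the vectors \<open>(1 - r \<omega> T)\<^sup>-\<^sup>1 v\<close> would be \<open>(1 - r\<^sup>n T\<^sup>n)\<^sup>-\<^sup>1 v\<close>. As \<open>n\<close> grows this tends to
  \<open>v\<close> for \<open>r < 1\<close> and to \<open>0\<close> for \<open>r > 1\<close>, although it is Lipschitz in \<open>r\<close> uniformly in \<open>n\<close>.
\<close>

lemma isometry_spectrum_nonempty:
  fixes sc :: "complex \<Rightarrow> 'v::ab_group_add \<Rightarrow> 'v" and q :: "'v \<Rightarrow> real"
  assumes vs: "vector_space sc" and sub: "module.subspace sc E"
    and q_add: "\<And>u w. u \<in> E \<Longrightarrow> w \<in> E \<Longrightarrow> q (u + w) \<le> q u + q w"
    and q_scale: "\<And>c u. u \<in> E \<Longrightarrow> q (sc c u) = cmod c * q u"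
    and q_nonneg: "\<And>u. u \<in> E \<Longrightarrow> 0 \<le> q u"
    and T_in: "\<And>u. u \<in> E \<Longrightarrow> T u \<in> E"
    and T_add: "\<And>u w. u \<in> E \<Longrightarrow> w \<in> E \<Longrightarrow> T (u + w) = T u + T w"
    and T_scale: "\<And>c u. u \<in> E \<Longrightarrow> T (sc c u) = sc c (T u)"
    and q_T: "\<And>u. u \<in> E \<Longrightarrow> q (T u) = q u"
    and bound: "\<And>z. \<exists>C>0. \<forall>u\<in>E. q u \<le> C * q (u - sc z (T u))"
    and surj: "\<And>z w. w \<in> E \<Longrightarrow> \<exists>u\<in>E. u - sc z (T u) = w"
    and v: "v \<in> E"
  shows "q v = 0"
proof (rule ccontr)
  assume "q v \<noteq> 0"
  with q_nonneg[OF v] have qv: "0 < q v" by simp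
  interpret vector_space sc by (rule vs)
  note E_add = subspace_add[OF sub] and E_scale = subspace_scale[OF sub] and E_diff
      = subspace_diff[OF sub]
    and E_sum = subspace_sum[OF sub]
  have q_minus: "q (u - w) = q (w - u)" if "u \<in> E" "w \<in> E" for u w
    using q_scale[OF E_diff[OF that], of "- 1"] by simp
  have q_diff: "q (u - w) \<le> q u + q w" if "u \<in> E" "w \<in> E" for u w
    using q_add[OF that(1) E_scale[OF that(2)], of "- 1"] q_scale[OF that(2), of "- 1"] by simp
  have q_triangle: "q u \<le> q (u - w) + q w" if "u \<in> E" "w \<in> E" for u w
    using q_add[OF E_diff[OF that] that(2)] by simp
  have q_sum: "q (\<Sum>j\<in>A. f j) \<le> (\<Sum>j\<in>A. q (f j))" if "finite A" "\<And>j. j \<in> A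
      \<Longrightarrow> f j \<in> E" for A :: "nat set" and f
    using that
  proof (induction A rule: finite_induct)
    case empty
    show ?case using q_scale[OF v, of 0] by simp
  next
    case (insert j A)
    then show ?case using q_add[of "f j" "sum f A"] by (force intro: E_sum)
  qed
  have T_minus: "T (u - w) = T u - T w" if "u \<in> E" "w \<in> E" for u w
    using T_add[OF that(1) E_scale[OF that(2)], of "- 1"] T_scale[OF that(2), of "- 1"] by simp

  \<comment> \<open>On a ball of radius 1 / (2 C z) about z the constant at most doubles. Finitely
    many such balls cover the disc, and the sum of their constants replaces the maximum. Radius 2
    leaves room for the moduli 1 + \<epsilon> used below.\<close>
  have "\<exists>C>0. \<forall>z\<in>cball 0 2. \<forall>u\<in>E. q u \<le> C * q (u - sc z (T u))"
  proof -
    from bound obtain C where C: "\<And>z. 0 < C z" "\<And>z u. u \<in> E \<Longrightarrow> q u \<le> C z * q (u - sc z (T u))"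
      by metis
    have "compact (cball (0 :: complex) 2)" by simp
    then obtain Z where Z: "Z \<subseteq> cball 0 2" "finite Z" "cball 0 2 \<subseteq> (\<Union>z\<in>Z. ball z (1 / (2 * C z)))"
      by (rule compactE_image[of _ "cball 0 2" "\<lambda>z. ball z (1 / (2 * C z))"]) (use C(1) in force)+
    let ?C = "\<Sum>z\<in>Z. 2 * C z"
    have "q u \<le> ?C * q (u - sc y (T u))" if y: "y \<in> cball 0 2" and u: "u \<in> E" for y u
    proof -
      obtain z where z: "z \<in> Z" "dist z y < 1 / (2 * C z)" using Z(3) y by auto
      note Tu = T_in[OF u]
      have eq: "u - sc z (T u) = (u - sc y (T u)) + sc (y - z) (T u)"
        by (simp add: algebra_simps)
      have "q (u - sc z (T u)) \<le> q (u - sc y (T u)) + cmod (y - z) * q u"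
        unfolding eq using q_add[OF E_diff[OF u E_scale[OF Tu]] E_scale[OF Tu], of y "y
            - z"] q_scale[OF Tu] q_T[OF u] by simp
      then have "q u \<le> C z * (q (u - sc y (T u)) + cmod (y - z) * q u)"
        using C(2)[OF u, of z] C(1)[of z] by (meson mult_left_mono order_trans less_imp_le)
      also have "\<dots> = C z * q (u - sc y (T u)) + (C z * cmod (y - z)) * q u" by (simp add: algebra_simps)
      also have "\<dots> \<le> C z * q (u - sc y (T u)) + 1 / 2 * q u"
      proof -
        have "C z * cmod (y - z) \<le> 1 / 2"
          using z(2) C(1)[of z] by (simp add: dist_norm norm_minus_commute field_simps)
        from mult_right_mono[OF this q_nonneg[OF u]] show ?thesis by simp
      qed
      finally have "q u \<le> 2 * C z * q (u - sc y (T u))" by simp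
      also have "\<dots> \<le> ?C * q (u - sc y (T u))"
        by (intro mult_right_mono q_nonneg E_diff u E_scale Tu member_le_sum[OF z(1)])
           (use C(1) Z(2) in \<open>auto intro: less_imp_le\<close>)
      finally show ?thesis .
    qed
    moreover have "0 < ?C"
    proof (rule sum_pos)
      have "(0 :: complex) \<in> cball 0 2" by simp
      then show "Z \<noteq> {}" using Z(3) by auto
    qed (use C(1) Z(2) in auto)
    ultimately show ?thesis by blast
  qed
  then obtain C where C: "0 < C" "\<And>z u. cmod z \<le> 2 \<Longrightarrow> u \<in> E \<Longrightarrow> q u \<le> C * q (u - sc z (T u))"
    by auto
  \<comment> \<open>g z plays the role of (1 - z T)^(-1) v.\<close>
  from surj[OF v] obtain g where g: "\<And>z. g z \<in> E" "\<And>z. g z - sc z (T (g z)) = v" by metis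

  \<comment> \<open>The resolvent identity: the difference of the two solutions solves the equation
    for y with right-hand side (y - z) T (g z). Using the lower bound for it and once more for g z
    gives C^2.\<close>
  have lipschitz: "q (g y - g z) \<le> C\<^sup>2 * cmod (y - z) * q v" if "cmod y \<le> 2" "cmod z \<le> 2" for y z
  proof -
    note gE = g(1)[of y] g(1)[of z] T_in[OF g(1)[of y]] T_in[OF g(1)[of z]]
    have "(g y - g z) - sc y (T (g y - g z))
        = (g y - sc y (T (g y))) - (g z - sc z (T (g z))) + sc (y - z) (T (g z))"
      by (simp add: T_minus gE algebra_simps)
    also have "\<dots> = sc (y - z) (T (g z))" by (simp only: g(2)) simp
    finally have "q (g y - g z) \<le> C * (cmod (y - z) * q (g z))"
      using C(2)[OF that(1) E_diff[OF gE(1,2)]] by (simp add: q_scale gE q_T)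
    also have "\<dots> \<le> C * (cmod (y - z) * (C * q v))"
      using C(2)[OF that(2) gE(2)] C(1) by (intro mult_left_mono) (auto simp: g(2))
    finally show ?thesis by (simp add: power2_eq_square mult_ac)
  qed

  have Tn_in: "(T ^^ n) u \<in> E" and Tn_q: "q ((T ^^ n) u) = q u" if "u \<in> E" for n u
    using that by (induction n) (auto simp: T_in q_T)
  have Tn_scale: "(T ^^ n) (sc c u) = sc c ((T ^^ n) u)" if "u \<in> E" for n c u
    using that by (induction n) (auto simp: T_scale Tn_in)
  have Tn_add: "(T ^^ n) (u + w) = (T ^^ n) u + (T ^^ n) w" if "u \<in> E" "w \<in> E" for n u w
    using that by (induction n) (auto simp: T_add Tn_in)
  have Tn_sum: "(T ^^ n) (\<Sum>j\<in>A. f j) = (\<Sum>j\<in>A. (T ^^ n) (f j))"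
    if "finite A" "\<And>j. j \<in> A \<Longrightarrow> f j \<in> E" for n and A :: "nat set" and f
    using that
  proof (induction A rule: finite_induct)
    case empty
    show ?case using Tn_scale[OF v, of n 0] by simp
  qed (auto simp: Tn_add E_sum)
  \<comment> \<open>Sums z^i T^i applied to the equation g z - z T (g z) = v.\<close>
  have telescope: "g z - sc (z ^ n) ((T ^^ n) (g z)) = (\<Sum>i<n. sc (z ^ i) ((T ^^ i) v))" for z n
  proof (induction n)
    case (Suc n)
    have "sc (z ^ n) ((T ^^ n) (g z)) - sc (z ^ Suc n) ((T ^^ Suc n) (g z))
        = sc (z ^ n) ((T ^^ n) (g z) + (T ^^ n) (sc (- z) (T (g z))))"
      unfolding Tn_scale[OF T_in[OF g(1)]] funpow_Suc_right o_apply by (simp add: algebra_simps)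
    also have "\<dots> = sc (z ^ n) ((T ^^ n) (g z + sc (- z) (T (g z))))"
      by (simp only: Tn_add[OF g(1) E_scale[OF T_in[OF g(1)]]])
    also have "g z + sc (- z) (T (g z)) = v" using g(2)[of z] by simp
    finally show ?case using Suc by (simp add: algebra_simps)
  qed simp

  define \<omega> where "\<omega> n j = exp (2 * of_real pi * \<i> * of_nat j / of_nat n)" for n j :: nat
  define G where "G n r = sc (1 / of_nat n) (\<Sum>j<n. g (of_real r * \<omega> n j))" for n :: nat and r :: real
  have norm_\<omega>: "cmod (\<omega> n j) = 1" for n j
  proof -
    have "\<omega> n j = exp (\<i> * of_real (2 * pi * real j / real n))" by (simp add: \<omega>_def mult_ac)
    then show ?thesis by simp
  qed
  have G_in: "G n r \<in> E" for n r unfolding G_def by (intro E_scale E_sum g(1))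
  have G_eq: "G n r - sc (of_real r ^ n) ((T ^^ n) (G n r)) = v" if n: "0 < n" for n r
  proof -
    let ?z = "\<lambda>j. of_real r * \<omega> n j"
    have zn: "?z j ^ n = of_real r ^ n" for j
      using complex_root_unity[of n j] n by (simp add: \<omega>_def power_mult_distrib)
    have "(\<Sum>j<n. g (?z j)) - sc (of_real r ^ n) ((T ^^ n) (\<Sum>j<n. g (?z j)))
        = (\<Sum>j<n. g (?z j) - sc (?z j ^ n) ((T ^^ n) (g (?z j))))"
      by (simp only: Tn_sum[OF finite_lessThan g(1)] scale_sum_right zn sum_subtractf)
    also have "\<dots> = (\<Sum>j<n. \<Sum>i<n. sc (?z j ^ i) ((T ^^ i) v))" by (simp only: telescope)
    also have "\<dots> = (\<Sum>i<n. \<Sum>j<n. sc (?z j ^ i) ((T ^^ i) v))" by (rule sum.swap)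
    also have "\<dots> = (\<Sum>i<n. sc (of_real r ^ i * (\<Sum>j<n. \<omega> n j ^ i)) ((T ^^ i) v))"
      by (simp only: power_mult_distrib sum_distrib_left scale_sum_left)
    \<comment> \<open>The mean over the roots of unity annihilates every power of T except the
      zeroth.\<close>
    also have "\<dots> = (\<Sum>i<n. if i = 0 then sc (of_nat n) v else 0)"
      by (intro sum.cong refl) (auto simp: \<omega>_def sum_root_of_unity_powers)
    also have "\<dots> = sc (of_nat n) v" using n by simp
    finally have *: "(\<Sum>j<n. g (?z j)) - sc (of_real r ^ n) ((T ^^ n) (\<Sum>j<n. g (?z j)))
        = sc (of_nat n) v" .
    have "G n r - sc (of_real r ^ n) ((T ^^ n) (G n r))
        = sc (1 / of_nat n) ((\<Sum>j<n. g (?z j)) - sc (of_real r ^ n) ((T ^^ n) (\<Sum>j<n. g (?z j))))"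
      by (simp add: G_def Tn_scale[OF E_sum[OF g(1)]] scale_right_diff_distrib mult.commute)
    also have "\<dots> = v" unfolding * using n by simp
    finally show ?thesis .
  qed

  have G_dist: "q (G n r - v) = r ^ n * q (G n r)" if "0 < n" "0 \<le> r" for n r
  proof -
    have "sc (of_real r ^ n) ((T ^^ n) (G n r))
        = G n r - (G n r - sc (of_real r ^ n) ((T ^^ n) (G n r)))"
      by simp
    also have "\<dots> = G n r - v" by (simp only: G_eq[OF that(1)])
    finally have "q (G n r - v) = q (sc (of_real r ^ n) ((T ^^ n) (G n r)))" by simp
    also have "\<dots> = cmod (of_real r ^ n) * q (G n r)"
      by (simp only: q_scale[OF Tn_in[OF G_in]] Tn_q[OF G_in])
    finally show ?thesis using that(2) by (simp add: norm_power)
  qed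

  \<comment> \<open>The bound 1/2 keeps both radii inside the disc of radius 2, and 1 / (4 C^2)
    keeps the Lipschitz displacement 2 \<epsilon> C^2 q v at most q v / 2.\<close>
  define \<epsilon> where "\<epsilon> = min (1 / 2) (1 / (4 * C\<^sup>2))"
  have \<epsilon>: "0 < \<epsilon>" "\<epsilon> \<le> 1 / 2" "2 * \<epsilon> * C\<^sup>2 \<le> 1 / 2"
  proof -
    show "0 < \<epsilon>" "\<epsilon> \<le> 1 / 2" using C(1) by (auto simp: \<epsilon>_def)
    have "\<epsilon> * C\<^sup>2 \<le> 1 / (4 * C\<^sup>2) * C\<^sup>2" by (intro mult_right_mono) (auto simp: \<epsilon>_def)
    also have "\<dots> = 1 / 4" using C(1) by simp
    finally show "2 * \<epsilon> * C\<^sup>2 \<le> 1 / 2" by simp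
  qed
  \<comment> \<open>With 9 as threshold the distances of the two means from v and from 0 are at most
    q v / 8 each; added to q v / 2 they stay below q v, the contradiction.\<close>
  have "\<forall>\<^sub>F n in sequentially. (1 - \<epsilon>) ^ n < 1 / 9"
    using \<epsilon> by (intro order_tendstoD(2)[OF LIMSEQ_power_zero]) auto
  moreover have "\<forall>\<^sub>F n in sequentially. inverse ((1 + \<epsilon>) ^ n) < 1 / 9"
    using \<epsilon> by (intro order_tendstoD(2)[OF LIMSEQ_inverse_realpow_zero]) auto
  moreover have "\<forall>\<^sub>F n in sequentially. 0 < n" by (rule eventually_gt_at_top)
  ultimately have "\<forall>\<^sub>F n in sequentially. (1 - \<epsilon>) ^ n < 1 / 9 \<and> 9 < (1 + \<epsilon>) ^ n \<and> 0 < n"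
    by eventually_elim (use \<epsilon> in \<open>auto simp: field_simps\<close>)
  then obtain n where n: "(1 - \<epsilon>) ^ n < 1 / 9" "9 < (1 + \<epsilon>) ^ n" "0 < n"
    using eventually_happens'[OF sequentially_bot] by blast
  let ?r = "1 - \<epsilon>" and ?s = "1 + \<epsilon>"
  have far: "q (v - G n ?r) \<le> q v / 8"
  proof -
    have eq: "q (v - G n ?r) = ?r ^ n * q (G n ?r)"
      using G_dist[OF n(3), of ?r] \<epsilon> by (simp add: q_minus[OF v G_in])
    have "q (G n ?r) \<le> q (G n ?r - v) + q v" by (rule q_triangle[OF G_in v])
    then have "q (v - G n ?r) \<le> ?r ^ n * (q (v - G n ?r) + q v)"
      unfolding eq[symmetric] using \<epsilon> by (subst eq, intro mult_left_mono)
          (auto simp: q_minus[OF v G_in])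
    also have "\<dots> \<le> 1 / 9 * (q (v - G n ?r) + q v)"
      using n(1) q_nonneg[OF E_diff[OF v G_in]] qv by (intro mult_right_mono) auto
    finally show ?thesis by simp
  qed
  have near: "q (G n ?s) \<le> q v / 8"
  proof -
    have "?s ^ n * q (G n ?s) = q (G n ?s - v)"
      using G_dist[OF n(3), of ?s] \<epsilon> by simp
    also have "\<dots> \<le> q (G n ?s) + q v" by (rule q_diff[OF G_in v])
    finally have "?s ^ n * q (G n ?s) \<le> q (G n ?s) + q v" .
    moreover have "9 * q (G n ?s) \<le> ?s ^ n * q (G n ?s)"
      using n(2) q_nonneg[OF G_in] by (intro mult_right_mono) auto
    ultimately show ?thesis by simp
  qed
  have "q (G n ?r - G n ?s) \<le> q v / 2"
  proof -
    have "G n ?r - G n ?s = sc (1 / of_nat n) (\<Sum>j<n. g (of_real ?r * \<omega> n j) - g (of_real ?s * \<omega> n j))"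
      by (simp only: G_def scale_right_diff_distrib sum_subtractf)
    then have "q (G n ?r - G n ?s) = 1 / n * q (\<Sum>j<n. g (of_real ?r * \<omega> n j) - g (of_real ?s * \<omega> n j))"
      by (simp only: q_scale[OF E_sum[OF E_diff[OF g(1) g(1)]]]) (simp add: norm_divide)
    also have "\<dots> \<le> 1 / n * (\<Sum>j<n. q (g (of_real ?r * \<omega> n j) - g (of_real ?s * \<omega> n j)))"
      by (intro mult_left_mono q_sum E_diff g(1)) auto
    also have "\<dots> \<le> 1 / n * (\<Sum>j<n. 2 * \<epsilon> * C\<^sup>2 * q v)"
    proof (intro mult_left_mono sum_mono)
      fix j
      have "of_real ?r * \<omega> n j - of_real ?s * \<omega> n j = of_real (- (2 * \<epsilon>)) * \<omega> n j"
        by (simp add: algebra_simps)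
      then have "cmod (of_real ?r * \<omega> n j - of_real ?s * \<omega> n j) = 2 * \<epsilon>"
        using \<epsilon>(1) by (simp add: norm_mult norm_\<omega> del: of_real_minus of_real_mult)
      moreover have "cmod (of_real ?r * \<omega> n j) \<le> 2" "cmod (of_real ?s * \<omega> n j) \<le> 2"
        using \<epsilon>(1,2) by (simp_all add: norm_mult norm_\<omega> del: of_real_diff of_real_add)
      ultimately show "q (g (of_real ?r * \<omega> n j) - g (of_real ?s * \<omega> n j)) \<le> 2 * \<epsilon> * C\<^sup>2 * q v"
        using lipschitz[of "of_real ?r * \<omega> n j" "of_real ?s * \<omega> n j"] by (simp add: mult_ac)
    qed simp
    also have "\<dots> = 2 * \<epsilon> * C\<^sup>2 * q v" using n(3) by simp
    also have "\<dots> \<le> 1 / 2 * q v" using \<epsilon>(3) qv by (intro mult_right_mono) auto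
    finally show ?thesis by simp
  qed
  moreover have "q v \<le> q (v - G n ?r) + q (G n ?r)" by (rule q_triangle[OF v G_in])
  moreover have "q (G n ?r) \<le> q (G n ?r - G n ?s) + q (G n ?s)" by (rule q_triangle[OF G_in G_in])
  ultimately show False using far near qv by linarith
qed

section \<open>The quotient norm and Schur's lemma\<close>

context irreducible_rep
begin

text \<open>The norm of l1 modulo the annihilator of v, transported to E by a |-> \<rho> a v. It
  depends on the chosen nonzero vector v.\<close>

definition quotient_norm :: "'v \<Rightarrow> 'v \<Rightarrow> real"
  where "quotient_norm v u = (INF a\<in>{a \<in> l1. \<rho> a v = u}. l1_norm a)"

context
  fixes v assumes v: "v \<in> E" "v \<noteq> 0"
begin

lemma quotient_norm_le: "a \<in> l1 \<Longrightarrow> quotient_norm v (\<rho> a v) \<le> l1_norm a"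
  unfolding quotient_norm_def by (rule cINF_lower) (auto intro!: bdd_belowI2[of _ 0] l1_norm_ge_0)

text \<open>Estimates valid for all representatives of u pass to the infimum. Cyclicity provides a
  representative, and the factor C is built in because most estimates carry one.\<close>

lemma quotient_norm_bound:
  assumes u: "u \<in> E" and "0 \<le> C" and bound: "\<And>a. a \<in> l1 \<Longrightarrow> \<rho> a v = u \<Longrightarrow> B \<le> C * l1_norm a"
  shows "B \<le> C * quotient_norm v u"
proof -
  obtain a where a: "a \<in> l1" "\<rho> a v = u" using rho_cyclic[OF v u] by blast
  show ?thesis
  proof (cases "C = 0")
    case True
    then show ?thesis using bound[OF a] by simp
  next
    case False
    with \<open>0 \<le> C\<close> have C: "0 < C" by simp
    have "B / C \<le> quotient_norm v u"
      unfolding quotient_norm_def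
    proof (rule cINF_greatest)
      show "{a \<in> l1. \<rho> a v = u} \<noteq> {}" using a by blast
      show "B / C \<le> l1_norm a" if "a \<in> {a \<in> l1. \<rho> a v = u}" for a
        using bound[of a] that C by (simp add: field_simps)
    qed
    with C show ?thesis by (simp add: field_simps)
  qed
qed

lemma quotient_norm_nonneg: "u \<in> E \<Longrightarrow> 0 \<le> quotient_norm v u"
  using quotient_norm_bound[of u 1 0] by (simp add: l1_norm_ge_0)

lemma quotient_norm_rho:
  assumes b: "b \<in> l1" and u: "u \<in> E"
  shows "quotient_norm v (\<rho> b u) \<le> l1_norm b * quotient_norm v u"
proof (rule quotient_norm_bound[OF u l1_norm_ge_0])
  fix a assume a: "a \<in> l1" "\<rho> a v = u"
  have "quotient_norm v (\<rho> b u) \<le> l1_norm (l1_mult \<sigma> b a)"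
    using quotient_norm_le[of "l1_mult \<sigma> b a"] a b v(1) by (simp add: rho_mult l1_mult_in)
  also have "\<dots> \<le> l1_norm b * l1_norm a" by (rule l1_norm_mult_le[OF b a(1)])
  finally show "quotient_norm v (\<rho> b u) \<le> l1_norm b * l1_norm a" .
qed

lemma quotient_norm_add:
  assumes u: "u \<in> E" and w: "w \<in> E"
  shows "quotient_norm v (u + w) \<le> quotient_norm v u + quotient_norm v w"
proof -
  have "quotient_norm v (u + w) - quotient_norm v u \<le> 1 * quotient_norm v w"
  proof (rule quotient_norm_bound[OF w])
    fix b assume b: "b \<in> l1" "\<rho> b v = w"
    have "quotient_norm v (u + w) - l1_norm b \<le> 1 * quotient_norm v u"
    proof (rule quotient_norm_bound[OF u])
      fix a assume a: "a \<in> l1" "\<rho> a v = u"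
      have "quotient_norm v (u + w) \<le> l1_norm (a + b)"
        using quotient_norm_le[of "a + b"] a b v(1) by (simp add: rho_add l1_add)
      also have "\<dots> \<le> l1_norm a + l1_norm b" by (rule l1_norm_add_le[OF a(1) b(1)])
      finally show "quotient_norm v (u + w) - l1_norm b \<le> 1 * l1_norm a" by simp
    qed simp
    then show "quotient_norm v (u + w) - quotient_norm v u \<le> 1 * l1_norm b" by simp
  qed simp
  then show ?thesis by simp
qed

lemma quotient_norm_scale:
  assumes u: "u \<in> E"
  shows "quotient_norm v (sc c u) = cmod c * quotient_norm v u"
proof (rule antisym)
  have le: "quotient_norm v (sc c u) \<le> cmod c * quotient_norm v u" if "u \<in> E" for c u
  proof (rule quotient_norm_bound[OF that])
    fix a assume "a \<in> l1" "\<rho> a v = u"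
    then show "quotient_norm v (sc c u) \<le> cmod c * l1_norm a"
      using quotient_norm_le[of "l1_scale c a"] v(1) by (simp add: rho_scale l1_scale_in l1_norm_scale)
  qed simp
  then show "quotient_norm v (sc c u) \<le> cmod c * quotient_norm v u" using u .
  show "cmod c * quotient_norm v u \<le> quotient_norm v (sc c u)"
  proof (cases "c = 0")
    case True
    then show ?thesis using quotient_norm_nonneg[OF zero_in_E] by simp
  next
    case False
    then have "quotient_norm v u \<le> cmod (inverse c) * quotient_norm v (sc c u)"
      using le[OF subspace_scale[OF subspace_E u], of "inverse c" c] by simp
    with False show ?thesis by (simp add: norm_divide divide_simps mult.commute)
  qed
qed

text \<open>A representative of v with norm below 1 would be an element fixing v.\<close>

lemma quotient_norm_cyclic_vector: "1 \<le> quotient_norm v v"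
proof -
  have "1 \<le> 1 * quotient_norm v v"
    by (rule quotient_norm_bound[OF v(1)])
       (use rho_no_fixed_vector[OF _ _ v(1)] v(2) in \<open>force simp: not_less[symmetric]\<close>)+
  then show ?thesis by simp
qed

text \<open>Schur's lemma combined with the nonempty spectrum. If no 1 - z \<theta> vanished on E,
  irreducibility would make each of them bijective, since kernel and range are invariant, and the
  isometry would violate \<open>isometry_spectrum_nonempty\<close>.\<close>

lemma central_isometry_scalar:
  assumes th: "\<theta> \<in> l1" and central: "\<And>a u. a \<in> l1 \<Longrightarrow> u \<in> E \<Longrightarrow> \<rho> \<theta> (\<rho> a u) = \<rho> a (\<rho> \<theta> u)"
    and iso: "\<And>u. u \<in> E \<Longrightarrow> quotient_norm v (\<rho> \<theta> u) = quotient_norm v u"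
  obtains c where "cmod c = 1" "\<And>u. u \<in> E \<Longrightarrow> \<rho> \<theta> u = sc c u"
proof (cases "\<exists>z. \<forall>u\<in>E. u = sc z (\<rho> \<theta> u)")
  case True
  then obtain z where z: "\<And>u. u \<in> E \<Longrightarrow> u = sc z (\<rho> \<theta> u)" by blast
  with v have "z \<noteq> 0" by auto
  have eq: "\<rho> \<theta> u = sc (inverse z) u" if "u \<in> E" for u
  proof -
    have "sc (inverse z) u = sc (inverse z) (sc z (\<rho> \<theta> u))" using z[OF that] by simp
    with \<open>z \<noteq> 0\<close> show ?thesis by simp
  qed
  have "quotient_norm v v = cmod (inverse z) * quotient_norm v v"
    using iso[OF v(1)] quotient_norm_scale[OF v(1), of "inverse z"] eq[OF v(1)] by simp
  then have "cmod (inverse z) = 1" using quotient_norm_cyclic_vector by simp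
  with eq that show ?thesis by blast
next
  case False
  define op where "op z u = u - sc z (\<rho> \<theta> u)" for z u
  have op_in: "op z u \<in> E" if "u \<in> E" for z u
    unfolding op_def by (intro subspace_diff[OF subspace_E] subspace_scale[OF subspace_E] rho_in th
        that)
  have op_add: "op z (u + w) = op z u + op z w" if "u \<in> E" "w \<in> E" for z u w
    using that by (simp add: op_def rho_add_right[OF th] algebra_simps)
  have op_scale: "op z (sc c u) = sc c (op z u)" if "u \<in> E" for z c u
    using that by (simp add: op_def rho_scale_right[OF th] scale_right_diff_distrib mult.commute)
  have op_rho: "op z (\<rho> a u) = \<rho> a (op z u)" if "a \<in> l1" "u \<in> E" for z a u
    using that by (simp add: op_def central rho_diff_right rho_scale_right rho_in th
        subspace_scale[OF subspace_E])
  have op_zero: "op z 0 = 0" for z using th by (simp add: op_def)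
  from False have nz: "\<exists>u\<in>E. op z u \<noteq> 0" for z by (auto simp: op_def)
  have inj: "{u \<in> E. op z u = 0} = {0}" for z
  proof -
    have "{u \<in> E. op z u = 0} = {0} \<or> {u \<in> E. op z u = 0} = E"
    proof (rule invariant_trivial)
      show "subspace {u \<in> E. op z u = 0}"
        by (rule subspaceI)
           (auto simp: zero_in_E op_add op_scale op_zero
             intro: subspace_add[OF subspace_E] subspace_scale[OF subspace_E])
    qed (auto simp: rho_in op_rho)
    with nz show ?thesis by blast
  qed
  have surj: "op z ` E = E" for z
  proof -
    have "op z ` E = {0} \<or> op z ` E = E"
    proof (rule invariant_trivial)
      show "subspace (op z ` E)"
      proof (rule subspaceI)
        show "0 \<in> op z ` E" using op_zero[of z] zero_in_E by (intro image_eqI[of _ _ 0]) auto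
        show "x + y \<in> op z ` E" if "x \<in> op z ` E" "y \<in> op z ` E" for x y
          using that by (auto simp: op_add[symmetric] intro!: imageI subspace_add[OF subspace_E])
        show "sc c x \<in> op z ` E" if "x \<in> op z ` E" for c x
          using that by (auto simp: op_scale[symmetric] intro!: imageI subspace_scale[OF subspace_E])
      qed
      show "op z ` E \<subseteq> E" using op_in by blast
      show "\<rho> a x \<in> op z ` E" if "a \<in> l1" "x \<in> op z ` E" for a x
        using that by (auto simp: op_rho[symmetric] intro!: imageI rho_in)
    qed
    with nz[of z] show ?thesis by auto
  qed
  have "quotient_norm v v = 0"
  proof (rule isometry_spectrum_nonempty[where sc = sc and E = E and T = "\<rho> \<theta>" and q
      = "quotient_norm v"])
    show "\<exists>C>0. \<forall>u\<in>E. quotient_norm v u \<le> C * quotient_norm v (u - sc z (\<rho> \<theta> u))" for z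
    proof -
      \<comment> \<open>The inverse of \<open>op z\<close> is bounded explicitly: it sends v to w =
        \<rho> b v, and being compatible with the representation it sends \<rho> a v to \<rho> (a b)
        v. Hence the norm of b is a bound.\<close>
      obtain w where w: "w \<in> E" "op z w = v" using surj[of z] v(1) by (metis imageE)
      obtain b where b: "b \<in> l1" "\<rho> b v = w" using rho_cyclic[OF v w(1)] by blast
      have "quotient_norm v u \<le> l1_norm b * quotient_norm v (op z u)" if u: "u \<in> E" for u
      proof (rule quotient_norm_bound[OF op_in[OF u] l1_norm_ge_0])
        fix a assume a: "a \<in> l1" "\<rho> a v = op z u"
        have aw: "\<rho> a w \<in> E" by (rule rho_in[OF a(1) w(1)])
        have "op z (\<rho> a w - u) = op z (\<rho> a w) - op z u"
          using op_add[OF aw subspace_scale[OF subspace_E u], of z "- 1"] op_scale[OF u, of z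
              "- 1"] by simp
        also have "\<dots> = 0" using op_rho[OF a(1) w(1)] w(2) a(2) by simp
        finally have "\<rho> a w - u \<in> {u \<in> E. op z u = 0}"
          by (simp add: subspace_diff[OF subspace_E aw u])
        then have "u = \<rho> (l1_mult \<sigma> a b) v"
          using inj a b v(1) by (auto simp: rho_mult)
        then have "quotient_norm v u \<le> l1_norm (l1_mult \<sigma> a b)"
          using quotient_norm_le[OF l1_mult_in[OF a(1) b(1)]] by simp
        also have "\<dots> \<le> l1_norm a * l1_norm b" by (rule l1_norm_mult_le[OF a(1) b(1)])
        finally show "quotient_norm v u \<le> l1_norm b * l1_norm a" by (simp add: mult.commute)
      qed
      moreover have "l1_norm b * quotient_norm v (op z u)
          \<le> (l1_norm b + 1) * quotient_norm v (op z u)" if "u \<in> E" for u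
        using quotient_norm_nonneg[OF op_in[OF that]] by (intro mult_right_mono) auto
      moreover have "0 < l1_norm b + 1" using l1_norm_ge_0[of b] by linarith
      ultimately show ?thesis unfolding op_def by (meson order_trans)
    qed
    show "\<exists>u\<in>E. u - sc z (\<rho> \<theta> u) = w" if "w \<in> E" for z w
      using surj[of z] that unfolding op_def by (metis (no_types, lifting) imageE)
  qed (auto simp: v subspace_E quotient_norm_add quotient_norm_scale quotient_norm_nonneg iso th
      rho_in rho_add_right rho_scale_right vector_space_axioms)
  then show ?thesis using quotient_norm_cyclic_vector by simp
qed

end

text \<open>Since the p-th power of \<sigma> is the identity on the zero set, commutators with
  \<delta>^p have coefficients vanishing there and lie in the kernel. Neither \<delta>^p nor its
  inverse increases the quotient norm, so \<delta>^p acts isometrically.\<close>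

lemma periodic_shift_scalar:
  assumes fixed: "\<And>x. x \<in> ker.zero_set \<Longrightarrow> it p x = x"
  obtains c where "cmod c = 1" "l1_monom (const_bcontfun 1) p - l1_scale c l1_one \<in> ker"
proof -
  let ?th = "l1_monom (const_bcontfun 1) p" and ?th' = "l1_monom (const_bcontfun 1) (- p)"
  obtain v where v: "v \<in> E" "v \<noteq> 0" by (rule exists_nonzero)
  have central: "\<rho> ?th (\<rho> a u) = \<rho> a (\<rho> ?th u)" if a: "a \<in> l1" and u: "u \<in> E" for a u
  proof -
    have "l1_mult \<sigma> ?th a - l1_mult \<sigma> a ?th \<in> ker"
    proof (rule ker.vanishing_in_ideal)
      show "l1_mult \<sigma> ?th a - l1_mult \<sigma> a ?th \<in> l1"
        by (intro l1_diff l1_mult_in a l1_monom_in)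
      fix n x assume "x \<in> ker.zero_set"
      from fixed[OF this] have "it (- p) x = x" by (metis it_neg_cancel(1))
      then show "apply_bcontfun ((l1_mult \<sigma> ?th a - l1_mult \<sigma> a ?th) n) x = 0"
        by (simp add: l1_mult_monom_left l1_mult_monom_right)
    qed
    then have "\<rho> (l1_mult \<sigma> ?th a - l1_mult \<sigma> a ?th) u = 0"
      using u by (simp add: rep_kernel_def)
    then show ?thesis
      using a u by (simp add: rho_diff rho_mult l1_mult_in)
  qed
  have contr: "quotient_norm v (\<rho> (l1_monom (const_bcontfun 1) m) u)
      \<le> quotient_norm v u" if "u \<in> E" for m u
  proof -
    have "l1_norm (l1_monom (const_bcontfun 1 :: 'x \<Rightarrow>\<^sub>C complex) m) \<le> 1"
      using norm_const_bcontfun_le[of 1] by simp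
    from mult_right_mono[OF this quotient_norm_nonneg[OF v that]]
    show ?thesis using quotient_norm_rho[OF v l1_monom_in that, of "const_bcontfun 1" m] by linarith
  qed
  have iso: "quotient_norm v (\<rho> ?th u) = quotient_norm v u" if u: "u \<in> E" for u
  proof (rule antisym)
    have "\<rho> ?th' (\<rho> ?th u) = u"
      using u by (simp add: rho_mult[symmetric] l1_monom_cancel rho_one)
    then show "quotient_norm v u \<le> quotient_norm v (\<rho> ?th u)"
      using contr[OF rho_in[OF l1_monom_in u], of "- p" "const_bcontfun 1" p] by simp
  qed (rule contr[OF u])
  obtain c where c: "cmod c = 1" "\<And>u. u \<in> E \<Longrightarrow> \<rho> ?th u = sc c u"
    using central_isometry_scalar[OF v l1_monom_in central iso] by metis
  have "\<rho> (?th - l1_scale c l1_one) u = 0" if "u \<in> E" for u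
    using that by (simp add: rho_diff rho_scale rho_one c(2) l1_scale_in)
  then have "?th - l1_scale c l1_one \<in> ker"
    by (auto simp: rep_kernel_def)
  with c(1) that show ?thesis by blast
qed

end

section \<open>Ideals over a periodic orbit\<close>

text \<open>
  Modulo \<open>\<delta>\<^sup>p - c\<close> an element \<open>a\<close> reduces to \<open>\<Sum>\<^bsub>j<p\<^esub> g\<^sub>j \<delta>\<^sup>j\<close>, where \<open>g\<^sub>j\<close> collects the
  coefficients \<open>c\<^sup>m a(j + p m)\<close>.
\<close>

definition cyc_coeff :: "nat \<Rightarrow> complex \<Rightarrow> (int \<Rightarrow> ('x::topological_space \<Rightarrow>\<^sub>C complex)) \<Rightarrow> int \<Rightarrow>
    ('x \<Rightarrow>\<^sub>C complex)"
  where "cyc_coeff p c a j = (\<Sum>\<^sub>\<infinity>m. const_bcontfun (c powi m) * a (j + int p * m))"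

definition cyc_reduce :: "nat \<Rightarrow> complex \<Rightarrow> (int \<Rightarrow> ('x::topological_space \<Rightarrow>\<^sub>C complex)) \<Rightarrow> int \<Rightarrow>
    ('x \<Rightarrow>\<^sub>C complex)"
  where "cyc_reduce p c a = (\<Sum>j\<in>{0..<int p}. l1_monom (cyc_coeff p c a j) j)"

context
  fixes p :: nat and c :: complex
  assumes p: "0 < p" and c: "cmod c = 1"
begin

lemma cyc_norm_summable:
  assumes "a \<in> l1"
  shows "(\<lambda>m. norm (const_bcontfun (c powi m) * a (j + int p * m))) summable_on UNIV"
    and "(\<Sum>\<^sub>\<infinity>m. norm (const_bcontfun (c powi m) * a (j + int p * m))) \<le> l1_norm a"
proof -
  let ?h = "\<lambda>m. j + int p * m"
  have inj: "inj ?h" using p by (auto simp: inj_on_def)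
  have eq: "norm (const_bcontfun (c powi m) * a (?h m)) = norm (a (?h m))" for m
    by (simp add: norm_const_bcontfun_mult norm_power_int c)
  have sub: "(\<lambda>n. norm (a n)) summable_on range ?h"
    using summable_on_subset_banach[OF norm_summable_l1[OF assms]] by blast
  then show "(\<lambda>m. norm (const_bcontfun (c powi m) * a (?h m))) summable_on UNIV"
    unfolding eq using summable_on_reindex[OF inj, of "\<lambda>n. norm (a n)"] by (simp add: o_def)
  have "(\<Sum>\<^sub>\<infinity>m. norm (a (?h m))) = (\<Sum>\<^sub>\<infinity>n\<in>range ?h. norm (a n))"
    using infsum_reindex[OF inj, of "\<lambda>n. norm (a n)"] by (simp add: o_def)
  also have "\<dots> \<le> l1_norm a"
    unfolding l1_norm_def by (rule infsum_mono2[OF sub norm_summable_l1[OF assms]]) auto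
  finally show "(\<Sum>\<^sub>\<infinity>m. norm (const_bcontfun (c powi m) * a (?h m))) \<le> l1_norm a"
    unfolding eq .
qed

lemma cyc_coeff_has_sum:
  assumes "a \<in> l1"
  shows "((\<lambda>m. const_bcontfun (c powi m) * a (j + int p * m)) has_sum cyc_coeff p c a j) UNIV"
  unfolding cyc_coeff_def
  by (rule has_sum_infsum[OF abs_summable_summable[OF cyc_norm_summable(1)[OF assms]]])

lemma norm_cyc_coeff_le: "a \<in> l1 \<Longrightarrow> norm (cyc_coeff p c a j) \<le> l1_norm a"
  unfolding cyc_coeff_def
  by (rule order_trans[OF norm_infsum_bound[OF cyc_norm_summable(1)] cyc_norm_summable(2)])

lemma cyc_coeff_add: "a \<in> l1 \<Longrightarrow> b \<in> l1 \<Longrightarrow> cyc_coeff p c (a + b) j = cyc_coeff p c a j + cyc_coeff p c b j"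
  using has_sum_add[OF cyc_coeff_has_sum cyc_coeff_has_sum, of a b j j]
  by (subst cyc_coeff_def) (auto intro!: infsumI simp: distrib_left)

lemma l1_monom_add: "l1_monom (f + g) n = l1_monom f n + l1_monom g n"
  by (auto simp: l1_monom_def)

lemma cyc_reduce_in: "cyc_reduce p c a \<in> l1"
  unfolding cyc_reduce_def by (rule l1_sum) simp

lemma cyc_reduce_add: "a \<in> l1 \<Longrightarrow> b \<in> l1 \<Longrightarrow> cyc_reduce p c (a + b) = cyc_reduce p c a + cyc_reduce p c b"
  by (simp add: cyc_reduce_def cyc_coeff_add l1_monom_add sum.distrib)

text \<open>A crude bound; it supplies the continuity of the reduction in the limit case of
  \<open>reduce_congruent\<close>.\<close>

lemma l1_norm_cyc_reduce_le:
  assumes "a \<in> l1"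
  shows "l1_norm (cyc_reduce p c a) \<le> real p * l1_norm a"
proof -
  have "l1_norm (\<Sum>j\<in>A. l1_monom (cyc_coeff p c a j) j) \<le> (\<Sum>j\<in>A. norm (cyc_coeff p c a j))" for A
  proof (induction A rule: infinite_finite_induct)
    case (insert j A)
    then show ?case
      using l1_norm_add_le[OF l1_monom_in l1_sum[OF l1_monom_in], of "cyc_coeff p c a j" j
          "cyc_coeff p c a" "\<lambda>j. j" A]
      by (simp del: plus_fun_apply minus_apply zero_fun_apply)
  qed (simp_all del: plus_fun_apply minus_apply zero_fun_apply)
  then have "l1_norm (cyc_reduce p c a) \<le> (\<Sum>j\<in>{0..<int p}. norm (cyc_coeff p c a j))"
    unfolding cyc_reduce_def .
  also have "\<dots> \<le> (\<Sum>j\<in>{0..<int p}. l1_norm a)"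
    by (intro sum_mono norm_cyc_coeff_le assms)
  finally show ?thesis by simp
qed

lemma cyc_reduce_monom:
  "cyc_reduce p c (l1_monom f n) = l1_monom (const_bcontfun (c powi (n div int p)) * f) (n mod int p)"
proof -
  have "cyc_coeff p c (l1_monom f n) j = (if j
      = n mod int p then const_bcontfun (c powi (n div int p)) * f else 0)"
    if j: "j \<in> {0..<int p}" for j
  proof -
    have "j + int p * m = n \<longleftrightarrow> j = n mod int p \<and> m = n div int p" for m
      using j p by (auto simp: mod_mult_self2)
    then show ?thesis
      unfolding cyc_coeff_def
      by (subst infsum_single[where m = "n div int p"]) (auto simp: l1_monom_def)
  qed
  then have "cyc_reduce p c (l1_monom f n) = (\<Sum>j\<in>{0..<int p}.
      if j = n mod int p then l1_monom (const_bcontfun (c powi (n div int p)) * f) j else 0)"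
    unfolding cyc_reduce_def by (intro sum.cong refl) (auto simp: l1_monom_def)
  then show ?thesis using p by (simp add: sum.delta del: plus_fun_apply minus_apply zero_fun_apply)
qed

end

lemma (in dynamical_system) orbit_eq_period_image:
  assumes x: "x \<in> Per \<sigma>"
  shows "(\<lambda>k. it k x) ` {0..<int (period \<sigma> x)} = range (\<lambda>i. it i x)"
proof
  show "range (\<lambda>i. it i x) \<subseteq> (\<lambda>k. it k x) ` {0..<int (period \<sigma> x)}"
  proof (rule image_subsetI)
    fix i
    have "it i x = it (i mod int (period \<sigma> x)) x" by (simp add: it_eq_iff_mod_period[OF x])
    then show "it i x \<in> (\<lambda>i. it i x) ` {0..<int (period \<sigma> x)}" using period_pos[OF x] by auto
  qed
qed auto

lemma (in dynamical_system) finite_orbit: "x \<in> Per \<sigma> \<Longrightarrow> finite (range (\<lambda>i. it i x))"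
  by (simp flip: orbit_eq_period_image)

text \<open>Both the kernel of an abstract finite dimensional irreducible representation and that of
  \<pi>_{x,c} are instances. The criterion \<open>mem_iff_cyc_coeff\<close> refers only to x and c,
  so any two instances with the same data coincide.\<close>

locale periodic_ideal = closed_ideal \<sigma> J
  for \<sigma> :: "'x::t2_space \<Rightarrow> 'x" and J +
  fixes x :: 'x and c :: complex
  assumes x_Per: "x \<in> Per \<sigma>" and c_norm: "cmod c = 1"
    and zero_set_orbit: "zero_set = range (\<lambda>i. it i x)"
    and shift_scalar: "l1_monom (const_bcontfun 1) (int (period \<sigma> x)) - l1_scale c l1_one \<in> J"
begin

abbreviation p :: nat where "p \<equiv> period \<sigma> x"

lemmas p_pos = period_pos[OF x_Per]

lemma shift_monom: "l1_monom f (n + int p) - l1_monom (const_bcontfun c * f) n \<in> J"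
proof -
  have scalar: "l1_scale c l1_one = (l1_monom (const_bcontfun c) 0 :: int \<Rightarrow> ('x \<Rightarrow>\<^sub>C complex))"
    by (auto simp: l1_scale_def l1_one_eq_monom l1_monom_def intro!: bcontfun_eqI)
  have "l1_mult \<sigma> (l1_monom f n) (l1_monom (const_bcontfun 1) (int p) - l1_scale c l1_one)
      = l1_monom (f * alpha_pow \<sigma> n (const_bcontfun 1)) (n + int p)
        - l1_monom (f * alpha_pow \<sigma> n (const_bcontfun c)) n"
    unfolding scalar l1_mult_diff_right[OF l1_monom_in l1_monom_in l1_monom_in] l1_mult_monom_monom
        by simp
  with ideal_left[OF l1_monom_in shift_scalar, of f n]
  have "l1_monom (f * alpha_pow \<sigma> n (const_bcontfun 1)) (n + int p)
      - l1_monom (f * alpha_pow \<sigma> n (const_bcontfun c)) n \<in> J" by (simp only:)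
  moreover have "f * alpha_pow \<sigma> n (const_bcontfun 1) = f" "f * alpha_pow \<sigma> n (const_bcontfun c)
      = const_bcontfun c * f"
    by (auto intro!: bcontfun_eqI)
  ultimately show ?thesis by simp
qed

lemma shift_monom_multiple: "l1_monom f (j + int p * m)
    - l1_monom (const_bcontfun (c powi m) * f) j \<in> J"
proof (induction m arbitrary: f rule: int_induct[where k = 0])
  case base
  have "const_bcontfun 1 * f = f" by (rule bcontfun_eqI) simp
  then show ?case using ideal_0 by (simp del: plus_fun_apply minus_apply zero_fun_apply)
next
  case (step1 i)
  have c0: "c \<noteq> 0" using c_norm by auto
  have eq: "const_bcontfun (c powi i) * (const_bcontfun c * f) = const_bcontfun (c powi (i + 1)) * f"
    by (rule bcontfun_eqI) (simp add: power_int_add c0)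
  have "l1_monom f (j + int p * i + int p) - l1_monom (const_bcontfun c * f) (j + int p * i)
      + (l1_monom (const_bcontfun c * f) (j + int p * i)
          - l1_monom (const_bcontfun (c powi i) * (const_bcontfun c * f)) j) \<in> J"
    by (rule ideal_add[OF shift_monom[of f "j + int p * i"] step1(2)[of "const_bcontfun c * f"]])
  moreover have "j + int p * i + int p = j + int p * (i + 1)" by (simp add: algebra_simps)
  moreover have "u - y + (y - z) = u - z" for u y z :: "int \<Rightarrow> ('x \<Rightarrow>\<^sub>C complex)" by (rule ext) simp
  ultimately show ?case unfolding eq by (simp only:)
next
  case (step2 i)
  have c0: "c \<noteq> 0" using c_norm by auto
  \<comment> \<open>Absorbing 1 / c into the coefficient allows the congruence of one step upwards
    to be read backwards.\<close>
  let ?f = "const_bcontfun (inverse c) * f"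
  have eq: "const_bcontfun (c powi i) * ?f
      = const_bcontfun (c powi (i - 1)) * f" "const_bcontfun c * ?f = f"
    by (auto intro!: bcontfun_eqI simp: power_int_diff c0 field_simps)
  have idx: "j + int p * (i - 1) + int p = j + int p * i" by (simp add: algebra_simps)
  have "l1_monom ?f (j + int p * i) - l1_monom (const_bcontfun (c powi i) * ?f) j
      - (l1_monom ?f (j + int p * (i - 1) + int p)
          - l1_monom (const_bcontfun c * ?f) (j + int p * (i - 1))) \<in> J"
    by (rule ideal_diff[OF step2(2)[of ?f] shift_monom[of ?f "j + int p * (i - 1)"]])
  moreover have "u - y - (u - z) = z - y" for u y z :: "int \<Rightarrow> ('x \<Rightarrow>\<^sub>C complex)" by (rule ext) simp
  ultimately show ?case unfolding eq idx by (simp only:)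
qed

lemma reduce_congruent: "a \<in> l1 \<Longrightarrow> a - cyc_reduce p c a \<in> J"
proof (induction rule: l1_induct)
  case (monom f n)
  show ?case
    using shift_monom_multiple[of f "n mod int p" "n div int p"]
    by (simp add: cyc_reduce_monom[OF p_pos c_norm] del: plus_fun_apply minus_apply zero_fun_apply)
next
  case (add a b)
  have "a + b - cyc_reduce p c (a + b) = (a - cyc_reduce p c a) + (b - cyc_reduce p c b)"
    unfolding cyc_reduce_add[OF p_pos c_norm add.hyps] by (rule ext) simp
  with ideal_add[OF add.IH] show ?case by (simp only:)
next
  case (limit a)
  show ?case
  proof (rule ideal_closed)
    show "a - cyc_reduce p c a \<in> l1" by (intro l1_diff limit(1) cyc_reduce_in[OF p_pos c_norm])
    fix \<epsilon> :: real assume "0 < \<epsilon>"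
    then have "0 < \<epsilon> / (1 + real p)" by simp
    from limit(2)[OF this] obtain b where b: "b \<in> l1" "b - cyc_reduce p c b \<in> J"
      "l1_norm (a - b) < \<epsilon> / (1 + real p)" by blast
    have ab: "a - b \<in> l1" by (intro l1_diff limit(1) b(1))
    have "cyc_reduce p c a = cyc_reduce p c (a - b) + cyc_reduce p c b"
      using cyc_reduce_add[OF p_pos c_norm ab b(1)] by simp
    then have diff: "(a - cyc_reduce p c a) - (b - cyc_reduce p c b)
        = (a - b) + - cyc_reduce p c (a - b)"
      by (simp add: algebra_simps)
    have "l1_norm ((a - cyc_reduce p c a) - (b - cyc_reduce p c b))
        \<le> l1_norm (a - b) + l1_norm (cyc_reduce p c (a - b))"
      unfolding diff
      using l1_norm_add_le[OF ab l1_uminus[OF cyc_reduce_in[OF p_pos c_norm]], of "a - b"]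
      by (simp only: l1_norm_uminus)
    also have "\<dots> \<le> l1_norm (a - b) + real p * l1_norm (a - b)"
      by (intro add_left_mono l1_norm_cyc_reduce_le[OF p_pos c_norm ab])
    also have "\<dots> = (1 + real p) * l1_norm (a - b)" by (simp add: algebra_simps)
    also have "\<dots> < \<epsilon>" using b(3) by (simp add: field_simps)
    finally show "\<exists>d\<in>J. l1_norm (a - cyc_reduce p c a - d) < \<epsilon>" using b(2) by blast
  qed
qed

text \<open>Compress by functions isolating y and \<open>it (- j) y\<close> within the orbit.
  Different exponents in [0, p) lead from y to different points, so on the orbit only the j-th
  coefficient survives.\<close>

lemma reduced_coefficients_vanish:
  assumes b: "(\<Sum>j\<in>{0..<int p}. l1_monom (g j) j) \<in> J" and j: "j \<in> {0..<int p}"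
    and y: "y \<in> range (\<lambda>i. it i x)"
  shows "apply_bcontfun (g j) y = 0"
proof -
  let ?O = "range (\<lambda>i. it i x)"
  let ?b = "\<Sum>j\<in>{0..<int p}. l1_monom (g j) j"
  have b_apply: "?b n = (if n \<in> {0..<int p} then g n else 0)" for n
    by (auto simp: sum_fun_apply l1_monom_def)
  obtain i where i: "y = it i x" using y by blast
  have fin: "closed (?O - {z})" for z using finite_orbit[OF x_Per] by (simp add: finite_imp_closed)
  obtain f :: "'x \<Rightarrow>\<^sub>C complex" where f: "\<And>z. z \<in> {y} \<Longrightarrow> apply_bcontfun f z = 1"
    "\<And>z. z \<in> ?O - {y} \<Longrightarrow> apply_bcontfun f z = 0"
    by (rule bump_function[of "{y}" "?O - {y}"]) (use fin in auto)
  obtain h :: "'x \<Rightarrow>\<^sub>C complex" where h: "\<And>z. z \<in> {it (- j) y} \<Longrightarrow> apply_bcontfun h z = 1"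
    "\<And>z. z \<in> ?O - {it (- j) y} \<Longrightarrow> apply_bcontfun h z = 0"
    by (rule bump_function[of "{it (- j) y}" "?O - {it (- j) y}"]) (use fin in auto)
  define d where "d = l1_mult \<sigma> (l1_embed f) (l1_mult \<sigma> ?b (l1_embed h))"
  have d: "d \<in> J" unfolding d_def by (intro ideal_left ideal_right b l1_embed_in)
  have d_apply: "apply_bcontfun (d n) z
      = apply_bcontfun f z * apply_bcontfun (?b n) z * apply_bcontfun h (it (- n) z)" for n z
    by (simp add: d_def l1_embed_eq_monom l1_mult_monom_left l1_mult_monom_right)
  have "d - l1_monom (d j) j \<in> J"
  proof (rule vanishing_in_ideal)
    show "d - l1_monom (d j) j \<in> l1" by (intro l1_diff ideal_l1[OF d] l1_monom_in)
    fix n z assume "z \<in> zero_set"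
    then have z: "z \<in> ?O" by (simp add: zero_set_orbit)
    have "apply_bcontfun (d n) z = 0" if "n \<noteq> j"
    proof (rule ccontr)
      assume nz: "apply_bcontfun (d n) z \<noteq> 0"
      then have n: "n \<in> {0..<int p}" by (auto simp: d_apply b_apply split: if_splits)
      from nz have "z = y" using f(2)[of z] z by (auto simp: d_apply)
      moreover have "it (- n) z \<in> ?O" using z by (auto simp: it_add[symmetric])
      then have "it (- n) z = it (- j) y" using nz h(2)[of "it (- n) z"] by (auto simp: d_apply)
      ultimately have "it (i - n) x = it (i - j) x"
        using it_add[of "- n" i x] it_add[of "- j" i x] by (simp add: i)
      then have "(i - n) mod int p = (i - j) mod int p" by (simp add: it_eq_iff_mod_period[OF x_Per])
      then have "n mod int p = j mod int p"
        by (metis mod_diff_right_eq diff_diff_eq2 add_diff_cancel_left')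
      with n j that show False by simp
    qed
    then show "apply_bcontfun ((d - l1_monom (d j) j) n) z = 0" by (auto simp: l1_monom_def)
  qed
  from ideal_diff[OF d this] have "l1_monom (d j) j \<in> J" by simp
  \<comment> \<open>Multiplying by \<delta>^(-j) brings the remaining monomial into C(X), where
    membership in the ideal is decided on the zero set.\<close>
  from ideal_right[OF this l1_monom_in, of "const_bcontfun 1" "- j"]
  have "l1_monom (d j * alpha_pow \<sigma> j (const_bcontfun 1)) 0 \<in> J" by (simp add: l1_mult_monom_monom)
  moreover have "d j * alpha_pow \<sigma> j (const_bcontfun 1) = d j" by (rule bcontfun_eqI) simp
  ultimately have "l1_embed (d j) \<in> J" by (simp add: l1_embed_eq_monom)
  then have "apply_bcontfun (d j) y = 0" using y unfolding embed_in_iff zero_set_orbit by blast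
  then show ?thesis using f(1)[of y] h(1)[of "it (- j) y"] j by (simp add: d_apply b_apply)
qed

theorem mem_iff_cyc_coeff:
  "a \<in> J \<longleftrightarrow> a \<in> l1 \<and> (\<forall>j\<in>{0..<int p}. \<forall>y\<in>range (\<lambda>i. it i x). apply_bcontfun (cyc_coeff p c a j) y = 0)"
proof (intro iffI conjI ballI; (elim conjE)?)
  show "a \<in> l1" if "a \<in> J" using that by (rule ideal_l1)
  fix j y assume a: "a \<in> J" and j: "j \<in> {0..<int p}" and y: "y \<in> range (\<lambda>i. it i x)"
  have "cyc_reduce p c a \<in> J"
    using ideal_diff[OF a reduce_congruent[OF ideal_l1[OF a]]] by simp
  then show "apply_bcontfun (cyc_coeff p c a j) y = 0"
    unfolding cyc_reduce_def by (rule reduced_coefficients_vanish[OF _ j y])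
next
  assume a: "a \<in> l1" and zero:
      "\<forall>j\<in>{0..<int p}. \<forall>y\<in>range (\<lambda>i. it i x). apply_bcontfun (cyc_coeff p c a j) y = 0"
  have "cyc_reduce p c a \<in> J"
    unfolding cyc_reduce_def
    by (intro ideal_sum ideal_monom) (use zero in \<open>simp add: embed_in_iff zero_set_orbit\<close>)
  from ideal_add[OF reduce_congruent[OF a] this] show "a \<in> J" by simp
qed

end

section \<open>Kernels of irreducible representations\<close>

context orbit_rep
begin

lemma closed_ideal_kernel: "closed_ideal \<sigma> (rep_kernel (l2_on K) rep)"
proof
  fix a :: "int \<Rightarrow> ('x \<Rightarrow>\<^sub>C complex)"
  assume a: "a \<in> l1" and approx: "\<And>\<epsilon>. 0 < \<epsilon> \<Longrightarrow> \<exists>b\<in>rep_kernel (l2_on K) rep. l1_norm (a - b) < \<epsilon>"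
  have "rep a v = 0" if v: "v \<in> l2_on K" for v
  proof -
    have "l2_norm (rep a v) \<le> \<epsilon>" if "0 < \<epsilon>" for \<epsilon>
    proof -
      have pos: "0 < l2_norm v + 1" using l2_norm_ge_0[of v] by linarith
      with that have "0 < \<epsilon> / (l2_norm v + 1)" by simp
      from approx[OF this] obtain b where b: "b \<in> rep_kernel (l2_on K) rep" "l1_norm (a
          - b) < \<epsilon> / (l2_norm v + 1)"
        by blast
      then have bl: "b \<in> l1" "rep b v = 0" using v by (auto simp: rep_kernel_def)
      have "rep a v = rep (a - b) v"
        using rep_add[OF l1_diff[OF a bl(1)] bl(1) v] bl(2) by simp
      then have "l2_norm (rep a v) \<le> l1_norm (a - b) * l2_norm v"
        using l2_norm_rep_le[OF l1_diff[OF a bl(1)] v] by simp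
      also have "\<dots> \<le> l1_norm (a - b) * (l2_norm v + 1)"
        by (intro mult_left_mono l1_norm_ge_0) simp
      also have "\<dots> \<le> \<epsilon>" using b(2) pos by (simp add: field_simps)
      finally show ?thesis .
    qed
    then have "l2_norm (rep a v) \<le> 0" by (rule field_le_epsilon[of _ 0, simplified])
    then have "l2_norm (rep a v) = 0" using l2_norm_ge_0[of "rep a v"] by linarith
    then show ?thesis using l2_norm_zero_iff[OF rep_in_l2[OF a v]] by simp
  qed
  with a show "a \<in> rep_kernel (l2_on K) rep" by (simp add: rep_kernel_def)
next
  have "rep 0 v = 0" for v by (simp add: rep_def fun_eq_iff)
  then show "0 \<in> rep_kernel (l2_on K) rep" by (simp add: rep_kernel_def)
next
  have z: "rep a 0 = 0" for a by (simp add: rep_def fun_eq_iff)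
  show "l1_mult \<sigma> a b \<in> rep_kernel (l2_on K) rep" if "a \<in> l1" "b \<in> rep_kernel (l2_on K) rep" for a b
    using that by (auto simp: rep_kernel_def rep_mult z)
qed (auto simp: rep_kernel_def rep_add rep_mult rep_in_l2)

lemma embed_in_kernel_iff:
  "l1_embed f \<in> rep_kernel (l2_on K) rep \<longleftrightarrow> (\<forall>k\<in>K. apply_bcontfun f (q k) = 0)"
proof
  assume ker: "l1_embed f \<in> rep_kernel (l2_on K) rep"
  show "\<forall>k\<in>K. apply_bcontfun f (q k) = 0"
  proof
    fix k assume k: "k \<in> K"
    have "rep (l1_embed f) (fun_basis k) = 0"
      using ker fun_basis_in_l2[OF k] by (simp add: rep_kernel_def)
    from fun_cong[OF this, of k] have "apply_bcontfun f (q k) * fun_basis k k = 0"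
      by (simp add: rep_embed[OF fun_basis_in_l2[OF k]])
    then show "apply_bcontfun f (q k) = 0" by (simp add: fun_basis_def)
  qed
next
  assume "\<forall>k\<in>K. apply_bcontfun f (q k) = 0"
  then have "l1_embed f \<in> {a \<in> l1. \<forall>n. \<forall>k\<in>K. apply_bcontfun (a n) (q k) = 0}"
    by (intro CollectI conjI l1_embed_in) (auto simp: l1_embed_def)
  then show "l1_embed f \<in> rep_kernel (l2_on K) rep" using kernel_rep_subset by blast
qed

text \<open>Stated for an arbitrary index set because it is applied both to {0..<p} and to a copy of
  it inside a larger index type. The hypotheses on \<tau> and w say that U^p is multiplication by
  c.\<close>

lemma periodic_ideal_kernel:
  assumes x: "x \<in> Per \<sigma>" and c: "cmod c = 1" and orbit: "q ` K = range (\<lambda>i. it i x)"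
    and per: "\<And>k. k \<in> K \<Longrightarrow> \<tau> (- int (period \<sigma> x)) k = k"
    and scalar: "\<And>k. k \<in> K \<Longrightarrow> w (int (period \<sigma> x)) k = c"
  shows "periodic_ideal \<sigma> (rep_kernel (l2_on K) rep) x c"
proof -
  interpret closed_ideal \<sigma> "rep_kernel (l2_on K) rep" by (rule closed_ideal_kernel)
  show ?thesis
  proof
    show "zero_set = range (\<lambda>i. it i x)"
      unfolding orbit[symmetric]
    proof
      show "q ` K \<subseteq> zero_set" by (auto simp: zero_set_def embed_in_kernel_iff)
      show "zero_set \<subseteq> q ` K"
      proof (rule ccontr)
        assume "\<not> zero_set \<subseteq> q ` K"
        then obtain y where y: "y \<in> zero_set" "y \<notin> q ` K" by blast
        \<comment> \<open>The orbit is finite, hence closed, so a function in the kernel can be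
          nonzero at y.\<close>
        have "closed (q ` K)" unfolding orbit by (rule finite_imp_closed[OF finite_orbit[OF x]])
        then obtain f :: "'x \<Rightarrow>\<^sub>C complex" where f: "\<And>z. z \<in> {y} \<Longrightarrow> apply_bcontfun f z = 1"
          "\<And>z. z \<in> q ` K \<Longrightarrow> apply_bcontfun f z = 0"
          by (rule bump_function[of "{y}" "q ` K", rotated]) (use y in auto)
        then have "l1_embed f \<in> rep_kernel (l2_on K) rep" by (simp add: embed_in_kernel_iff)
        then show False using y(1) f(1)[of y] by (simp add: zero_set_def)
      qed
    qed
    let ?a = "l1_monom (const_bcontfun 1) (int (period \<sigma> x))
        + l1_scale (- c) l1_one :: int \<Rightarrow> ('x \<Rightarrow>\<^sub>C complex)"
    have "rep ?a v = 0" if v: "v \<in> l2_on K" for v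
    proof -
      have "rep ?a v = rep (l1_monom (const_bcontfun 1) (int (period \<sigma> x))) v
          + fun_scale (- c) (rep l1_one v)"
        by (simp only: rep_add[OF l1_monom_in l1_scale_in[OF l1_one_in] v] rep_scale[OF l1_one_in v])
      also have "rep l1_one v = v" using unital_rep_rep v by (simp add: unital_rep_def)
      also have "rep (l1_monom (const_bcontfun 1) (int (period \<sigma> x))) v + fun_scale (- c) v = 0"
        using v by (auto simp: rep_monom per scalar fun_scale_def fun_eq_iff l2_on_def)
      finally show ?thesis .
    qed
    moreover have "?a \<in> l1" by (intro l1_add l1_monom_in l1_scale_in l1_one_in)
    ultimately have "?a \<in> rep_kernel (l2_on K) rep" by (simp add: rep_kernel_def)
    moreover have "l1_monom (const_bcontfun 1) (int (period \<sigma> x)) - l1_scale c l1_one = ?a"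
      by (rule ext, rule bcontfun_eqI) (simp add: l1_scale_def)
    ultimately show "l1_monom (const_bcontfun 1) (int (period \<sigma> x))
        - l1_scale c l1_one \<in> rep_kernel (l2_on K) rep"
      by (simp only:)
  qed (use x c in auto)
qed

end

section \<open>Realizing the ideals on Hilbert spaces\<close>

context dynamical_system
begin

lemma periodic_ideal_unique:
  assumes "periodic_ideal \<sigma> I x c" "periodic_ideal \<sigma> J x c"
  shows "I = J"
  using periodic_ideal.mem_iff_cyc_coeff[OF assms(1)] periodic_ideal.mem_iff_cyc_coeff[OF assms(2)]
      by blast

lemma per_cocycle_period:
  fixes c :: complex
  assumes "k \<in> {0..<int m}" "0 < m"
  shows "c powi (- ((k - int m) div int m)) = c"
proof -
  have "(k - int m) div int m = - 1"
    using assms div_mult_self1[of "int m" k "- 1"] by simp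
  then show ?thesis by simp
qed

lemma periodic_ideal_per:
  assumes x: "x \<in> Per \<sigma>" and c: "cmod c = 1"
  shows "periodic_ideal \<sigma> (rep_kernel (H_per (period \<sigma> x)) (pi_per \<sigma> x c)) x c"
proof -
  interpret orbit_rep \<sigma> "{0..<int (period \<sigma> x)}" "\<lambda>n k. (k + n) mod int (period \<sigma> x)" "\<lambda>k. it k x"
    "\<lambda>n k. c powi (- ((k - n) div int (period \<sigma> x)))"
    by (rule orbit_rep_per[OF x c])
  have "rep_kernel (H_per (period \<sigma> x)) (pi_per \<sigma> x c) = rep_kernel (H_per (period \<sigma> x)) rep"
    by (rule rep_kernel_cong) (rule pi_per_eq_rep[OF x c])
  also have "periodic_ideal \<sigma> \<dots> x c"
    unfolding H_per_eq
    by (rule periodic_ideal_kernel[OF x c])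
       (use period_pos[OF x] in \<open>auto simp: orbit_eq_period_image[OF x] per_cocycle_period\<close>)
  finally show ?thesis .
qed

text \<open>The cycle {0..<p} is copied into the third component of the triples, with the others
  fixed. The aperiodic case uses the first component of the same type, so one ambient space serves
  every primitive ideal.\<close>

lemma periodic_representation:
  assumes x: "x \<in> Per \<sigma>" and c: "cmod c = 1" and I: "periodic_ideal \<sigma> I x c"
  shows "\<exists>(sc :: complex \<Rightarrow> ('x \<times> complex \<times> int \<Rightarrow> complex) \<Rightarrow> 'x \<times> complex \<times> int \<Rightarrow> complex) H ip \<pi>.
    involutive_rep \<sigma> sc H ip \<pi> \<and> unital_rep H \<pi> \<and> I = rep_kernel H \<pi>"
proof -
  let ?p = "int (period \<sigma> x)"
  interpret P: orbit_rep \<sigma> "{0..<?p}" "\<lambda>n k. (k + n) mod ?p" "\<lambda>k. it k x"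
    "\<lambda>n k. c powi (- ((k - n) div ?p))"
    by (rule orbit_rep_per[OF x c])
  let ?K = "(\<lambda>k. (x, 0 :: complex, k)) ` {0..<?p}"
  interpret Q: orbit_rep \<sigma> ?K "\<lambda>n (y, z, k). (y, z, (k + n) mod ?p)" "\<lambda>(y, z, k). it k x"
    "\<lambda>n (y, z, k). c powi (- ((k - n) div ?p))"
  proof
    fix k :: "'x \<times> complex \<times> int" and m n
    assume "k \<in> ?K"
    then obtain j where k: "k = (x, 0, j)" and j: "j \<in> {0..<?p}" by blast
    show "(case k of (y, z, k) \<Rightarrow> (y, z, (k + n) mod ?p)) \<in> ?K"
      using P.act_in[OF j, of n] by (auto simp: k)
    show "(case k of (y, z, k) \<Rightarrow> (y, z, (k + 0) mod ?p)) = k"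
      using P.act_0[OF j] by (simp add: k)
    show "(case k of (y, z, k) \<Rightarrow> (y, z, (k + (m + n)) mod ?p))
        = (case case k of (y, z, k) \<Rightarrow> (y, z, (k + n) mod ?p) of (y, z, k) \<Rightarrow> (y, z, (k + m) mod ?p))"
      using P.act_add[OF j, of m n] by (simp add: k)
    show "(case case k of (y, z, k) \<Rightarrow> (y, z, (k + n) mod ?p) of (y, z, k) \<Rightarrow> it k x)
        = it n (case k of (y, z, k) \<Rightarrow> it k x)"
      using P.equivariant[OF j, of n] by (simp add: k)
    show "cmod (case k of (y, z, k) \<Rightarrow> c powi (- ((k - n) div ?p))) = 1"
      using P.cocycle_norm[OF j, of n] by (simp add: k)
    show "(case k of (y, z, k) \<Rightarrow> c powi (- ((k - (m + n)) div ?p)))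
        = (case k of (y, z, k) \<Rightarrow> c powi (- ((k - m) div ?p)))
          * (case case k of (y, z, k) \<Rightarrow> (y, z, (k + - m) mod ?p) of (y, z, k) \<Rightarrow> c powi (- ((k
              - n) div ?p)))"
      using P.cocycle[OF j, of m n] by (simp add: k)
  qed
  have "periodic_ideal \<sigma> (rep_kernel (l2_on ?K) Q.rep) x c"
    by (rule Q.periodic_ideal_kernel[OF x c])
       (use period_pos[OF x] in \<open>auto simp: image_image orbit_eq_period_image[OF x] per_cocycle_period\<close>)
  then have "I = rep_kernel (l2_on ?K) Q.rep" by (rule periodic_ideal_unique[OF I])
  with Q.involutive_rep_rep Q.unital_rep_rep show ?thesis by blast
qed

text \<open>The space is l^2(S) with \<sigma> permuting the coordinates, that is, the direct sum of
  the \<pi>_x^2 over the orbits contained in S. Aperiodicity makes the action free, so the kernel is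
  read off from the coefficients.\<close>

lemma aperiodic_representation:
  assumes S: "S \<subseteq> Aper \<sigma>" and inv: "\<forall>n. \<forall>y\<in>S. it n y \<in> S"
    and I: "I = {a \<in> l1. \<forall>n. \<forall>y\<in>S. apply_bcontfun (a n) y = 0}"
  shows "\<exists>(sc :: complex \<Rightarrow> ('x \<times> complex \<times> int \<Rightarrow> complex) \<Rightarrow> 'x \<times> complex \<times> int \<Rightarrow> complex) H ip \<pi>.
    involutive_rep \<sigma> sc H ip \<pi> \<and> unital_rep H \<pi> \<and> I = rep_kernel H \<pi>"
proof -
  let ?K = "(\<lambda>y. (y, 0 :: complex, 0 :: int)) ` S"
  interpret Q: orbit_rep \<sigma> ?K "\<lambda>n (y, z, k). (it n y, z, k)" fst "\<lambda>n k. 1"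
    by unfold_locales (auto simp: inv it_add)
  have "rep_kernel (l2_on ?K) Q.rep = I"
    unfolding I
  proof (subst Q.kernel_rep_free)
    show "n = 0" if "k \<in> ?K" "(case k of (y, z, k) \<Rightarrow> (it n y, z, k)) = k" for k n
      using that S it_inj_Aper[of _ n 0] by auto
  qed auto
  with Q.involutive_rep_rep Q.unital_rep_rep show ?thesis by blast
qed

end

section \<open>Dimension of the representation and size of the zero set\<close>

context irreducible_rep
begin

lemma finite_zero_set_periodic:
  assumes fin: "finite ker.zero_set"
  obtains x c where "x \<in> Per \<sigma>" "cmod c = 1" "periodic_ideal \<sigma> ker x c"
proof -
  obtain x where x: "x \<in> ker.zero_set" using zero_set_nonempty by blast
  have sub: "range (\<lambda>i. it i x) \<subseteq> ker.zero_set" using x by (auto simp: ker.zero_set_invariant)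
  have per: "x \<in> Per \<sigma>"
  proof (rule ccontr)
    assume "x \<notin> Per \<sigma>"
    then have "inj (\<lambda>i. it i x)" using it_inj_Aper by (auto simp: inj_def Aper_def)
    then have "infinite (range (\<lambda>i. it i x))" by (simp add: finite_image_iff infinite_UNIV_int)
    with finite_subset[OF sub fin] show False by blast
  qed
  have "ker.zero_set = (\<lambda>i. it i x) ` {0..<int (period \<sigma> x)}"
  \<comment> \<open>A finite zero set is discrete: removing its other points leaves a neighbourhood
    in which x is the only one, and x returns after its period.\<close>
  proof (rule zero_set_finite_orbit[of "- (ker.zero_set - {x})"])
    show "open (- (ker.zero_set - {x}))"
      using fin by (intro open_Compl finite_imp_closed) simp
  qed (use x period_pos[OF per] it_period[OF per] in auto)
  then have orbit: "ker.zero_set = range (\<lambda>i. it i x)" by (simp add: orbit_eq_period_image[OF per])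
  have "it (int (period \<sigma> x)) y = y" if "y \<in> ker.zero_set" for y
    using that unfolding orbit
    by (auto simp: it_eq_iff_mod_period[OF per] simp flip: it_add)
  then obtain c where "cmod c = 1"
    "l1_monom (const_bcontfun 1) (int (period \<sigma> x)) - l1_scale c l1_one \<in> ker"
    by (rule periodic_shift_scalar)
  with per orbit have "periodic_ideal \<sigma> ker x c" by unfold_locales
  with per \<open>cmod c = 1\<close> that show ?thesis by blast
qed

lemma rho_sum: "(\<And>i. i \<in> F \<Longrightarrow> a i \<in> l1) \<Longrightarrow> v \<in> E \<Longrightarrow> \<rho> (\<Sum>i\<in>F. a i) v = (\<Sum>i\<in>F. \<rho> (a i) v)"
proof (induction F rule: infinite_finite_induct)
  case (insert i F)
  then show ?case by (simp add: rho_add l1_sum del: plus_fun_apply minus_apply zero_fun_apply)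
qed (use rho_diff[OF l1_one_in l1_one_in, of v] in \<open>simp_all del: plus_fun_apply minus_apply
    zero_fun_apply\<close>)

text \<open>A function isolating x within the orbit produces a common eigenvector v of C(X). Modulo
  the kernel every element reduces to p monomials, so the p vectors \<delta>^j v span E.\<close>

lemma periodic_ker_fin_dim:
  assumes "periodic_ideal \<sigma> ker x c"
  shows "fin_dim sc E"
proof -
  interpret P: periodic_ideal \<sigma> ker x c by (rule assms)
  let ?O = "range (\<lambda>i. it i x)"
  have "closed (?O - {x})" using finite_orbit[OF P.x_Per] by (simp add: finite_imp_closed)
  then obtain f :: "'x \<Rightarrow>\<^sub>C complex" where f: "\<And>z. z \<in> {x} \<Longrightarrow> apply_bcontfun f z = 1"
    "\<And>z. z \<in> ?O - {x} \<Longrightarrow> apply_bcontfun f z = 0"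
    by (rule bump_function[of "{x}" "?O - {x}", rotated]) auto
  have xO: "x \<in> ?O" by (rule range_eqI[of _ _ 0]) simp
  then have "l1_embed f \<notin> ker" using f(1)[of x]
    by (metis ker.embed_in_iff P.zero_set_orbit singletonI zero_neq_one)
  then obtain u where u: "u \<in> E" "\<rho> (l1_embed f) u \<noteq> 0" by (auto simp: rep_kernel_def)
  define v where "v = \<rho> (l1_embed f) u"
  have v: "v \<in> E" "v \<noteq> 0" using u by (auto simp: v_def rho_in)
  have embed: "\<rho> (l1_embed g) v = sc (apply_bcontfun g x) v" for g
  proof -
    have "l1_mult \<sigma> (l1_embed g) (l1_embed f) - l1_scale (apply_bcontfun g x) (l1_embed f) \<in> ker"
    proof (rule ker.vanishing_in_ideal)
      show "l1_mult \<sigma> (l1_embed g) (l1_embed f) - l1_scale (apply_bcontfun g x) (l1_embed f) \<in> l1"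
        by (intro l1_diff l1_mult_in l1_scale_in l1_embed_in)
      fix n z assume "z \<in> ker.zero_set"
      then have "z \<noteq> x \<Longrightarrow> apply_bcontfun f z = 0" using f(2)[of z] by (auto simp: P.zero_set_orbit)
      then show "apply_bcontfun ((l1_mult \<sigma> (l1_embed g) (l1_embed f)
          - l1_scale (apply_bcontfun g x) (l1_embed f)) n) z = 0"
        unfolding l1_mult_embed_embed by (cases "z = x") (auto simp: l1_embed_def l1_scale_def)
    qed
    then have "\<rho> (l1_mult \<sigma> (l1_embed g) (l1_embed f)
        - l1_scale (apply_bcontfun g x) (l1_embed f)) u = 0"
      using u(1) by (simp add: rep_kernel_def)
    then show ?thesis
      using u(1) by (simp add: rho_diff rho_mult rho_scale l1_mult_in l1_scale_in v_def)
  qed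
  let ?e = "\<lambda>j. \<rho> (l1_monom (const_bcontfun 1) j) v"
  have monom: "\<rho> (l1_monom g j) v = sc (apply_bcontfun g (it j x)) (?e j)" for g j
  proof -
    have "const_bcontfun 1 * alpha_pow \<sigma> j (alpha_pow \<sigma> (- j) g) = g" by (rule bcontfun_eqI) simp
    then have "l1_monom g j = l1_mult \<sigma> (l1_monom (const_bcontfun 1) j) (l1_embed (alpha_pow \<sigma>
        (- j) g))"
      by (simp add: l1_embed_eq_monom l1_mult_monom_monom)
    then show ?thesis using v(1) by (simp add: rho_mult embed rho_scale_right)
  qed
  let ?B = "?e ` {0..<int P.p}"
  have B: "?B \<subseteq> E" using v(1) by (auto intro: rho_in)
  have "w \<in> span ?B" if w: "w \<in> E" for w
  proof -
    obtain a where a: "a \<in> l1" "\<rho> a v = w" by (rule rho_cyclic[OF v w])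
    have red: "cyc_reduce P.p c a \<in> l1" by (rule cyc_reduce_in[OF P.p_pos P.c_norm])
    have "\<rho> (a - cyc_reduce P.p c a) v = 0"
      using P.reduce_congruent[OF a(1)] v(1) by (simp add: rep_kernel_def)
    then have "w = \<rho> (cyc_reduce P.p c a) v"
      using rho_diff[OF a(1) red v(1)] a(2) by simp
    also have "\<dots> = (\<Sum>j\<in>{0..<int P.p}. sc (apply_bcontfun (cyc_coeff P.p c a j) (it j x)) (?e j))"
      unfolding cyc_reduce_def rho_sum[OF l1_monom_in v(1)] by (intro sum.cong refl monom)
    also have "\<dots> \<in> span ?B" by (intro span_sum span_scale span_base) auto
    finally show ?thesis .
  qed
  moreover have "span ?B \<subseteq> E" by (rule span_minimal[OF B subspace_E])
  ultimately have "span ?B = E" by blast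
  with B show ?thesis unfolding fin_dim_def by blast
qed

text \<open>Bump functions with disjoint supports act by nonzero operators with independent ranges.\<close>

lemma infinite_zero_set_not_fin_dim:
  assumes inf: "infinite ker.zero_set"
  shows "\<not> fin_dim sc E"
proof
  assume "fin_dim sc E"
  then obtain B where B: "finite B" "span B = E" by (auto simp: fin_dim_def)
  \<comment> \<open>One point more than the spanning set has elements, for the final comparison of
    cardinalities.\<close>
  obtain Y where Y: "Y \<subseteq> ker.zero_set" "finite Y" "card Y = Suc (card B)"
    using infinite_arbitrarily_large[OF inf] by blast
  have "\<exists>U V. open U \<and> open V \<and> y \<in> U \<and> z \<in> V \<and> U \<inter> V = {}" if "y \<noteq> z" for y z :: 'x
    by (rule hausdorff[OF that])
  then obtain A D where AD: "\<And>y z :: 'x. y \<noteq> z \<Longrightarrow> open (A y z)" "\<And>y z :: 'x. y \<noteq> z \<Longrightarrow> open (D y z)"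
    "\<And>y z. y \<noteq> z \<Longrightarrow> y \<in> A y z" "\<And>y z. y \<noteq> z \<Longrightarrow> z \<in> D y z" "\<And>y z. y \<noteq> z \<Longrightarrow> A y z \<inter> D y z = {}"
    by metis
  \<comment> \<open>For distinct y and z in Y the set W y lies in A y z and W z in D y z, so these
    neighbourhoods are pairwise disjoint.\<close>
  define W where "W y = (\<Inter>z\<in>Y - {y}. A y z \<inter> D z y)" for y
  have W: "open (W y)" "y \<in> W y" for y
  proof -
    have "open (A y z \<inter> D z y) \<and> y \<in> A y z \<inter> D z y" if "z \<in> Y - {y}" for z
      using that AD(1,3)[of y z] AD(2,4)[of z y] by auto
    then show "open (W y)" "y \<in> W y" unfolding W_def using Y(2) by (simp_all add: open_INT)
  qed
  have W_disj: "W y \<inter> W z = {}" if "y \<in> Y" "z \<in> Y" "y \<noteq> z" for y z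
    using that AD(5)[OF that(3)] unfolding W_def by blast
  have "\<exists>f :: 'x \<Rightarrow>\<^sub>C complex. apply_bcontfun f y = 1 \<and> (\<forall>z. z \<notin> W y \<longrightarrow> apply_bcontfun f z = 0)" for y
  proof -
    obtain f :: "'x \<Rightarrow>\<^sub>C complex" where "\<And>z. z \<in> {y} \<Longrightarrow> apply_bcontfun f z = 1"
      "\<And>z. z \<in> - W y \<Longrightarrow> apply_bcontfun f z = 0"
      by (rule bump_function[of "{y}" "- W y"]) (use W in auto)
    then show ?thesis by auto
  qed
  then obtain f :: "'x \<Rightarrow> 'x \<Rightarrow>\<^sub>C complex" where f: "\<And>y. apply_bcontfun (f y) y = 1"
    "\<And>y z. z \<notin> W y \<Longrightarrow> apply_bcontfun (f y) z = 0" by metis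
  have rho_ff: "\<rho> (l1_embed (f y)) (\<rho> (l1_embed (f z)) u)
      = \<rho> (l1_embed (f y * f z)) u" if "u \<in> E" for y z u
    using that by (simp add: rho_mult[symmetric] l1_mult_embed_embed)
  have orth: "\<rho> (l1_embed (f y * f z)) u = 0" if "y \<in> Y" "z \<in> Y" "y \<noteq> z" "u \<in> E" for y z u
  proof -
    have "l1_embed (f y * f z) \<in> ker"
      using W_disj[OF that(1-3)] f(2) by (auto simp: ker.embed_in_iff)
    then show ?thesis using that(4) by (simp add: rep_kernel_def)
  qed
  \<comment> \<open>The square ensures that the vector r y below, which already lies in the range of
    f y, is not killed by another application of f y.\<close>
  have "\<exists>u\<in>E. \<rho> (l1_embed (f y * f y)) u \<noteq> 0" if "y \<in> Y" for y
  proof -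
    have "l1_embed (f y * f y) \<notin> ker"
      using that Y(1) f(1)[of y] by (auto simp: ker.embed_in_iff intro!: bexI[of _ y])
    then show ?thesis by (auto simp: rep_kernel_def)
  qed
  then obtain u where u: "\<And>y. y \<in> Y \<Longrightarrow> u y \<in> E" "\<And>y. y \<in> Y \<Longrightarrow> \<rho> (l1_embed (f y * f y)) (u y) \<noteq> 0"
    by metis
  define r where "r y = \<rho> (l1_embed (f y)) (u y)" for y
  have r_in: "r y \<in> E" if "y \<in> Y" for y
    using u(1)[OF that] by (simp add: r_def rho_in)
  have r_same: "\<rho> (l1_embed (f y)) (r y) \<noteq> 0" if "y \<in> Y" for y
    using u[OF that] by (simp add: r_def rho_ff)
  have r_diff: "\<rho> (l1_embed (f y)) (r z) = 0" if "y \<in> Y" "z \<in> Y" "y \<noteq> z" for y z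
    using orth[OF that u(1)[OF that(2)]] u(1)[OF that(2)] by (simp add: r_def rho_ff)
  have inj: "inj_on r Y"
    using r_same r_diff by (metis inj_onI)
  have rho_sum_right: "\<rho> a (\<Sum>i\<in>F. g i) = (\<Sum>i\<in>F. \<rho> a (g i))"
    if "a \<in> l1" "\<And>i. i \<in> F \<Longrightarrow> g i \<in> E" for a F and g :: "'x \<Rightarrow> 'v"
    using that(2)
  proof (induction F rule: infinite_finite_induct)
    case (insert i F)
    then show ?case using that(1) by (simp add: rho_add_right subspace_sum[OF subspace_E])
  qed (use that(1) in auto)
  have "independent (r ` Y)"
  proof (rule independent_if_scalars_zero)
    show "finite (r ` Y)" using Y(2) by simp
    fix g w assume sum: "(\<Sum>w\<in>r ` Y. sc (g w) w) = 0" and "w \<in> r ` Y"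
    then obtain y where y: "y \<in> Y" "w = r y" by blast
    have "0 = \<rho> (l1_embed (f y)) (\<Sum>z\<in>Y. sc (g (r z)) (r z))"
      using sum by (simp add: sum.reindex[OF inj])
    also have "\<dots> = (\<Sum>z\<in>Y. \<rho> (l1_embed (f y)) (sc (g (r z)) (r z)))"
      by (rule rho_sum_right) (auto intro: subspace_scale[OF subspace_E] r_in)
    also have "\<dots> = (\<Sum>z\<in>Y. if z = y then sc (g (r y)) (\<rho> (l1_embed (f y)) (r y)) else 0)"
      using y(1) by (intro sum.cong refl) (auto simp: rho_scale_right r_in r_diff)
    also have "\<dots> = sc (g (r y)) (\<rho> (l1_embed (f y)) (r y))"
      using Y(2) y(1) by simp
    finally show "g w = 0" using r_same[OF y(1)] y(2) by simp
  qed
  moreover have "r ` Y \<subseteq> span B" using r_in B(2) by auto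
  ultimately have "card (r ` Y) \<le> card B"
    using independent_span_bound[OF B(1)] by blast
  then show False using card_image[OF inj] Y(3) by simp
qed

theorem kernel_fin_dim:
  assumes "fin_dim sc E"
  obtains x c where "x \<in> Per \<sigma>" "cmod c = 1" "periodic_ideal \<sigma> ker x c"
  using finite_zero_set_periodic infinite_zero_set_not_fin_dim assms by blast

text \<open>S consists of the aperiodic points of the zero set. The zero set is infinite, since a
  finite one would give finite dimension; were S finite it would be closed, and by density it would
  contain the zero set.\<close>

theorem kernel_inf_dim:
  assumes "\<not> fin_dim sc E"
  obtains S where "infinite S" "S \<subseteq> Aper \<sigma>" "\<forall>n. \<forall>y\<in>S. it n y \<in> S"
    "ker = {a \<in> l1. \<forall>n. \<forall>y\<in>S. apply_bcontfun (a n) y = 0}"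
    "metrizable_space (euclidean :: 'x topology) \<longrightarrow>
      (\<exists>x\<in>Aper \<sigma>. ker = {a \<in> l1. \<forall>n k. apply_bcontfun (a n) (it k x) = 0})"
proof -
  have inf: "infinite ker.zero_set"
    using finite_zero_set_periodic periodic_ker_fin_dim assms by blast
  let ?S = "ker.zero_set \<inter> Aper \<sigma>"
  show ?thesis
  proof (rule that[of ?S])
    show "infinite ?S"
    proof
      assume "finite ?S"
      then have "closure ?S = ?S" by (simp add: finite_imp_closed closure_closed)
      with Aper_dense[OF inf] \<open>finite ?S\<close> inf show False by (metis finite_subset)
    qed
    show "\<forall>n. \<forall>y\<in>?S. it n y \<in> ?S"
      by (simp add: ker.zero_set_invariant Aper_def Per_invariant)
    show "ker = {a \<in> l1. \<forall>n. \<forall>y\<in>?S. apply_bcontfun (a n) y = 0}"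
      by (rule ker_eq_dense[OF order_refl Aper_dense[OF inf]])
    show "metrizable_space (euclidean :: 'x topology) \<longrightarrow>
      (\<exists>x\<in>Aper \<sigma>. ker = {a \<in> l1. \<forall>n k. apply_bcontfun (a n) (it k x) = 0})"
    proof
      assume "metrizable_space (euclidean :: 'x topology)"
      then obtain x where x: "x \<in> ker.zero_set" "x \<in> Aper \<sigma>"
          "ker.zero_set \<subseteq> closure (range (\<lambda>n. it n x))"
        by (rule dense_orbit[OF inf])
      have "range (\<lambda>n. it n x) \<subseteq> ?S"
        using x(1,2) by (auto simp: ker.zero_set_invariant Aper_def Per_invariant)
      from ker_eq_dense[OF this x(3)] x(2)
      show "\<exists>x\<in>Aper \<sigma>. ker = {a \<in> l1. \<forall>n k. apply_bcontfun (a n) (it k x) = 0}"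
        by (intro bexI[of _ x]) auto
    qed
  qed auto
qed

end

section \<open>Assembling the description of primitive ideals\<close>

lemma irreducible_rep_intro:
  assumes "compact (UNIV :: 'x::t2_space set)" "homeomorphism UNIV UNIV \<sigma> (inv \<sigma>)"
    and "alg_irreducible (\<sigma> :: 'x \<Rightarrow> 'x) sc E \<rho>"
  shows "irreducible_rep \<sigma> sc E \<rho>"
proof -
  have "vector_space sc" using assms(3) by (simp add: alg_irreducible_def alg_rep_def)
  then interpret vector_space sc .
  show ?thesis by unfold_locales (use assms in auto)
qed

theorem theorem3p6:
  fixes \<sigma> :: "'x::t2_space \<Rightarrow> 'x" and I :: "(int \<Rightarrow> ('x \<Rightarrow>\<^sub>C complex)) set"
  assumes "compact (UNIV :: 'x set)"
    and "homeomorphism UNIV UNIV \<sigma> (inv \<sigma>)"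
    and "primitive_ideal TYPE('e::ab_group_add) \<sigma> I"
  shows
    "(kernel_of_fin_dim_irreducible TYPE('f::ab_group_add) \<sigma> I \<longrightarrow>
       (\<exists>x\<in>Per \<sigma>. \<exists>c\<in>sphere 0 1.
          I = rep_kernel (H_per (period \<sigma> x)) (pi_per \<sigma> x c) \<and>
          top_irreducible \<sigma> seq_scale (H_per (period \<sigma> x)) seq_ip (pi_per \<sigma> x c) \<and>
          fin_dim seq_scale (H_per (period \<sigma> x))))
     \<and> (kernel_of_inf_dim_irreducible TYPE('g::ab_group_add) \<sigma> I \<longrightarrow>
       (\<exists>S. infinite S \<and> \<sigma> ` S = S \<and>
          I = l1
            \<inter> (\<Inter>x\<in>Per \<sigma> \<inter> S. \<Inter>c\<in>sphere 0 1. rep_kernel (H_per (period \<sigma> x)) (pi_per \<sigma> x c))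
            \<inter> (\<Inter>x\<in>Aper \<sigma> \<inter> S. rep_kernel ell2 (pi_aper \<sigma> x)) \<and>
          (\<forall>x\<in>Per \<sigma> \<inter> S. \<forall>c\<in>sphere 0 1.
             top_irreducible \<sigma> seq_scale (H_per (period \<sigma> x)) seq_ip (pi_per \<sigma> x c) \<and>
             fin_dim seq_scale (H_per (period \<sigma> x))) \<and>
          (\<forall>x\<in>Aper \<sigma> \<inter> S. top_irreducible \<sigma> seq_scale ell2 seq_ip (pi_aper \<sigma> x)))
       \<and> (metrizable_space (euclidean :: 'x topology) \<longrightarrow>
          (\<exists>x\<in>Aper \<sigma>. I = rep_kernel ell2 (pi_aper \<sigma> x) \<and>
             top_irreducible \<sigma> seq_scale ell2 seq_ip (pi_aper \<sigma> x))))
     \<and> (\<exists>(sc :: complex \<Rightarrow> ('x \<times> complex \<times> int \<Rightarrow> complex) \<Rightarrow> ('x \<times> complex \<times> int \<Rightarrow> complex)) H ip \<pi>.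
          involutive_rep \<sigma> sc H ip \<pi> \<and> unital_rep H \<pi> \<and> I = rep_kernel H \<pi>)
     \<and> (metrizable_space (euclidean :: 'x topology) \<longrightarrow>
       (\<exists>(sc :: complex \<Rightarrow> (int \<Rightarrow> complex) \<Rightarrow> (int \<Rightarrow> complex)) H ip \<pi>.
          top_irreducible \<sigma> sc H ip \<pi> \<and> I = rep_kernel H \<pi>))"
proof -
  interpret dynamical_system \<sigma> by unfold_locales (rule assms)+
  have fin: "I = rep_kernel (H_per (period \<sigma> x)) (pi_per \<sigma> x c)"
    if "x \<in> Per \<sigma>" "cmod c = 1" "periodic_ideal \<sigma> I x c" for x c
    by (rule periodic_ideal_unique[OF that(3) periodic_ideal_per[OF that(1,2)]])
  obtain sc :: "complex \<Rightarrow> 'e \<Rightarrow> 'e" and E \<rho> where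
    irr: "alg_irreducible \<sigma> sc E \<rho>" and I: "I = rep_kernel E \<rho>"
    using assms(3) by (auto simp: primitive_ideal_def)
  interpret R: irreducible_rep \<sigma> sc E \<rho> by (rule irreducible_rep_intro[OF assms(1,2) irr])
  show ?thesis
  proof (intro conjI impI)
    \<comment> \<open>The representation in question lives on its own space and may differ from the
      one that makes I primitive, so its kernel is analysed separately.\<close>
    assume "kernel_of_fin_dim_irreducible TYPE('f) \<sigma> I"
    then obtain sc' :: "complex \<Rightarrow> 'f \<Rightarrow> 'f" and E' \<rho>' where
      irr': "alg_irreducible \<sigma> sc' E' \<rho>'" "fin_dim sc' E'" and I': "I = rep_kernel E' \<rho>'"
      by (auto simp: kernel_of_fin_dim_irreducible_def)
    obtain x c where x: "x \<in> Per \<sigma>" "cmod c = 1" "periodic_ideal \<sigma> I x c"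
      using irreducible_rep.kernel_fin_dim[OF irreducible_rep_intro[OF assms(1,2) irr'(1)] irr'(2)]
      unfolding I' by blast
    show "\<exists>x\<in>Per \<sigma>. \<exists>c\<in>sphere 0 1.
          I = rep_kernel (H_per (period \<sigma> x)) (pi_per \<sigma> x c) \<and>
          top_irreducible \<sigma> seq_scale (H_per (period \<sigma> x)) seq_ip (pi_per \<sigma> x c) \<and>
          fin_dim seq_scale (H_per (period \<sigma> x))"
      using x by (intro bexI[of _ x] bexI[of _ c] conjI fin top_irreducible_per fin_dim_H_per) auto
  next
    assume "kernel_of_inf_dim_irreducible TYPE('g) \<sigma> I"
    then obtain sc' :: "complex \<Rightarrow> 'g \<Rightarrow> 'g" and E' \<rho>' where
      irr': "alg_irreducible \<sigma> sc' E' \<rho>'" "\<not> fin_dim sc' E'" and I': "I = rep_kernel E' \<rho>'"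
      by (auto simp: kernel_of_inf_dim_irreducible_def)
    obtain S where S: "infinite S" "S \<subseteq> Aper \<sigma>" "\<forall>n. \<forall>y\<in>S. it n y \<in> S"
      "I = {a \<in> l1. \<forall>n. \<forall>y\<in>S. apply_bcontfun (a n) y = 0}"
      and metr: "metrizable_space (euclidean :: 'x topology) \<longrightarrow>
        (\<exists>x\<in>Aper \<sigma>. I = {a \<in> l1. \<forall>n k. apply_bcontfun (a n) (it k x) = 0})"
      unfolding I'
      by (rule irreducible_rep.kernel_inf_dim[OF irreducible_rep_intro[OF assms(1,2) irr'(1)] irr'(2)])
    \<comment> \<open>S has no periodic points, so the first intersection of the formula is over an
      empty family and imposes no condition.\<close>
    have disj: "Per \<sigma> \<inter> S = {}" "Aper \<sigma> \<inter> S = S" using S(2) by (auto simp: Aper_def)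
    have img: "\<sigma> ` S = S"
    proof
      show "\<sigma> ` S \<subseteq> S" using S(3)[THEN spec, of 1] by auto
      show "S \<subseteq> \<sigma> ` S"
      proof
        fix y assume "y \<in> S"
        with S(3) have "it (- 1) y \<in> S" by blast
        then show "y \<in> \<sigma> ` S"
          using it_Suc[of "- 1" y] by (intro image_eqI[of _ _ "it (- 1) y"]) auto
      qed
    qed
    have "(\<Inter>x\<in>S. rep_kernel ell2 (pi_aper \<sigma> x))
        = (\<Inter>x\<in>S. {a \<in> l1. \<forall>n k. apply_bcontfun (a n) (it k x) = 0})"
      using S(2) by (intro INF_cong refl rep_kernel_aper) blast
    moreover have "I = l1 \<inter> (\<Inter>x\<in>S. {a \<in> l1. \<forall>n k. apply_bcontfun (a n) (it k x) = 0})"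
      unfolding S(4)
    proof (intro equalityI subsetI)
      fix a :: "int \<Rightarrow> ('x \<Rightarrow>\<^sub>C complex)"
      assume a: "a \<in> l1 \<inter> (\<Inter>x\<in>S. {a \<in> l1. \<forall>n k. apply_bcontfun (a n) (it k x) = 0})"
      have "apply_bcontfun (a n) y = 0" if "y \<in> S" for n y
      proof -
        \<comment> \<open>The exponent 0 recovers the condition at y itself from the condition along
          its orbit.\<close>
        have "apply_bcontfun (a n) (it 0 y) = 0" using a that by blast
        then show ?thesis by simp
      qed
      with a show "a \<in> {a \<in> l1. \<forall>n. \<forall>y\<in>S. apply_bcontfun (a n) y = 0}" by blast
    qed (use S(3) in auto)
    ultimately have eq: "I = l1
            \<inter> (\<Inter>x\<in>Per \<sigma> \<inter> S. \<Inter>c\<in>sphere 0 1. rep_kernel (H_per (period \<sigma> x)) (pi_per \<sigma> x c))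
            \<inter> (\<Inter>x\<in>Aper \<sigma> \<inter> S. rep_kernel ell2 (pi_aper \<sigma> x))"
      unfolding disj by simp
    show "\<exists>S. infinite S \<and> \<sigma> ` S = S \<and>
          I = l1
            \<inter> (\<Inter>x\<in>Per \<sigma> \<inter> S. \<Inter>c\<in>sphere 0 1. rep_kernel (H_per (period \<sigma> x)) (pi_per \<sigma> x c))
            \<inter> (\<Inter>x\<in>Aper \<sigma> \<inter> S. rep_kernel ell2 (pi_aper \<sigma> x)) \<and>
          (\<forall>x\<in>Per \<sigma> \<inter> S. \<forall>c\<in>sphere 0 1.
             top_irreducible \<sigma> seq_scale (H_per (period \<sigma> x)) seq_ip (pi_per \<sigma> x c) \<and>
             fin_dim seq_scale (H_per (period \<sigma> x))) \<and>
          (\<forall>x\<in>Aper \<sigma> \<inter> S. top_irreducible \<sigma> seq_scale ell2 seq_ip (pi_aper \<sigma> x))"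
      by (intro exI[of _ S] conjI ballI S(1) img eq top_irreducible_aper top_irreducible_per
          fin_dim_H_per)
         auto
    assume "metrizable_space (euclidean :: 'x topology)"
    from metr[THEN mp, OF this] show "\<exists>x\<in>Aper \<sigma>. I = rep_kernel ell2 (pi_aper \<sigma> x) \<and>
             top_irreducible \<sigma> seq_scale ell2 seq_ip (pi_aper \<sigma> x)"
      by (simp add: rep_kernel_aper top_irreducible_aper cong: bex_cong)
  next
    show "\<exists>(sc :: complex \<Rightarrow> ('x \<times> complex \<times> int \<Rightarrow> complex) \<Rightarrow> ('x \<times> complex \<times> int \<Rightarrow> complex)) H ip \<pi>.
          involutive_rep \<sigma> sc H ip \<pi> \<and> unital_rep H \<pi> \<and> I = rep_kernel H \<pi>"
    proof (cases "fin_dim sc E")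
      case True
      then obtain x c where "x \<in> Per \<sigma>" "cmod c = 1" "periodic_ideal \<sigma> I x c"
        using R.kernel_fin_dim unfolding I by blast
      then show ?thesis by (rule periodic_representation)
    next
      case False
      then obtain S where "S \<subseteq> Aper \<sigma>" "\<forall>n. \<forall>y\<in>S. it n y \<in> S"
        "I = {a \<in> l1. \<forall>n. \<forall>y\<in>S. apply_bcontfun (a n) y = 0}"
        unfolding I by (rule R.kernel_inf_dim)
      then show ?thesis by (rule aperiodic_representation)
    qed
  next
    assume metr: "metrizable_space (euclidean :: 'x topology)"
    show "\<exists>(sc :: complex \<Rightarrow> (int \<Rightarrow> complex) \<Rightarrow> (int \<Rightarrow> complex)) H ip \<pi>.
          top_irreducible \<sigma> sc H ip \<pi> \<and> I = rep_kernel H \<pi>"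
    proof (cases "fin_dim sc E")
      case True
      then obtain x c where "x \<in> Per \<sigma>" "cmod c = 1" "periodic_ideal \<sigma> I x c"
        using R.kernel_fin_dim unfolding I by blast
      then show ?thesis using fin top_irreducible_per by blast
    next
      case False
      then have "metrizable_space (euclidean :: 'x topology) \<longrightarrow>
          (\<exists>x\<in>Aper \<sigma>. I = {a \<in> l1. \<forall>n k. apply_bcontfun (a n) (it k x) = 0})"
        unfolding I by (rule R.kernel_inf_dim)
      with metr obtain x where x: "x \<in> Aper \<sigma>" "I = {a \<in> l1. \<forall>n k. apply_bcontfun (a n) (it k x) = 0}"
        by blast
      show ?thesis
        by (intro exI conjI) (rule top_irreducible_aper[OF x(1)], simp add: x(2) rep_kernel_aper[OF
            x(1)])
    qed
  qed
qed

end
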